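(* Let $\eta$ be a stationary Poisson process on $\mathbb{R}^d$ ($d\geq 1$) with intensity measure $\lambda_d$, let $u>0$, and let $g:\mathbb{R}^d\to\mathbb{R}$ be a continuous integrable function with $g(0)>0$. Let $$f_\eta(x)=\sum_{y\in\eta}g(x-y),\quad x\in\mathbb{R}^d,\qquad F_s=\lambda_d(\{x\in B^d(0,s): f_\eta(x)\geq u\}),\quad s\geq 1.$$ a) Suppose that there exist constants $\underline{c}_g,\overline{c}_g,\delta,\gamma>0$ and $c_g\geq 1$ such that $\delta+d/2>\gamma\geq\delta>3d$ and $$\underline{c}_g\lVert x \rVert^{-\gamma}\leq |g(x)|\leq \overline{c}_g\lVert x\rVert^{-\delta}$$ for all $x\in\mathbb{R}^d$ with $\lVert x\rVert\geq c_g$. Then there exists a constant $c>0$ such that $\mathrm{Var}[F_s]\geq cs^d$ for all $s\geq 1$. b) Suppose that $g$ has compact support. Then there exists a constant $c>0$ such that $\mathrm{Var}[F_s]\geq cs^d$ for all $s\geq 1$.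
   Context: $\lambda_d$ is $d$-dimensional Lebesgue measure and $B^d(0,s)$ is the closed Euclidean ball with centre $0$ and radius $s$. The point process $\eta$ is identified with the random set of its points. $(f_\eta(x))_{x\in\mathbb{R}^d}$ is called a Poisson shot noise process and $F_s$ is the volume of its excursion set at level $u$ in the observation window $B^d(0,s)$. *)

theory Defs
  imports "HOL-Probability.Probability"
begin

text \<open>A point process is identified with the random set of its points; the number of points of
  \<open>E\<close> in \<open>B\<close> is the counting measure of \<open>E \<inter> B\<close>, which may be infinite.\<close>

definition num_points :: "'a set \<Rightarrow> 'a set \<Rightarrow> ennreal" where
  "num_points E B = emeasure (count_space UNIV) (E \<inter> B)"

text \<open>A Poisson process with intensity measure \<open>\<Lambda>\<close>, for \<open>\<Lambda>\<close> locally finite and without atoms (such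
  as \<open>lborel\<close>), so that the process has no multiple points and can be encoded by a random set.
  Every realisation is locally finite, as for a random element of the space of locally finite
  simple counting measures. If \<open>\<Lambda> B = \<infinity>\<close>, Poisson distributed with parameter \<open>\<infinity>\<close> means almost
  surely infinite.\<close>

definition poisson_process ::
  "'w measure \<Rightarrow> 'a::euclidean_space measure \<Rightarrow> ('w \<Rightarrow> 'a set) \<Rightarrow> bool" where
  "poisson_process M \<Lambda> \<eta> \<longleftrightarrow>
     prob_space M \<and>
     (\<forall>\<omega>\<in>space M. \<forall>B. bounded B \<longrightarrow> finite (\<eta> \<omega> \<inter> B)) \<and>
     (\<forall>B\<in>sets borel. (\<lambda>\<omega>. num_points (\<eta> \<omega>) B) \<in> borel_measurable M) \<and>
     (\<forall>B\<in>sets borel. emeasure \<Lambda> B < \<infinity> \<longrightarrow>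
        (\<forall>k::nat. measure M {\<omega>\<in>space M. num_points (\<eta> \<omega>) B = of_nat k} =
           measure \<Lambda> B ^ k / fact k * exp (- measure \<Lambda> B))) \<and>
     (\<forall>B\<in>sets borel. emeasure \<Lambda> B = \<infinity> \<longrightarrow> (AE \<omega> in M. num_points (\<eta> \<omega>) B = \<infinity>)) \<and>
     (\<forall>(I::nat set) B. finite I \<longrightarrow> (\<forall>i\<in>I. B i \<in> sets borel) \<longrightarrow> disjoint_family_on B I \<longrightarrow>
        prob_space.indep_vars M (\<lambda>_. borel) (\<lambda>i \<omega>. num_points (\<eta> \<omega>) (B i)) I)"

lemma num_points_translation: "num_points ((+) x ` E) B = num_points E ((+) (- x) ` B)"
  for x :: "'a::euclidean_space"
proof -
  have "(+) x ` E \<inter> B = (+) x ` (E \<inter> (+) (- x) ` B)"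
    by (force simp: image_iff)
  moreover have "emeasure (count_space UNIV) ((+) x ` A) = emeasure (count_space UNIV) A" for A
    by (simp add: emeasure_count_space finite_image_iff card_image)
  ultimately show ?thesis
    by (simp add: num_points_def)
qed

text \<open>With intensity measure \<open>lborel\<close> the process is stationary: every translate of it is again a
  Poisson process with the same intensity measure.\<close>

lemma poisson_process_lborel_translation:
  fixes x :: "'a::euclidean_space"
  assumes "poisson_process M (lborel :: 'a measure) \<eta>"
  shows "poisson_process M (lborel :: 'a measure) (\<lambda>\<omega>. (+) x ` \<eta> \<omega>)"
proof -
  have vim: "(+) (- x) ` B = (+) x -` B" for B
    by (force simp: image_iff)
  have s: "(+) (- x) ` B \<in> sets borel" if "B \<in> sets borel" for B :: "'a set"
    unfolding vim using measurable_sets[OF _ that, of "(+) x" borel] by simp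
  have e: "emeasure lborel ((+) (- x) ` B) = emeasure lborel B" if B: "B \<in> sets borel" for B :: "'a set"
  proof -
    have "emeasure lborel B = emeasure (distr lborel borel ((+) x)) B"
      by (simp add: lborel_distr_plus)
    also have "\<dots> = emeasure lborel ((+) (- x) ` B)"
      unfolding vim using B by (subst emeasure_distr) auto
    finally show ?thesis by simp
  qed
  then have m: "measure lborel ((+) (- x) ` B) = measure lborel B" if "B \<in> sets borel" for B :: "'a set"
    using that by (simp add: measure_def)
  have f: "finite ((+) x ` E \<inter> B)" if "\<forall>B. bounded B \<longrightarrow> finite (E \<inter> B)" "bounded B" for E B :: "'a set"
  proof -
    have "(+) x ` E \<inter> B = (+) x ` (E \<inter> (+) (- x) ` B)"
      by (force simp: image_iff)
    then show ?thesis
      using that bounded_translation[of B "- x"] by simp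
  qed
  have d: "disjoint_family_on (\<lambda>i. (+) (- x) ` B i) I" if "disjoint_family_on B I" for B :: "nat \<Rightarrow> 'a set" and I
    using that unfolding vim disjoint_family_on_def by blast
  show ?thesis
    using assms unfolding poisson_process_def num_points_translation
    by (intro conjI; (elim conjE)?) (use s e m f d in \<open>auto 0 3\<close>)
qed

text \<open>\<open>f\<^sub>\<eta>(x)\<close>; the sum over the points is understood as an absolutely convergent (unordered) sum.
  For integrable \<open>g\<close> it converges for almost every \<open>x\<close>, almost surely; where it does not, \<open>infsum\<close> is \<open>0\<close>.\<close>

definition shot_noise :: "('a::euclidean_space \<Rightarrow> real) \<Rightarrow> 'a set \<Rightarrow> 'a \<Rightarrow> real" where
  "shot_noise g E x = (\<Sum>\<^sub>\<infinity>y\<in>E. g (x - y))"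

definition excursion_volume :: "('a::euclidean_space \<Rightarrow> real) \<Rightarrow> real \<Rightarrow> 'a set \<Rightarrow> real \<Rightarrow> real" where
  "excursion_volume g u E s = measure lborel {x \<in> cball 0 s. shot_noise g E x \<ge> u}"

end

(*
  For z in a grid of points of B(0,s) let Q_z be a small and C_z a large ball around z, the C_z pairwise
  disjoint, and let
    Y_z = 1{no point in C_z - Q_z} (1{k points in Q_z} / p_k - 1{no point in Q_z} / p_0),
  where p_j is the probability of j points in Q_z. The Y_z are centred, uncorrelated and have a common
  variance, so by Bessel's inequality Var F_s is at least a constant times the number of grid points (of
  order s^d) as soon as E[F_s Y_z] is bounded below by a positive constant. On {no point in C_z - Q_z} the
  field f is the shot noise X of the points outside C_z, which is independent of the points inside, plus
  the contribution of the points in Q_z. For x in Q_z, k points there lift f(x) above u as soon as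
  |X(x)| < u, which gives a positive contribution to E[F_s Y_z]. What k points in Q_z may destroy
  elsewhere has to be negligible.
  If g has compact support then X(x) = 0 < u wherever Q_z has an influence, and nothing is lost. In the
  other case, let R be the radius of C_z and w = x - z. For |w| <= R - sqrt R Markov's inequality bounds
  P(|X(x)| >= u) by a multiple of R^((d - delta)/2), and delta > 3d makes the integral over these w small.
  For larger |w| one needs P(u <= X(x) <= u + O(|w|^(-delta))) = O(|w|^(-delta)), that is, a bounded
  density of X(x). It follows from the decay of the characteristic function:
    |E exp(i t X(x))| <= exp(- integral over D of (1 - cos(t g(x - y))) dy)
  for a ball D of radius of order r at distance r from x, r^delta = cu |t|, on the side averted from z. The
  integral over D is at least a multiple of |t|^(2 + (d - 2 gamma)/delta), where the exponent is positive
  because gamma < delta + d/2.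
*)
theory Submission
  imports Defs "HOL-Real_Asymp.Real_Asymp"
begin

section \<open>The counting measure of the process\<close>

text \<open>As g may change sign, points added to Q_z can lower f, so the sign of E[F_s Y_z] is not
  evident. It follows from one pointwise inequality: if m is a lower bound of g(x - y) over y in
  Q_z, then P(X(x) + k m >= u) - P(X(x) >= u) has to be at least 1/2 1{x in Q_z} - beta(x - z),
  where the integral of beta is at most a quarter of the volume of Q_z. The two parts of the theorem
  differ only in the choice of beta, k and R; for compact support beta = 0. Under power decay the
  order of the choices matters: g near 0 fixes r and k, the decay of g fixes the density constants,
  and only then R is made large. If x lies at depth b inside C_z, the ball D outside C_z is at
  distance at least b from x, so there is no decay for |t| below a multiple of b^delta. The density
  bound thus deteriorates with the depth, which is why Markov's inequality takes over at depth sqrt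
  R. The two regions then cost R^d R^((d - delta)/2) and R^(delta/2) R^(d - delta).\<close>

lemma nn_integral_eq_SUP_cball:
  fixes f :: "'a::euclidean_space \<Rightarrow> ennreal"
  assumes "sets K = sets borel" and [measurable]: "f \<in> borel_measurable borel"
  shows "(\<integral>\<^sup>+y. f y \<partial>K) = (SUP n. \<integral>\<^sup>+y. f y * indicator (cball 0 (real n)) y \<partial>K)"
proof -
  note [measurable_cong] = assms(1)
  have "(SUP n. f y * indicator (cball 0 (real n)) y) = f y" for y
  proof (rule antisym)
    show "(SUP n. f y * indicator (cball 0 (real n)) y) \<le> f y"
      by (rule SUP_least) (auto simp: indicator_def)
    obtain n :: nat where "norm y \<le> real n" using real_arch_simple by blast
    then show "f y \<le> (SUP n. f y * indicator (cball 0 (real n)) y)"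
      by (intro SUP_upper2[of n]) auto
  qed
  then have "(\<integral>\<^sup>+y. f y \<partial>K) = (\<integral>\<^sup>+y. (SUP n. f y * indicator (cball 0 (real n)) y) \<partial>K)" by simp
  also have "\<dots> = (SUP n. \<integral>\<^sup>+y. f y * indicator (cball 0 (real n)) y \<partial>K)"
  proof (rule nn_integral_monotone_convergence_SUP)
    show "incseq (\<lambda>n y. f y * indicator (cball 0 (real n)) y)"
      by (auto simp: incseq_def le_fun_def indicator_def)
    have [measurable]: "cball (0::'a) (real n) \<in> sets borel" for n by simp
    show "(\<lambda>y. f y * indicator (cball 0 (real n)) y) \<in> borel_measurable K" for n
      by measurable
  qed
  finally show ?thesis .
qed

locale poisson_lborel =
  fixes M :: "'w measure" and \<eta> :: "'w \<Rightarrow> 'a::euclidean_space set"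
  assumes poisson: "poisson_process M (lborel :: 'a measure) \<eta>"
begin

sublocale prob_space M
  using poisson by (simp add: poisson_process_def)

text \<open>A count in \<open>nat\<close> is convenient for powers and case distinctions, but
  \<open>card\<close> is 0 on infinite sets; agreement with \<open>num_points\<close> is guaranteed
  only on bounded sets, hence the recurring boundedness assumptions.\<close>

definition npt :: "'a set \<Rightarrow> 'w \<Rightarrow> nat" where
  "npt B \<omega> = card (\<eta> \<omega> \<inter> B)"

text \<open>As a measure on the Borel sets the point set turns the shot noise into a Bochner
  integral, to which dominated convergence and Campbell's formula apply.\<close>

definition N :: "'w \<Rightarrow> 'a measure" where
  "N \<omega> = distr (count_space (\<eta> \<omega>)) borel (\<lambda>y. y)"

lemma finite_points: "\<omega> \<in> space M \<Longrightarrow> bounded B \<Longrightarrow> finite (\<eta> \<omega> \<inter> B)"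
  using poisson by (auto simp: poisson_process_def)

lemma num_points_measurable [measurable]:
  "B \<in> sets borel \<Longrightarrow> (\<lambda>\<omega>. num_points (\<eta> \<omega>) B) \<in> borel_measurable M"
  using poisson by (auto simp: poisson_process_def)

lemma num_points_eq_npt: "\<omega> \<in> space M \<Longrightarrow> bounded B \<Longrightarrow> num_points (\<eta> \<omega>) B = of_nat (npt B \<omega>)"
  using finite_points[of \<omega> B] by (simp add: num_points_def npt_def)

lemma npt_measurable [measurable]:
  assumes "B \<in> sets borel" "bounded B"
  shows "npt B \<in> M \<rightarrow>\<^sub>M count_space UNIV"
proof (subst measurable_count_space_eq2_countable, intro conjI ballI)
  fix k :: nat
  have "npt B -` {k} \<inter> space M = {\<omega>\<in>space M. num_points (\<eta> \<omega>) B = of_nat k}"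
    using assms by (auto simp: num_points_eq_npt)
  also have "\<dots> \<in> sets M"
    using assms by measurable
  finally show "npt B -` {k} \<inter> space M \<in> sets M" .
qed auto

lemma prob_npt:
  assumes "B \<in> sets borel" "bounded B"
  shows "prob {\<omega>\<in>space M. npt B \<omega> = k} = measure lborel B ^ k / fact k * exp (- measure lborel B)"
proof -
  have "{\<omega>\<in>space M. npt B \<omega> = k} = {\<omega>\<in>space M. num_points (\<eta> \<omega>) B = of_nat k}"
    using assms by (auto simp: num_points_eq_npt)
  then show ?thesis
    using poisson assms emeasure_bounded_finite[of B]
    by (simp add: poisson_process_def)
qed

lemma distr_npt:
  assumes [measurable]: "B \<in> sets borel" and "bounded B"
  shows "distr M (count_space UNIV) (npt B) =
    density (count_space UNIV) (\<lambda>k. ennreal (measure lborel B ^ k / fact k * exp (- measure lborel B)))"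
proof (rule measure_eqI_countable[where A=UNIV])
  fix k :: nat
  have [measurable]: "npt B \<in> M \<rightarrow>\<^sub>M count_space UNIV" using assms by simp
  have "npt B -` {k} \<inter> space M = {\<omega>\<in>space M. npt B \<omega> = k}" by auto
  then show "emeasure (distr M (count_space UNIV) (npt B)) {k} =
    emeasure (density (count_space UNIV) (\<lambda>k. ennreal (measure lborel B ^ k / fact k * exp (- measure lborel B)))) {k}"
    using prob_npt[OF assms, of k]
    by (subst emeasure_density) (simp_all add: emeasure_distr emeasure_eq_measure)
qed auto

text \<open>The generating function of the Poisson law, for complex z because it is applied to z =
  exp(i t a) with a value a of the integrand.\<close>

lemma expectation_power_npt:
  fixes z :: complex
  assumes B: "B \<in> sets borel" "bounded B" and z: "norm z \<le> 1"
  shows "integrable M (\<lambda>\<omega>. z ^ npt B \<omega>)"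
    and "(\<integral>\<omega>. z ^ npt B \<omega> \<partial>M) = exp (complex_of_real (measure lborel B) * (z - 1))"
proof -
  have [measurable]: "npt B \<in> M \<rightarrow>\<^sub>M count_space UNIV" using B by simp
  define L where "L = measure lborel B"
  have L0: "L \<ge> 0" by (simp add: L_def)
  let ?p = "\<lambda>k. L ^ k / fact k * exp (- L)"
  have p0: "?p k \<ge> 0" for k using L0 by simp
  show "integrable M (\<lambda>\<omega>. z ^ npt B \<omega>)"
    using z by (intro integrable_const_bound[where B=1]) (auto simp: norm_power power_le_one)
  have "(\<integral>\<omega>. z ^ npt B \<omega> \<partial>M) = (\<integral>k. z ^ k \<partial>distr M (count_space UNIV) (npt B))"
    by (subst integral_distr) auto
  also have "\<dots> = (\<integral>k. ?p k *\<^sub>R z ^ k \<partial>count_space UNIV)"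
    unfolding distr_npt[OF B] L_def[symmetric]
    by (subst integral_density) (auto intro!: AE_I2 simp: L0)
  also have "\<dots> = (\<Sum>k. ?p k *\<^sub>R z ^ k)"
  proof (rule integral_count_space_nat)
    have "summable (\<lambda>k. norm (?p k *\<^sub>R z ^ k))"
    proof (rule summable_comparison_test')
      show "summable (\<lambda>k. L ^ k / fact k * exp (- L))"
        using summable_exp[of L] by (intro summable_mult2) (simp add: field_simps)
      show "norm (norm (?p k *\<^sub>R z ^ k)) \<le> ?p k" if "k \<ge> 0" for k
        using mult_left_le[OF power_le_one[OF norm_ge_zero z] p0[of k], of k] p0[of k] by (simp add: norm_power L0)
    qed
    then show "integrable (count_space UNIV) (\<lambda>k. ?p k *\<^sub>R z ^ k)"
      by (simp add: integrable_count_space_nat_iff)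
  qed
  also have "\<dots> = exp (of_real L * (z - 1))"
  proof (rule sums_unique[symmetric])
    have "(\<lambda>k. (of_real L * z) ^ k /\<^sub>R fact k) sums exp (of_real L * z)"
      by (rule exp_converges)
    then have "(\<lambda>k. ((of_real L * z) ^ k /\<^sub>R fact k) * exp (- of_real L)) sums (exp (of_real L * z) * exp (- of_real L))"
      by (rule sums_mult2)
    moreover have "((of_real L * z) ^ k /\<^sub>R fact k) * exp (- of_real L) = ?p k *\<^sub>R z ^ k" for k
      by (simp add: scaleR_conv_of_real power_mult_distrib field_simps exp_of_real[symmetric])
    moreover have "exp (of_real L * z) * exp (- of_real L) = exp (of_real L * (z - 1))"
      by (simp add: exp_add[symmetric] algebra_simps)
    ultimately show "(\<lambda>k. ?p k *\<^sub>R z ^ k) sums exp (of_real L * (z - 1))" by simp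
  qed
  finally show "(\<integral>\<omega>. z ^ npt B \<omega> \<partial>M) = exp (complex_of_real (measure lborel B) * (z - 1))"
    by (simp add: L_def)
qed

lemma nn_integral_npt:
  assumes B: "B \<in> sets borel" "bounded B"
  shows "(\<integral>\<^sup>+\<omega>. of_nat (npt B \<omega>) \<partial>M) = emeasure lborel B"
proof -
  have [measurable]: "npt B \<in> M \<rightarrow>\<^sub>M count_space UNIV" using B by simp
  define L where "L = measure lborel B"
  have L0: "L \<ge> 0" by (simp add: L_def)
  let ?p = "\<lambda>k. L ^ k / fact k * exp (- L)"
  have p0: "?p k \<ge> 0" for k using L0 by simp
  have "(\<integral>\<^sup>+\<omega>. of_nat (npt B \<omega>) \<partial>M) = (\<integral>\<^sup>+k. of_nat k \<partial>distr M (count_space UNIV) (npt B))"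
    by (subst nn_integral_distr) auto
  also have "\<dots> = (\<integral>\<^sup>+k. ennreal (?p k) * of_nat k \<partial>count_space UNIV)"
    unfolding distr_npt[OF B] L_def[symmetric]
    by (subst nn_integral_density) auto
  also have "\<dots> = (\<Sum>k. ennreal (?p k * real k))"
    unfolding nn_integral_count_space_nat
    by (intro suminf_cong) (simp only: ennreal_mult''[OF of_nat_0_le_iff] ennreal_of_nat_eq_real_of_nat)
  also have "\<dots> = ennreal L"
  proof (rule suminf_ennreal_eq)
    have "(\<lambda>k. L ^ k /\<^sub>R fact k) sums exp L"
      by (rule exp_converges)
    then have "(\<lambda>k. (L ^ k /\<^sub>R fact k) * (L * exp (- L))) sums (exp L * (L * exp (- L)))"
      by (rule sums_mult2)
    moreover have "(L ^ k /\<^sub>R fact k) * (L * exp (- L)) = ?p (Suc k) * real (Suc k)" for k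
      by (simp add: divide_simps del: of_nat_Suc)
    moreover have "exp L * (L * exp (- L)) = L"
      by (simp add: exp_minus)
    ultimately have "(\<lambda>k. ?p (Suc k) * real (Suc k)) sums L" by simp
    then show "(\<lambda>k. ?p k * real k) sums L"
      using sums_Suc[of "\<lambda>k. ?p k * real k" L] by simp
  qed (simp add: p0 L0)
  also have "\<dots> = emeasure lborel B"
    unfolding L_def using emeasure_bounded_finite[of B] B
    by (simp add: emeasure_eq_ennreal_measure)
  finally show ?thesis .
qed

text \<open>Carries the independence of extended real counts indexed by naturals over to functions
  of natural counts with an arbitrary finite index set.\<close>

lemma expectation_prod_npt:
  fixes \<phi> :: "'i \<Rightarrow> nat \<Rightarrow> 'b::{real_normed_field,banach,second_countable_topology}"
  assumes J: "finite J" and B: "\<And>j. j \<in> J \<Longrightarrow> B j \<in> sets borel" "\<And>j. j \<in> J \<Longrightarrow> bounded (B j)"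
    and disj: "disjoint_family_on B J"
    and int: "\<And>j. j \<in> J \<Longrightarrow> integrable M (\<lambda>\<omega>. \<phi> j (npt (B j) \<omega>))"
  shows "(\<integral>\<omega>. (\<Prod>j\<in>J. \<phi> j (npt (B j) \<omega>)) \<partial>M) = (\<Prod>j\<in>J. \<integral>\<omega>. \<phi> j (npt (B j) \<omega>) \<partial>M)"
proof -
  obtain h where h: "bij_betw h {..<card J} J"
    using ex_bij_betw_nat_finite[OF J] by (auto simp: atLeast0LessThan)
  let ?I = "{..<card J}"
  have hJ: "h i \<in> J" if "i \<in> ?I" for i
    using h that by (auto simp: bij_betw_def)
  have dj: "disjoint_family_on (\<lambda>i. B (h i)) ?I"
    unfolding disjoint_family_on_def
  proof (intro ballI impI)
    fix m n assume "m \<in> ?I" "n \<in> ?I" "m \<noteq> n"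
    then have "h m \<noteq> h n" using h by (auto simp: bij_betw_def inj_on_def)
    then show "B (h m) \<inter> B (h n) = {}"
      using disj hJ \<open>m \<in> ?I\<close> \<open>n \<in> ?I\<close> by (auto simp: disjoint_family_on_def)
  qed
  have "\<forall>(I::nat set) B. finite I \<longrightarrow> (\<forall>i\<in>I. B i \<in> sets borel) \<longrightarrow> disjoint_family_on B I \<longrightarrow>
        indep_vars (\<lambda>_. borel) (\<lambda>i \<omega>. num_points (\<eta> \<omega>) (B i)) I"
    using poisson unfolding poisson_process_def by (elim conjE)
  from this[rule_format, of ?I "\<lambda>i. B (h i)"]
  have ind: "indep_vars (\<lambda>_. borel) (\<lambda>i \<omega>. num_points (\<eta> \<omega>) (B (h i))) ?I"
    using dj B hJ by simp
  \<comment> \<open>\<open>nat \<lfloor>enn2real x\<rfloor>\<close> is a Borel left inverse of the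
    embedding of \<open>nat\<close> into \<open>ennreal\<close>.\<close>
  define \<psi> where "\<psi> i x = \<phi> (h i) (nat \<lfloor>enn2real x\<rfloor>)" for i and x :: ennreal
  have [measurable]: "\<psi> i \<in> borel_measurable borel" for i
    unfolding \<psi>_def by measurable
  have \<psi>: "\<psi> i (num_points (\<eta> \<omega>) (B (h i))) = \<phi> (h i) (npt (B (h i)) \<omega>)" if "\<omega> \<in> space M" "i \<in> ?I" for i \<omega>
    using that B hJ by (simp add: \<psi>_def num_points_eq_npt ennreal_of_nat_eq_real_of_nat)
  have ind2: "indep_vars (\<lambda>_. borel) (\<lambda>i \<omega>. \<psi> i (num_points (\<eta> \<omega>) (B (h i)))) ?I"
    by (rule indep_vars_compose2[OF ind]) auto
  have "(\<integral>\<omega>. (\<Prod>j\<in>J. \<phi> j (npt (B j) \<omega>)) \<partial>M) = (\<integral>\<omega>. (\<Prod>i\<in>?I. \<psi> i (num_points (\<eta> \<omega>) (B (h i)))) \<partial>M)"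
  proof (intro Bochner_Integration.integral_cong refl)
    fix \<omega> assume \<omega>: "\<omega> \<in> space M"
    have "(\<Prod>j\<in>J. \<phi> j (npt (B j) \<omega>)) = (\<Prod>i\<in>?I. \<phi> (h i) (npt (B (h i)) \<omega>))"
      by (rule prod.reindex_bij_betw[OF h, symmetric])
    also have "\<dots> = (\<Prod>i\<in>?I. \<psi> i (num_points (\<eta> \<omega>) (B (h i))))"
      by (intro prod.cong refl) (simp add: \<psi> \<omega>)
    finally show "(\<Prod>j\<in>J. \<phi> j (npt (B j) \<omega>)) = (\<Prod>i\<in>?I. \<psi> i (num_points (\<eta> \<omega>) (B (h i))))" .
  qed
  also have "\<dots> = (\<Prod>i\<in>?I. \<integral>\<omega>. \<psi> i (num_points (\<eta> \<omega>) (B (h i))) \<partial>M)"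
  proof (rule indep_vars_lebesgue_integral[OF _ ind2])
    fix i assume i: "i \<in> ?I"
    have "integrable M (\<lambda>\<omega>. \<psi> i (num_points (\<eta> \<omega>) (B (h i)))) \<longleftrightarrow> integrable M (\<lambda>\<omega>. \<phi> (h i) (npt (B (h i)) \<omega>))"
      using i by (intro Bochner_Integration.integrable_cong) (auto simp: \<psi>)
    then show "integrable M (\<lambda>\<omega>. \<psi> i (num_points (\<eta> \<omega>) (B (h i))))"
      using int[OF hJ[OF i]] by simp
  qed auto
  also have "\<dots> = (\<Prod>i\<in>?I. \<integral>\<omega>. \<phi> (h i) (npt (B (h i)) \<omega>) \<partial>M)"
    by (intro prod.cong Bochner_Integration.integral_cong refl) (auto simp: \<psi>)
  also have "\<dots> = (\<Prod>j\<in>J. \<integral>\<omega>. \<phi> j (npt (B j) \<omega>) \<partial>M)"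
    by (rule prod.reindex_bij_betw[OF h])
  finally show ?thesis .
qed

section \<open>The point set as a random measure\<close>

lemma sets_N [simp, measurable_cong]: "sets (N \<omega>) = sets borel"
  and space_N [simp]: "space (N \<omega>) = UNIV"
  by (simp_all add: N_def)

lemma emeasure_N: "B \<in> sets borel \<Longrightarrow> emeasure (N \<omega>) B = num_points (\<eta> \<omega>) B"
proof -
  assume B: "B \<in> sets borel"
  have "emeasure (N \<omega>) B = emeasure (count_space (\<eta> \<omega>)) (B \<inter> \<eta> \<omega>)"
    unfolding N_def using B by (subst emeasure_distr) auto
  also have "\<dots> = num_points (\<eta> \<omega>) B"
    by (simp add: num_points_def emeasure_count_space Int_commute)
  finally show ?thesis .
qed

lemma emeasure_N_bounded:
  "\<omega> \<in> space M \<Longrightarrow> B \<in> sets borel \<Longrightarrow> bounded B \<Longrightarrow> emeasure (N \<omega>) B = of_nat (npt B \<omega>)"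
  by (simp add: emeasure_N num_points_eq_npt)

lemma measure_N_bounded:
  "\<omega> \<in> space M \<Longrightarrow> B \<in> sets borel \<Longrightarrow> bounded B \<Longrightarrow> measure (N \<omega>) B = npt B \<omega>"
  by (simp add: emeasure_N_bounded measure_def ennreal_of_nat_eq_real_of_nat)

text \<open>Unordered summability of reals is absolute summability, so both sides are defined for
  the same point sets, and elsewhere both take the default value 0.\<close>

lemma infsum_eq_integral_N:
  fixes h :: "'a \<Rightarrow> real"
  assumes [measurable]: "h \<in> borel_measurable borel"
  shows "(\<Sum>\<^sub>\<infinity>y\<in>\<eta> \<omega>. h y) = (\<integral>y. h y \<partial>N \<omega>)"
proof -
  have eq: "(\<integral>y. h y \<partial>N \<omega>) = infsetsum h (\<eta> \<omega>)"
    unfolding N_def infsetsum_def by (subst integral_distr) auto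
  show ?thesis
  proof (cases "Infinite_Set_Sum.abs_summable_on h (\<eta> \<omega>)")
    case True
    then show ?thesis using eq by (simp add: infsetsum_infsum)
  next
    case False
    then have "\<not> h summable_on \<eta> \<omega>"
      using abs_summable_equivalent summable_on_iff_abs_summable_on_real by blast
    moreover have "infsetsum h (\<eta> \<omega>) = 0"
      using False by (rule not_summable_infsetsum_eq)
    ultimately show ?thesis using eq by (simp add: infsum_not_exists)
  qed
qed

text \<open>The kernel \<open>N\<close> is not a subprobability kernel; restricting it to a bounded set and dividing by the
  total mass plus one reduces the claim to the library's result on such kernels.\<close>

lemma nn_integral_N_indicator_mult_measurable:
  fixes H :: "'b \<times> 'w \<Rightarrow> 'a \<Rightarrow> ennreal" and K :: "'b measure"
  assumes H: "(\<lambda>(p, y). H p y) \<in> borel_measurable ((K \<Otimes>\<^sub>M M) \<Otimes>\<^sub>M borel)"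
    and C: "C \<in> sets borel" "bounded C"
  shows "(\<lambda>p. \<integral>\<^sup>+y. H p y * indicator C y \<partial>N (snd p)) \<in> borel_measurable (K \<Otimes>\<^sub>M M)"
proof -
  note [measurable] = H C(1)
  define c where "c \<omega> = (1 + emeasure (N \<omega>) C)" for \<omega>
  define L where "L p = scale_measure (inverse (c (snd p))) (density (N (snd p)) (indicator C))" for p :: "'b \<times> 'w"
  have fin: "emeasure (N \<omega>) C < \<infinity>" if "\<omega> \<in> space M" for \<omega>
    using that C by (simp add: emeasure_N_bounded ennreal_of_nat_eq_real_of_nat)
  have c0: "c \<omega> \<noteq> 0" for \<omega> by (simp add: c_def)
  have cinf: "c \<omega> \<noteq> \<infinity>" if "\<omega> \<in> space M" for \<omega>
    using fin[OF that] by (simp add: c_def)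
  have [measurable]: "(\<lambda>\<omega>. emeasure (N \<omega>) A) \<in> borel_measurable M" if "A \<in> sets borel" for A
    using that by (simp add: emeasure_N)
  have emL: "emeasure (L p) A = inverse (c (snd p)) * emeasure (N (snd p)) (A \<inter> C)" if "A \<in> sets borel" for A p
    using that C by (simp add: L_def emeasure_density indicator_inter_arith[symmetric] Int_commute)
  have [measurable]: "c \<in> borel_measurable M" unfolding c_def by measurable
  have L: "L \<in> (K \<Otimes>\<^sub>M M) \<rightarrow>\<^sub>M subprob_algebra borel"
  proof (rule measurable_subprob_algebra)
    fix p assume "p \<in> space (K \<Otimes>\<^sub>M M)"
    then have p: "snd p \<in> space M" by (auto simp: space_pair_measure)
    show "subprob_space (L p)"
    proof (rule subprob_spaceI)
      have "emeasure (L p) (space (L p)) = inverse (c (snd p)) * emeasure (N (snd p)) C"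
        using emL[of UNIV p] by (simp add: L_def space_scale_measure)
      also have "\<dots> \<le> inverse (c (snd p)) * c (snd p)"
        unfolding c_def by (intro mult_left_mono) auto
      also have "\<dots> = 1"
        using c0[of "snd p"] cinf[OF p] ennreal_divide_self[of "c (snd p)"]
        by (simp add: divide_ennreal_def mult.commute less_top)
      finally show "emeasure (L p) (space (L p)) \<le> 1" .
      show "space (L p) \<noteq> {}" by (simp add: L_def space_scale_measure)
    qed
    show "sets (L p) = sets borel" by (simp add: L_def)
  next
    fix A :: "'a set" assume [measurable]: "A \<in> sets borel"
    show "(\<lambda>p. emeasure (L p) A) \<in> borel_measurable (K \<Otimes>\<^sub>M M)"
      by (subst emL) measurable
  qed
  have "(\<lambda>p. c (snd p) * (\<integral>\<^sup>+y. H p y \<partial>L p)) \<in> borel_measurable (K \<Otimes>\<^sub>M M)"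
    using nn_integral_measurable_subprob_algebra2[OF H L] by measurable
  moreover have "c (snd p) * (\<integral>\<^sup>+y. H p y \<partial>L p) = (\<integral>\<^sup>+y. H p y * indicator C y \<partial>N (snd p))"
    if "p \<in> space (K \<Otimes>\<^sub>M M)" for p
  proof -
    have p: "snd p \<in> space M" using that by (auto simp: space_pair_measure)
    have m: "(\<lambda>y. H p y) \<in> borel_measurable borel"
      using that by measurable
    have "(\<integral>\<^sup>+y. H p y \<partial>L p) = inverse (c (snd p)) * (\<integral>\<^sup>+y. H p y \<partial>density (N (snd p)) (indicator C))"
      unfolding L_def by (rule nn_integral_scale_measure) (use m in simp)
    also have "(\<integral>\<^sup>+y. H p y \<partial>density (N (snd p)) (indicator C)) = (\<integral>\<^sup>+y. H p y * indicator C y \<partial>N (snd p))"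
      using m by (subst nn_integral_density) (auto simp: mult.commute)
    finally show ?thesis
      using c0[of "snd p"] cinf[OF p] ennreal_divide_self[of "c (snd p)"]
      by (simp add: divide_ennreal_def mult.assoc[symmetric] less_top)
  qed
  ultimately show ?thesis
    by (subst measurable_cong[where g="\<lambda>p. c (snd p) * (\<integral>\<^sup>+y. H p y \<partial>L p)"]) auto
qed

text \<open>The extra parameter space \<open>K\<close> will carry the location x: joint
  measurability in x and \<omega> is what Fubini's theorem for the excursion volume
  requires.\<close>

lemma nn_integral_N_measurable:
  fixes H :: "'b \<times> 'w \<Rightarrow> 'a \<Rightarrow> ennreal" and K :: "'b measure"
  assumes H: "(\<lambda>(p, y). H p y) \<in> borel_measurable ((K \<Otimes>\<^sub>M M) \<Otimes>\<^sub>M borel)"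
  shows "(\<lambda>p. \<integral>\<^sup>+y. H p y \<partial>N (snd p)) \<in> borel_measurable (K \<Otimes>\<^sub>M M)"
proof -
  have "(\<lambda>p. SUP n. \<integral>\<^sup>+y. H p y * indicator (cball 0 (real n)) y \<partial>N (snd p)) \<in> borel_measurable (K \<Otimes>\<^sub>M M)"
    by (intro borel_measurable_SUP nn_integral_N_indicator_mult_measurable[OF H]) auto
  moreover have "(\<integral>\<^sup>+y. H p y \<partial>N (snd p)) = (SUP n. \<integral>\<^sup>+y. H p y * indicator (cball 0 (real n)) y \<partial>N (snd p))"
    if "p \<in> space (K \<Otimes>\<^sub>M M)" for p
    by (rule nn_integral_eq_SUP_cball) (use H that in \<open>auto intro: measurable_Pair2'\<close>)
  ultimately show ?thesis
    by (subst measurable_cong) auto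
qed

section \<open>Campbell's formula and characteristic functions\<close>

lemma integral_N_measurable:
  fixes H :: "'b \<times> 'w \<Rightarrow> 'a \<Rightarrow> real" and K :: "'b measure"
  assumes H [measurable]: "(\<lambda>(p, y). H p y) \<in> borel_measurable ((K \<Otimes>\<^sub>M M) \<Otimes>\<^sub>M borel)"
  shows "(\<lambda>p. \<integral>y. H p y \<partial>N (snd p)) \<in> borel_measurable (K \<Otimes>\<^sub>M M)"
proof -
  have [measurable]: "(\<lambda>p. \<integral>\<^sup>+y. ennreal \<bar>H p y\<bar> \<partial>N (snd p)) \<in> borel_measurable (K \<Otimes>\<^sub>M M)"
    "(\<lambda>p. \<integral>\<^sup>+y. ennreal (H p y) \<partial>N (snd p)) \<in> borel_measurable (K \<Otimes>\<^sub>M M)"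
    "(\<lambda>p. \<integral>\<^sup>+y. ennreal (- H p y) \<partial>N (snd p)) \<in> borel_measurable (K \<Otimes>\<^sub>M M)"
    by (intro nn_integral_N_measurable; measurable)+
  \<comment> \<open>The last branch is the default value of the Bochner integral for functions that
    are not integrable.\<close>
  have "(\<integral>y. H p y \<partial>N (snd p)) = (if (\<integral>\<^sup>+y. ennreal \<bar>H p y\<bar> \<partial>N (snd p)) < \<infinity>
      then enn2real (\<integral>\<^sup>+y. ennreal (H p y) \<partial>N (snd p)) - enn2real (\<integral>\<^sup>+y. ennreal (- H p y) \<partial>N (snd p))
      else 0)" if "p \<in> space (K \<Otimes>\<^sub>M M)" for p
  proof -
    have [measurable]: "H p \<in> borel_measurable borel" using measurable_Pair2[OF H that] by simp
    have "integrable (N (snd p)) (H p) \<longleftrightarrow> (\<integral>\<^sup>+y. ennreal \<bar>H p y\<bar> \<partial>N (snd p)) < \<infinity>"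
      by (simp add: integrable_iff_bounded)
    then show ?thesis
      using real_lebesgue_integral_def[of "N (snd p)" "H p"] by (simp add: not_integrable_integral_eq)
  qed
  then show ?thesis
    by (subst measurable_cong) (assumption, measurable)
qed

lemma integral_N_measurable1 [measurable]:
  fixes h :: "'a \<Rightarrow> real"
  assumes [measurable]: "h \<in> borel_measurable borel"
  shows "(\<lambda>\<omega>. \<integral>y. h y \<partial>N \<omega>) \<in> borel_measurable M"
proof -
  have m: "(\<lambda>p. \<integral>y. h y \<partial>N (snd p)) \<in> borel_measurable (count_space (UNIV::unit set) \<Otimes>\<^sub>M M)"
    by (intro integral_N_measurable) measurable
  have "(\<lambda>\<omega>. ((), \<omega>)) \<in> M \<rightarrow>\<^sub>M (count_space (UNIV::unit set) \<Otimes>\<^sub>M M)"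
    by measurable
  from measurable_compose[OF this m] show ?thesis by simp
qed

lemma nn_integral_N_measurable1 [measurable]:
  fixes h :: "'a \<Rightarrow> ennreal"
  assumes [measurable]: "h \<in> borel_measurable borel"
  shows "(\<lambda>\<omega>. \<integral>\<^sup>+y. h y \<partial>N \<omega>) \<in> borel_measurable M"
proof -
  have m: "(\<lambda>p. \<integral>\<^sup>+y. h y \<partial>N (snd p)) \<in> borel_measurable (count_space (UNIV::unit set) \<Otimes>\<^sub>M M)"
    by (intro nn_integral_N_measurable) measurable
  have "(\<lambda>\<omega>. ((), \<omega>)) \<in> M \<rightarrow>\<^sub>M (count_space (UNIV::unit set) \<Otimes>\<^sub>M M)"
    by measurable
  from measurable_compose[OF this m] show ?thesis by simp
qed

lemma campbell_indicator:
  assumes [measurable]: "A \<in> sets borel"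
  shows "(\<integral>\<^sup>+\<omega>. emeasure (N \<omega>) A \<partial>M) = emeasure lborel A"
proof -
  have [measurable]: "cball (0::'a) (real n) \<in> sets borel" for n by simp
  let ?C = "\<lambda>n. cball (0::'a) (real n)"
  have e: "emeasure K A = (SUP n. emeasure K (A \<inter> ?C n))" if [measurable_cong]: "sets K = sets borel" for K
  proof -
    have "emeasure K A = (\<integral>\<^sup>+y. indicator A y \<partial>K)" by simp
    also have "\<dots> = (SUP n. \<integral>\<^sup>+y. indicator A y * indicator (?C n) y \<partial>K)"
      by (rule nn_integral_eq_SUP_cball[OF that]) measurable
    also have "\<dots> = (SUP n. emeasure K (A \<inter> ?C n))"
      by (intro SUP_cong refl) (simp add: indicator_inter_arith[symmetric])
    finally show ?thesis .
  qed
  have "(\<integral>\<^sup>+\<omega>. emeasure (N \<omega>) A \<partial>M) = (\<integral>\<^sup>+\<omega>. (SUP n. emeasure (N \<omega>) (A \<inter> ?C n)) \<partial>M)"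
    by (intro nn_integral_cong e) simp
  also have "\<dots> = (SUP n. \<integral>\<^sup>+\<omega>. emeasure (N \<omega>) (A \<inter> ?C n) \<partial>M)"
  proof (rule nn_integral_monotone_convergence_SUP)
    show "incseq (\<lambda>n \<omega>. emeasure (N \<omega>) (A \<inter> ?C n))"
      by (auto simp: incseq_def le_fun_def intro!: emeasure_mono)
    show "(\<lambda>\<omega>. emeasure (N \<omega>) (A \<inter> ?C n)) \<in> borel_measurable M" for n
      by (simp add: emeasure_N)
  qed
  also have "\<dots> = (SUP n. emeasure lborel (A \<inter> ?C n))"
  proof (intro SUP_cong refl)
    fix n
    have b: "bounded (A \<inter> ?C n)" by (simp add: bounded_Int)
    have "(\<integral>\<^sup>+\<omega>. emeasure (N \<omega>) (A \<inter> ?C n) \<partial>M) = (\<integral>\<^sup>+\<omega>. of_nat (npt (A \<inter> ?C n) \<omega>) \<partial>M)"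
      by (intro nn_integral_cong emeasure_N_bounded b) auto
    then show "(\<integral>\<^sup>+\<omega>. emeasure (N \<omega>) (A \<inter> ?C n) \<partial>M) = emeasure lborel (A \<inter> ?C n)"
      using b by (simp add: nn_integral_npt)
  qed
  also have "\<dots> = emeasure lborel A" by (rule e[symmetric]) simp
  finally show ?thesis .
qed

lemma campbell:
  fixes h :: "'a \<Rightarrow> ennreal"
  assumes "h \<in> borel_measurable borel"
  shows "(\<integral>\<^sup>+\<omega>. (\<integral>\<^sup>+y. h y \<partial>N \<omega>) \<partial>M) = (\<integral>\<^sup>+y. h y \<partial>lborel)"
  using assms
proof induct
  case (cong f g)
  then have "f = g" by auto
  then show ?case using cong by simp
next
  case (set A)
  then show ?case using campbell_indicator[of A] by simp
next
  case (mult f c)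
  note [measurable] = mult(2)
  show ?case using mult by (simp add: nn_integral_cmult)
next
  case (add f g)
  note [measurable] = add(1,4)
  show ?case using add by (simp add: nn_integral_add)
next
  case (seq U)
  note [measurable] = seq(1)
  have "(\<integral>\<^sup>+\<omega>. (\<integral>\<^sup>+y. (SUP i. U i) y \<partial>N \<omega>) \<partial>M) = (\<integral>\<^sup>+\<omega>. (SUP i. \<integral>\<^sup>+y. U i y \<partial>N \<omega>) \<partial>M)"
    unfolding SUP_apply using seq(4)
    by (intro nn_integral_cong nn_integral_monotone_convergence_SUP) auto
  also have "\<dots> = (SUP i. \<integral>\<^sup>+\<omega>. (\<integral>\<^sup>+y. U i y \<partial>N \<omega>) \<partial>M)"
  proof (intro nn_integral_monotone_convergence_SUP)
    show "incseq (\<lambda>i \<omega>. \<integral>\<^sup>+y. U i y \<partial>N \<omega>)"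
      using seq(4) by (auto simp: incseq_def le_fun_def intro!: nn_integral_mono)
  qed measurable
  also have "\<dots> = (SUP i. \<integral>\<^sup>+y. U i y \<partial>lborel)"
    using seq by simp
  also have "\<dots> = (\<integral>\<^sup>+y. (SUP i. U i) y \<partial>lborel)"
    unfolding SUP_apply using seq(4)
    by (intro nn_integral_monotone_convergence_SUP[symmetric]) auto
  finally show ?case by (simp add: image_comp)
qed

lemma AE_integrable_N:
  fixes h :: "'a \<Rightarrow> real"
  assumes h: "integrable lborel h"
  shows "AE \<omega> in M. integrable (N \<omega>) h"
proof -
  have [measurable]: "h \<in> borel_measurable borel" using h by simp
  have "(\<integral>\<^sup>+\<omega>. (\<integral>\<^sup>+y. ennreal \<bar>h y\<bar> \<partial>N \<omega>) \<partial>M) \<noteq> \<infinity>"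
    using h by (subst campbell) (auto simp: integrable_iff_bounded)
  then have "AE \<omega> in M. (\<integral>\<^sup>+y. ennreal \<bar>h y\<bar> \<partial>N \<omega>) \<noteq> \<infinity>"
    by (intro nn_integral_PInf_AE) measurable
  then show ?thesis
    by eventually_elim (auto simp: integrable_iff_bounded less_top)
qed

text \<open>Markov's inequality for the integral of \<open>\<bar>h\<bar>\<close>, whose mean is
  known from Campbell's formula. Where \<open>h\<close> is not integrable its integral is 0, so the
  comparison survives.\<close>

lemma prob_abs_integral_N_ge:
  fixes h :: "'a \<Rightarrow> real"
  assumes h: "integrable lborel h" and t: "t > 0"
  shows "prob {\<omega>\<in>space M. t \<le> \<bar>\<integral>y. h y \<partial>N \<omega>\<bar>} \<le> (\<integral>y. \<bar>h y\<bar> \<partial>lborel) / t"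
proof -
  have [measurable]: "h \<in> borel_measurable borel" using h by simp
  let ?X = "\<lambda>\<omega>. \<integral>\<^sup>+y. ennreal \<bar>h y\<bar> \<partial>N \<omega>"
  have le: "ennreal \<bar>\<integral>y. h y \<partial>N \<omega>\<bar> \<le> ?X \<omega>" for \<omega>
    using integral_norm_bound_ennreal[of "N \<omega>" h]
    by (cases "integrable (N \<omega>) h") (auto simp: not_integrable_integral_eq)
  have 1: "1 \<le> ennreal (1 / t) * ?X \<omega>" if "t \<le> \<bar>\<integral>y. h y \<partial>N \<omega>\<bar>" for \<omega>
  proof -
    have "1 \<le> ennreal (1 / t) * ennreal \<bar>\<integral>y. h y \<partial>N \<omega>\<bar>"
      using t that by (subst ennreal_mult[symmetric]) (auto simp: field_simps)
    also have "\<dots> \<le> ennreal (1 / t) * ?X \<omega>" by (intro mult_left_mono le) auto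
    finally show ?thesis .
  qed
  have "emeasure M {\<omega>\<in>space M. t \<le> \<bar>\<integral>y. h y \<partial>N \<omega>\<bar>} \<le> emeasure M {\<omega>\<in>space M. 1 \<le> ennreal (1 / t) * ?X \<omega>}"
    using 1 by (intro emeasure_mono) auto
  also have "\<dots> \<le> ennreal (1 / t) * (\<integral>\<^sup>+\<omega>. ?X \<omega> * indicator (space M) \<omega> \<partial>M)"
    by (rule nn_integral_Markov_inequality) auto
  also have "(\<integral>\<^sup>+\<omega>. ?X \<omega> * indicator (space M) \<omega> \<partial>M) = (\<integral>\<^sup>+\<omega>. ?X \<omega> \<partial>M)"
    by (intro nn_integral_cong) auto
  also have "\<dots> = ennreal (\<integral>y. \<bar>h y\<bar> \<partial>lborel)"
    using h by (subst campbell) (auto simp: nn_integral_eq_integral)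
  finally show ?thesis
    using t by (simp add: emeasure_eq_measure ennreal_mult[symmetric])
qed

text \<open>The integral of such an \<open>s\<close> is a finite linear combination of counts of
  disjoint level sets. Independence therefore factorises the expectation, and each factor is a
  Poisson generating function.\<close>

lemma shot_char_simple:
  fixes s :: "'a \<Rightarrow> real"
  assumes s [measurable]: "s \<in> borel_measurable borel" and fin: "finite (range s)"
    and bd: "bounded {y. s y \<noteq> 0}"
    and A [measurable]: "A0 \<in> sets borel" "A1 \<in> sets borel" and bA: "bounded A0" "bounded A1"
    and disj: "A0 \<inter> A1 = {}" and s0: "\<And>y. y \<in> A0 \<union> A1 \<Longrightarrow> s y = 0"
  shows "(\<integral>\<omega>. iexp (t * (\<integral>y. s y \<partial>N \<omega>)) * of_bool (npt A0 \<omega> = k0 \<and> npt A1 \<omega> = k1) \<partial>M) =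
    exp (\<integral>y. iexp (t * s y) - 1 \<partial>lborel) *
    of_real (prob {\<omega>\<in>space M. npt A0 \<omega> = k0} * prob {\<omega>\<in>space M. npt A1 \<omega> = k1})"
proof -
  \<comment> \<open>The value 0 contributes nothing, and dropping it leaves only bounded level
    sets.\<close>
  define S where "S = range s - {0}"
  have fS: "finite S" using fin by (simp add: S_def)
  let ?L = "\<lambda>a. s -` {a}"
  have mL [measurable]: "?L a \<in> sets borel" for a
    using measurable_sets[OF s, of "{a}"] by simp
  have bL: "bounded (?L a)" if "a \<in> S" for a
    using that by (intro bounded_subset[OF bd]) (auto simp: S_def)
  \<comment> \<open>Stated for a general \<open>F\<close> vanishing at 0, since it is applied to the
    identity and to exp(i t a) - 1.\<close>
  have repr: "F (s y) = (\<Sum>a\<in>S. indicator (?L a) y *\<^sub>R F a)" if "F 0 = 0" for F :: "real \<Rightarrow> 'c::real_vector" and y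
  proof (cases "s y = 0")
    case True
    then show ?thesis using that by (auto simp: S_def indicator_def intro!: sum.neutral)
  next
    case False
    then have "(\<Sum>a\<in>S. indicator (?L a) y *\<^sub>R F a) = (\<Sum>a\<in>S. if a = s y then F a else 0)"
      by (intro sum.cong) (auto simp: indicator_def)
    then show ?thesis using False fS by (simp add: S_def)
  qed
  have intN: "(\<integral>y. s y \<partial>N \<omega>) = (\<Sum>a\<in>S. real (npt (?L a) \<omega>) * a)" if w: "\<omega> \<in> space M" for \<omega>
  proof -
    have "(\<integral>y. s y \<partial>N \<omega>) = (\<integral>y. (\<Sum>a\<in>S. indicator (?L a) y *\<^sub>R a) \<partial>N \<omega>)"
      by (subst repr[of "\<lambda>a. a", OF refl]) simp
    also have "\<dots> = (\<Sum>a\<in>S. \<integral>y. indicator (?L a) y *\<^sub>R a \<partial>N \<omega>)"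
      using w bL by (intro Bochner_Integration.integral_sum integrable_scaleR_left integrable_real_indicator)
         (auto simp: emeasure_N_bounded ennreal_of_nat_eq_real_of_nat)
    also have "\<dots> = (\<Sum>a\<in>S. real (npt (?L a) \<omega>) * a)"
      using w bL by (intro sum.cong) (auto simp: measure_N_bounded)
    finally show ?thesis .
  qed
  have intL: "(\<integral>y. iexp (t * s y) - 1 \<partial>lborel) = (\<Sum>a\<in>S. of_real (measure lborel (?L a)) * (iexp (t * a) - 1))"
  proof -
    have "(\<integral>y. iexp (t * s y) - 1 \<partial>lborel) = (\<integral>y. (\<Sum>a\<in>S. indicator (?L a) y *\<^sub>R (iexp (t * a) - 1)) \<partial>lborel)"
      by (subst repr[of "\<lambda>a. iexp (t * a) - 1"]) auto
    also have "\<dots> = (\<Sum>a\<in>S. \<integral>y. indicator (?L a) y *\<^sub>R (iexp (t * a) - 1) \<partial>lborel)"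
      using bL emeasure_bounded_finite
      by (intro Bochner_Integration.integral_sum integrable_scaleR_left integrable_real_indicator) auto
    also have "\<dots> = (\<Sum>a\<in>S. of_real (measure lborel (?L a)) * (iexp (t * a) - 1))"
      by (intro sum.cong) (auto simp: scaleR_conv_of_real)
    finally show ?thesis .
  qed
  \<comment> \<open>Level sets and the two windows form one disjoint family: \<open>A0\<close> and
    \<open>A1\<close> lie in the level set of the dropped value 0.\<close>
  define B where "B = case_sum ?L (\<lambda>b. if b then A1 else A0)"
  define \<phi> where "\<phi> = case_sum (\<lambda>a n. iexp (t * a) ^ n) (\<lambda>b n. of_bool (n = (if b then k1 else k0)) :: complex)"
  let ?J = "S <+> (UNIV :: bool set)"
  have Bm: "B j \<in> sets borel" and Bb: "bounded (B j)" if "j \<in> ?J" for j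
    using that bL bA by (auto simp: B_def)
  have Bd: "disjoint_family_on B ?J"
    using disj s0 by (fastforce simp: disjoint_family_on_def B_def S_def split: if_splits)
  have int: "integrable M (\<lambda>\<omega>. \<phi> j (npt (B j) \<omega>))" if j: "j \<in> ?J" for j
  proof -
    have [measurable]: "npt (B j) \<in> M \<rightarrow>\<^sub>M count_space UNIV"
      using Bm Bb j by simp
    have [measurable]: "\<phi> j \<in> count_space UNIV \<rightarrow>\<^sub>M borel" by simp
    have "(\<lambda>\<omega>. \<phi> j (npt (B j) \<omega>)) \<in> borel_measurable M" by measurable
    moreover have "norm (\<phi> j n) \<le> 1" for n
      by (cases j) (auto simp: \<phi>_def norm_power)
    ultimately show ?thesis by (intro integrable_const_bound[where B=1]) auto
  qed
  have "(\<integral>\<omega>. iexp (t * (\<integral>y. s y \<partial>N \<omega>)) * of_bool (npt A0 \<omega> = k0 \<and> npt A1 \<omega> = k1) \<partial>M) =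
     (\<integral>\<omega>. (\<Prod>j\<in>?J. \<phi> j (npt (B j) \<omega>)) \<partial>M)"
  proof (intro Bochner_Integration.integral_cong refl)
    fix \<omega> assume w: "\<omega> \<in> space M"
    have "(\<Prod>a\<in>S. iexp (t * a) ^ npt (?L a) \<omega>) = iexp (t * (\<integral>y. s y \<partial>N \<omega>))"
      by (simp add: intN[OF w] sum_distrib_left exp_sum[OF fS] exp_of_nat_mult[symmetric] algebra_simps)
    then show "iexp (t * (\<integral>y. s y \<partial>N \<omega>)) * of_bool (npt A0 \<omega> = k0 \<and> npt A1 \<omega> = k1) = (\<Prod>j\<in>?J. \<phi> j (npt (B j) \<omega>))"
      using fS by (simp add: prod.Plus \<phi>_def B_def UNIV_bool of_bool_conj)
  qed
  also have "\<dots> = (\<Prod>j\<in>?J. \<integral>\<omega>. \<phi> j (npt (B j) \<omega>) \<partial>M)"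
    using fS by (intro expectation_prod_npt Bm Bb Bd int) auto
  also have "\<dots> = (\<Prod>a\<in>S. \<integral>\<omega>. iexp (t * a) ^ npt (?L a) \<omega> \<partial>M) *
     ((\<integral>\<omega>. of_bool (npt A0 \<omega> = k0) \<partial>M) * (\<integral>\<omega>. of_bool (npt A1 \<omega> = k1) \<partial>M))"
    using fS by (simp add: prod.Plus \<phi>_def B_def UNIV_bool)
  also have "(\<Prod>a\<in>S. \<integral>\<omega>. iexp (t * a) ^ npt (?L a) \<omega> \<partial>M) =
      (\<Prod>a\<in>S. exp (of_real (measure lborel (?L a)) * (iexp (t * a) - 1)))"
    by (intro prod.cong refl expectation_power_npt mL bL) auto
  also have "\<dots> = exp (\<integral>y. iexp (t * s y) - 1 \<partial>lborel)"
    unfolding intL by (simp add: exp_sum[OF fS])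
  also have "(\<integral>\<omega>. of_bool (npt C \<omega> = k) \<partial>M) = complex_of_real (prob {\<omega>\<in>space M. npt C \<omega> = k})"
    if "C \<in> sets borel" "bounded C" for C k
  proof -
    have [measurable]: "npt C \<in> M \<rightarrow>\<^sub>M count_space UNIV" using that by simp
    have "(\<integral>\<omega>. of_bool (npt C \<omega> = k) \<partial>M) = (\<integral>\<omega>. of_real (indicator {\<omega>\<in>space M. npt C \<omega> = k} \<omega>) \<partial>M)"
      by (intro Bochner_Integration.integral_cong refl) (auto simp: indicator_def)
    also have "\<dots> = complex_of_real (\<integral>\<omega>. indicator {\<omega>\<in>space M. npt C \<omega> = k} \<omega> \<partial>M)"
      by (rule integral_complex_of_real)
    also have "\<dots> = complex_of_real (prob {\<omega>\<in>space M. npt C \<omega> = k})"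
      by simp
    finally show ?thesis .
  qed
  from this[OF A(1) bA(1)] this[OF A(2) bA(2)]
  have "(\<integral>\<omega>. of_bool (npt A0 \<omega> = k0) \<partial>M) * (\<integral>\<omega>. of_bool (npt A1 \<omega> = k1) \<partial>M) =
    complex_of_real (prob {\<omega>\<in>space M. npt A0 \<omega> = k0} * prob {\<omega>\<in>space M. npt A1 \<omega> = k1})" by simp
  finally show ?thesis .
qed

end

lemma norm_iexp_minus_1_le: "norm (iexp x - 1) \<le> \<bar>x\<bar>"
  using iexp_approx1[of x 0] by simp

context poisson_lborel
begin

text \<open>The joint statement about the shot noise and two counts yields both the characteristic function
  (take \<open>A0 = A1 = {}\<close>) and, by uniqueness of characteristic functions, independence.\<close>

lemma shot_char:
  fixes h :: "'a \<Rightarrow> real"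
  assumes h: "integrable lborel h"
    and A [measurable]: "A0 \<in> sets borel" "A1 \<in> sets borel" and bA: "bounded A0" "bounded A1"
    and disj: "A0 \<inter> A1 = {}" and h0: "\<And>y. y \<in> A0 \<union> A1 \<Longrightarrow> h y = 0"
  shows "(\<integral>\<omega>. iexp (t * (\<integral>y. h y \<partial>N \<omega>)) * of_bool (npt A0 \<omega> = k0 \<and> npt A1 \<omega> = k1) \<partial>M) =
    exp (\<integral>y. iexp (t * h y) - 1 \<partial>lborel) *
    of_real (prob {\<omega>\<in>space M. npt A0 \<omega> = k0} * prob {\<omega>\<in>space M. npt A1 \<omega> = k1})"
proof -
  have [measurable]: "h \<in> borel_measurable borel" using h by simp
  from borel_measurable_implies_sequence_metric[OF this, of 0]
  obtain F where F: "\<And>i. simple_function borel (F i)" "\<And>y. (\<lambda>i. F i y) \<longlonglongrightarrow> h y"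
    "\<And>i y. \<bar>F i y\<bar> \<le> 2 * \<bar>h y\<bar>"
    by (auto simp: dist_real_def)
  \<comment> \<open>Cutting off at radius i gives the bounded support; the domination by
    \<open>2 * \<bar>h y\<bar>\<close> also makes each approximant vanish on the windows.\<close>
  define s where "s i y = F i y * indicator (cball 0 (real i)) y" for i y
  have [measurable]: "cball (0::'a) (real n) \<in> sets borel" for n by simp
  have [measurable]: "F i \<in> borel_measurable borel" for i
    using F(1) by (rule borel_measurable_simple_function)
  have [measurable]: "s i \<in> borel_measurable borel" for i
    unfolding s_def by measurable
  have sb: "\<bar>s i y\<bar> \<le> 2 * \<bar>h y\<bar>" for i y
    using F(3)[of i y] by (auto simp: s_def indicator_def)
  have slim: "(\<lambda>i. s i y) \<longlonglongrightarrow> h y" for y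
  proof -
    obtain n :: nat where n: "norm y \<le> real n" using real_arch_simple by blast
    have "eventually (\<lambda>i. F i y = s i y) sequentially"
      using eventually_ge_at_top[of n] by eventually_elim (use n in \<open>auto simp: s_def\<close>)
    then show ?thesis using F(2)[of y] by (rule Lim_transform_eventually[rotated])
  qed
  have [measurable]: "npt A0 \<in> M \<rightarrow>\<^sub>M count_space UNIV" "npt A1 \<in> M \<rightarrow>\<^sub>M count_space UNIV"
    using A bA by simp_all
  let ?P = "complex_of_real (prob {\<omega>\<in>space M. npt A0 \<omega> = k0} * prob {\<omega>\<in>space M. npt A1 \<omega> = k1})"
  have eq: "(\<integral>\<omega>. iexp (t * (\<integral>y. s i y \<partial>N \<omega>)) * of_bool (npt A0 \<omega> = k0 \<and> npt A1 \<omega> = k1) \<partial>M) =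
    exp (\<integral>y. iexp (t * s i y) - 1 \<partial>lborel) * ?P" for i
  proof (rule shot_char_simple[OF _ _ _ A bA disj])
    show "s i \<in> borel_measurable borel" by simp
    have "range (s i) \<subseteq> insert 0 (range (F i))"
      by (auto simp: s_def indicator_def)
    moreover have "finite (range (F i))"
      using simple_functionD(1)[OF F(1)[of i]] by simp
    ultimately show "finite (range (s i))" by (meson finite.insertI finite_subset)
    show "bounded {y. s i y \<noteq> 0}"
      by (rule bounded_subset[OF bounded_cball[of 0 "real i"]]) (auto simp: s_def indicator_def split: if_splits)
    show "s i y = 0" if "y \<in> A0 \<union> A1" for y
      using sb[of i y] h0[OF that] by simp
  qed
  have limL: "(\<lambda>i. \<integral>y. iexp (t * s i y) - 1 \<partial>lborel) \<longlonglongrightarrow> (\<integral>y. iexp (t * h y) - 1 \<partial>lborel)"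
  proof (rule integral_dominated_convergence[where w="\<lambda>y. 2 * \<bar>t\<bar> * \<bar>h y\<bar>"])
    show "integrable lborel (\<lambda>y. 2 * \<bar>t\<bar> * \<bar>h y\<bar>)" using h by simp
    show "AE y in lborel. (\<lambda>i. iexp (t * s i y) - 1) \<longlonglongrightarrow> iexp (t * h y) - 1"
      by (intro AE_I2 tendsto_intros slim)
    show "AE y in lborel. norm (iexp (t * s i y) - 1) \<le> 2 * \<bar>t\<bar> * \<bar>h y\<bar>" for i
    proof (intro AE_I2)
      fix y
      have "norm (iexp (t * s i y) - 1) \<le> \<bar>t * s i y\<bar>" by (rule norm_iexp_minus_1_le)
      also have "\<dots> \<le> \<bar>t\<bar> * (2 * \<bar>h y\<bar>)"
        unfolding abs_mult by (intro mult_left_mono sb) auto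
      finally show "norm (iexp (t * s i y) - 1) \<le> 2 * \<bar>t\<bar> * \<bar>h y\<bar>" by simp
    qed
  qed measurable
  have limN: "AE \<omega> in M. (\<lambda>i. \<integral>y. s i y \<partial>N \<omega>) \<longlonglongrightarrow> (\<integral>y. h y \<partial>N \<omega>)"
    using AE_integrable_N[OF h]
  proof eventually_elim
    fix \<omega> assume i: "integrable (N \<omega>) h"
    show "(\<lambda>i. \<integral>y. s i y \<partial>N \<omega>) \<longlonglongrightarrow> (\<integral>y. h y \<partial>N \<omega>)"
      by (rule integral_dominated_convergence[where w="\<lambda>y. 2 * \<bar>h y\<bar>"]) (use i slim sb in auto)
  qed
  have "(\<lambda>i. \<integral>\<omega>. iexp (t * (\<integral>y. s i y \<partial>N \<omega>)) * of_bool (npt A0 \<omega> = k0 \<and> npt A1 \<omega> = k1) \<partial>M) \<longlonglongrightarrow>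
    (\<integral>\<omega>. iexp (t * (\<integral>y. h y \<partial>N \<omega>)) * of_bool (npt A0 \<omega> = k0 \<and> npt A1 \<omega> = k1) \<partial>M)"
  proof (rule integral_dominated_convergence[where w="\<lambda>_. 1"])
    show "AE \<omega> in M. (\<lambda>i. iexp (t * (\<integral>y. s i y \<partial>N \<omega>)) * of_bool (npt A0 \<omega> = k0 \<and> npt A1 \<omega> = k1)) \<longlonglongrightarrow>
      iexp (t * (\<integral>y. h y \<partial>N \<omega>)) * of_bool (npt A0 \<omega> = k0 \<and> npt A1 \<omega> = k1)"
      using limN by eventually_elim (intro tendsto_intros)
    show "AE \<omega> in M. norm (iexp (t * (\<integral>y. s i y \<partial>N \<omega>)) * of_bool (npt A0 \<omega> = k0 \<and> npt A1 \<omega> = k1)) \<le> 1" for i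
      by (intro AE_I2) (simp add: norm_mult)
  qed measurable
  moreover have "(\<lambda>i. exp (\<integral>y. iexp (t * s i y) - 1 \<partial>lborel) * ?P) \<longlonglongrightarrow> exp (\<integral>y. iexp (t * h y) - 1 \<partial>lborel) * ?P"
    by (intro tendsto_intros limL)
  ultimately show ?thesis
    unfolding eq by (rule LIMSEQ_unique)
qed

lemma norm_shot_char:
  fixes h :: "'a \<Rightarrow> real"
  assumes h: "integrable lborel h"
  shows "norm (\<integral>\<omega>. iexp (t * (\<integral>y. h y \<partial>N \<omega>)) \<partial>M) = exp (- (\<integral>y. 1 - cos (t * h y) \<partial>lborel))"
    and "integrable lborel (\<lambda>y. 1 - cos (t * h y))"
proof -
  have [measurable]: "h \<in> borel_measurable borel" using h by simp
  have i: "integrable lborel (\<lambda>y. iexp (t * h y) - 1)"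
  proof (rule Bochner_Integration.integrable_bound[where f="\<lambda>y. \<bar>t * h y\<bar>"])
    show "AE y in lborel. norm (iexp (t * h y) - 1) \<le> norm \<bar>t * h y\<bar>"
      using norm_iexp_minus_1_le by (simp del: of_real_mult)
  qed (use h in \<open>auto intro: integrable_abs\<close>)
  have Re: "Re (iexp x - 1) = - (1 - cos x)" for x
    by (simp add: cis_conv_exp[symmetric])
  have "integrable lborel (\<lambda>y. - (1 - cos (t * h y)))"
    using integrable_Re[OF i] unfolding Re .
  then show "integrable lborel (\<lambda>y. 1 - cos (t * h y))"
    using integrable_minus[of lborel "\<lambda>y. - (1 - cos (t * h y))"] by simp
  \<comment> \<open>With empty windows the two count conditions hold surely, so the joint formula
    becomes the plain characteristic function.\<close>
  have "npt {} = (\<lambda>_. 0)" by (simp add: npt_def fun_eq_iff)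
  then have "(\<integral>\<omega>. iexp (t * (\<integral>y. h y \<partial>N \<omega>)) \<partial>M) = exp (\<integral>y. iexp (t * h y) - 1 \<partial>lborel)"
    using shot_char[OF h, of "{}" "{}" t 0 0] by (simp add: prob_space)
  moreover have "Re (\<integral>y. iexp (t * h y) - 1 \<partial>lborel) = - (\<integral>y. 1 - cos (t * h y) \<partial>lborel)"
    by (simp only: integral_Re[OF i, symmetric] Re integral_minus)
  ultimately show "norm (\<integral>\<omega>. iexp (t * (\<integral>y. h y \<partial>N \<omega>)) \<partial>M) = exp (- (\<integral>y. 1 - cos (t * h y) \<partial>lborel))"
    by (simp add: norm_exp_eq_Re)
qed

text \<open>By the joint formula the characteristic function of the shot noise is the same with and
  without conditioning on the two counts, so Levy's uniqueness theorem identifies the conditional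
  law with the unconditional one.\<close>

lemma prob_shot_indep:
  fixes h :: "'a \<Rightarrow> real"
  assumes h: "integrable lborel h"
    and A [measurable]: "A0 \<in> sets borel" "A1 \<in> sets borel" and bA: "bounded A0" "bounded A1"
    and disj: "A0 \<inter> A1 = {}" and h0: "\<And>y. y \<in> A0 \<union> A1 \<Longrightarrow> h y = 0"
    and S [measurable]: "S \<in> sets borel"
  shows "prob {\<omega>\<in>space M. (\<integral>y. h y \<partial>N \<omega>) \<in> S \<and> npt A0 \<omega> = k0 \<and> npt A1 \<omega> = k1} =
    prob {\<omega>\<in>space M. (\<integral>y. h y \<partial>N \<omega>) \<in> S} *
    (prob {\<omega>\<in>space M. npt A0 \<omega> = k0} * prob {\<omega>\<in>space M. npt A1 \<omega> = k1})"
proof -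
  have [measurable]: "h \<in> borel_measurable borel" using h by simp
  have [measurable]: "npt A0 \<in> M \<rightarrow>\<^sub>M count_space UNIV" "npt A1 \<in> M \<rightarrow>\<^sub>M count_space UNIV"
    using A bA by simp_all
  define X where "X \<omega> = (\<integral>y. h y \<partial>N \<omega>)" for \<omega>
  have [measurable]: "X \<in> borel_measurable M" unfolding X_def by measurable
  define E where "E = {\<omega>\<in>space M. npt A0 \<omega> = k0 \<and> npt A1 \<omega> = k1}"
  have E [measurable]: "E \<in> sets M" unfolding E_def by measurable
  define p where "p = prob {\<omega>\<in>space M. npt A0 \<omega> = k0} * prob {\<omega>\<in>space M. npt A1 \<omega> = k1}"
  have ind: "of_bool (npt A0 \<omega> = k0 \<and> npt A1 \<omega> = k1) = (indicator E \<omega> :: 'b::zero_neq_one)" if "\<omega> \<in> space M" for \<omega>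
    using that by (auto simp: E_def indicator_def)
  have char: "(\<integral>\<omega>. iexp (t * X \<omega>) * indicator E \<omega> \<partial>M) = (\<integral>\<omega>. iexp (t * X \<omega>) \<partial>M) * of_real p" for t
  proof -
    have "(\<integral>\<omega>. iexp (t * X \<omega>) * indicator E \<omega> \<partial>M) =
      (\<integral>\<omega>. iexp (t * (\<integral>y. h y \<partial>N \<omega>)) * of_bool (npt A0 \<omega> = k0 \<and> npt A1 \<omega> = k1) \<partial>M)"
      by (intro Bochner_Integration.integral_cong refl) (simp add: ind X_def)
    also have "\<dots> = exp (\<integral>y. iexp (t * h y) - 1 \<partial>lborel) * of_real p"
      unfolding p_def using assms by (intro shot_char) auto
    also have "exp (\<integral>y. iexp (t * h y) - 1 \<partial>lborel) = (\<integral>\<omega>. iexp (t * X \<omega>) \<partial>M)"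
    proof -
      have "npt {} = (\<lambda>_. 0)" by (simp add: npt_def fun_eq_iff)
      then show ?thesis
        using shot_char[OF h, of "{}" "{}" t 0 0] by (simp add: prob_space X_def)
    qed
    finally show ?thesis .
  qed
  have pE: "prob E = p"
  proof -
    have "complex_of_real (prob E) = (\<integral>\<omega>. complex_of_real (indicator E \<omega>) \<partial>M)"
      by (simp only: integral_complex_of_real) simp
    also have "\<dots> = (\<integral>\<omega>. iexp (0 * X \<omega>) * indicator E \<omega> \<partial>M)"
      by (intro Bochner_Integration.integral_cong refl) (auto simp: indicator_def)
    also have "\<dots> = of_real p"
      unfolding char by (simp add: prob_space)
    finally show ?thesis by simp
  qed
  have goal: "prob {\<omega>\<in>space M. X \<omega> \<in> S \<and> \<omega> \<in> E} = prob {\<omega>\<in>space M. X \<omega> \<in> S} * p"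
  proof (cases "p = 0")
    case True
    have "prob {\<omega>\<in>space M. X \<omega> \<in> S \<and> \<omega> \<in> E} \<le> prob E"
      by (intro finite_measure_mono) auto
    then show ?thesis using True pE measure_nonneg[of M "{\<omega>\<in>space M. X \<omega> \<in> S \<and> \<omega> \<in> E}"] by simp
  next
    case False
    then have p: "p > 0" by (simp add: pE[symmetric] zero_less_measure_iff)
    \<comment> \<open>The conditional probability given \<open>E\<close>.\<close>
    define D where "D = density M (\<lambda>\<omega>. ennreal (indicator E \<omega> / p))"
    have emD: "emeasure D A = ennreal (prob (A \<inter> E) / p)" if A [measurable]: "A \<in> sets M" for A
    proof -
      have "emeasure D A = (\<integral>\<^sup>+\<omega>. ennreal (1 / p) * indicator (A \<inter> E) \<omega> \<partial>M)"
        unfolding D_def by (subst emeasure_density; (intro nn_integral_cong)?)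
          (auto simp: indicator_def)
      also have "\<dots> = ennreal (prob (A \<inter> E) / p)"
        using p by (subst nn_integral_cmult_indicator) (auto simp: emeasure_eq_measure ennreal_mult[symmetric])
      finally show ?thesis .
    qed
    have pD: "prob_space D"
    proof (rule prob_spaceI)
      have "space M \<inter> E = E" using sets.sets_into_space[OF E] by auto
      then show "emeasure D (space D) = 1"
        using emD[of "space M"] p pE by (simp add: D_def)
    qed
    have [measurable]: "X \<in> borel_measurable D" by (simp add: D_def)
    interpret D: prob_space D by (rule pD)
    have "distr D borel X = distr M borel X"
    proof (rule Levy_uniqueness)
      show "real_distribution (distr D borel X)" "real_distribution (distr M borel X)"
        by (auto intro!: D.real_distribution_distr real_distribution_distr)
      show "char (distr D borel X) = char (distr M borel X)"
      proof
        fix t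
        have "char (distr D borel X) t = (\<integral>\<omega>. iexp (t * X \<omega>) \<partial>D)"
          unfolding char_def by (subst integral_distr) auto
        also have "\<dots> = (\<integral>\<omega>. (indicator E \<omega> / p) *\<^sub>R iexp (t * X \<omega>) \<partial>M)"
          unfolding D_def using p by (subst integral_density) auto
        also have "\<dots> = (\<integral>\<omega>. (iexp (t * X \<omega>) * indicator E \<omega>) * of_real (1 / p) \<partial>M)"
          by (intro Bochner_Integration.integral_cong refl) (auto simp: indicator_def scaleR_conv_of_real)
        also have "\<dots> = (\<integral>\<omega>. iexp (t * X \<omega>) * indicator E \<omega> \<partial>M) * of_real (1 / p)"
          by (rule integral_mult_left_zero)
        also have "\<dots> = (\<integral>\<omega>. iexp (t * X \<omega>) \<partial>M)"
          unfolding char using p by simp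
        also have "\<dots> = char (distr M borel X) t"
          unfolding char_def by (subst integral_distr) auto
        finally show "char (distr D borel X) t = char (distr M borel X) t" .
      qed
    qed
    then have "emeasure (distr D borel X) S = emeasure (distr M borel X) S" by simp
    then have "emeasure D (X -` S \<inter> space M) = emeasure M (X -` S \<inter> space M)"
      by (simp add: emeasure_distr D_def)
    then have "prob (X -` S \<inter> space M \<inter> E) / p = prob (X -` S \<inter> space M)"
      using p by (subst (asm) emD) (auto simp: emeasure_eq_measure)
    moreover have "X -` S \<inter> space M \<inter> E = {\<omega>\<in>space M. X \<omega> \<in> S \<and> \<omega> \<in> E}"
      "X -` S \<inter> space M = {\<omega>\<in>space M. X \<omega> \<in> S}" by auto
    ultimately show ?thesis using p by (simp add: field_simps)
  qed
  have "{\<omega>\<in>space M. X \<omega> \<in> S \<and> \<omega> \<in> E} = {\<omega>\<in>space M. X \<omega> \<in> S \<and> npt A0 \<omega> = k0 \<and> npt A1 \<omega> = k1}"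
    by (auto simp: E_def)
  then show ?thesis using goal by (simp add: X_def p_def)
qed

end

section \<open>Concentration, variance and packing bounds\<close>

text \<open>The indicator of an interval is dominated by a multiple of a Gaussian, which is a mixture of
  characters.\<close>

lemma (in prob_space) prob_near_le_integral_char:
  fixes X :: "'a \<Rightarrow> real" and \<phi> :: "real \<Rightarrow> real"
  assumes [measurable]: "X \<in> borel_measurable M"
    and \<phi>: "integrable lborel \<phi>" and le: "\<And>t. norm (\<integral>\<omega>. iexp (t * X \<omega>) \<partial>M) \<le> \<phi> t"
    and e: "e > 0"
  shows "prob {\<omega>\<in>space M. \<bar>X \<omega> - v\<bar> \<le> e} \<le> e * (\<integral>t. \<phi> t \<partial>lborel)"
proof -
  have [measurable]: "\<phi> \<in> borel_measurable borel" using \<phi> by simp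
  have \<phi>0: "\<phi> t \<ge> 0" for t using order_trans[OF norm_ge_zero le[of t]] .
  let ?\<nu> = "std_normal_distribution"
  interpret \<nu>: real_distribution ?\<nu> by (rule real_dist_normal_dist)
  let ?Z = "\<lambda>\<omega>. (X \<omega> - v) / e"
  interpret pair_sigma_finite M ?\<nu> ..
  have gauss: "complex_of_real (exp (- (x\<^sup>2) / 2)) = (\<integral>s. iexp (x * s) \<partial>?\<nu>)" for x
    using fun_cong[OF char_std_normal_distribution, of x] by (simp add: char_def)
  have int1: "integrable M (\<lambda>\<omega>. exp (- ((?Z \<omega>)\<^sup>2) / 2))"
    by (intro integrable_const_bound[where B=1]) auto
  have A: "complex_of_real (\<integral>\<omega>. exp (- ((?Z \<omega>)\<^sup>2) / 2) \<partial>M) = (\<integral>\<omega>. (\<integral>s. iexp (?Z \<omega> * s) \<partial>?\<nu>) \<partial>M)"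
    by (simp only: integral_complex_of_real[symmetric] gauss)
  also have "\<dots> = (\<integral>s. (\<integral>\<omega>. iexp (?Z \<omega> * s) \<partial>M) \<partial>?\<nu>)"
  proof (rule Fubini_integral[symmetric])
    interpret P: pair_prob_space M ?\<nu> ..
    show "integrable (M \<Otimes>\<^sub>M ?\<nu>) (\<lambda>(\<omega>, s). iexp (?Z \<omega> * s))"
      by (rule P.P.integrable_const_bound[where B=1]) (auto simp: split_beta intro!: AE_I2)
  qed
  finally have F: "complex_of_real (\<integral>\<omega>. exp (- ((?Z \<omega>)\<^sup>2) / 2) \<partial>M) = (\<integral>s. (\<integral>\<omega>. iexp (?Z \<omega> * s) \<partial>M) \<partial>?\<nu>)" .
  \<comment> \<open>The shift by \<open>v\<close> only contributes a factor of modulus one, so the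
    bound does not depend on \<open>v\<close>.\<close>
  have bound: "norm (\<integral>\<omega>. iexp (?Z \<omega> * s) \<partial>M) \<le> \<phi> (s / e)" for s
  proof -
    have "iexp (?Z \<omega> * s) = iexp (- (v * s / e)) * iexp (s / e * X \<omega>)" for \<omega>
      by (simp add: exp_add[symmetric] diff_divide_distrib algebra_simps)
    then have "(\<integral>\<omega>. iexp (?Z \<omega> * s) \<partial>M) = iexp (- (v * s / e)) * (\<integral>\<omega>. iexp (s / e * X \<omega>) \<partial>M)"
      by simp
    then show ?thesis using le[of "s / e"] by (simp add: norm_mult)
  qed
  have \<phi>e: "integrable lborel (\<lambda>s. \<phi> (s / e))"
    using lborel_integrable_real_affine[OF \<phi>, of "1 / e" 0] e by simp
  have "(\<integral>\<omega>. exp (- ((?Z \<omega>)\<^sup>2) / 2) \<partial>M) = norm (complex_of_real (\<integral>\<omega>. exp (- ((?Z \<omega>)\<^sup>2) / 2) \<partial>M))"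
    by (simp add: Bochner_Integration.integral_nonneg)
  also have "\<dots> \<le> (\<integral>s. norm (\<integral>\<omega>. iexp (?Z \<omega> * s) \<partial>M) \<partial>?\<nu>)"
    unfolding F by (rule integral_norm_bound)
  also have "\<dots> = (\<integral>s. std_normal_density s * norm (\<integral>\<omega>. iexp (?Z \<omega> * s) \<partial>M) \<partial>lborel)"
    by (subst integral_density) (auto simp: normal_density_nonneg)
  also have "\<dots> \<le> (\<integral>s. 1 / sqrt (2 * pi) * \<phi> (s / e) \<partial>lborel)"
  proof (rule integral_mono_AE')
    show "AE s in lborel. std_normal_density s * norm (\<integral>\<omega>. iexp (?Z \<omega> * s) \<partial>M) \<le> 1 / sqrt (2 * pi) * \<phi> (s / e)"
    proof (intro AE_I2 mult_mono bound)
      show "std_normal_density s \<le> 1 / sqrt (2 * pi)" for s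
        by (simp add: std_normal_density_def divide_right_mono)
    qed auto
    show "integrable lborel (\<lambda>s. 1 / sqrt (2 * pi) * \<phi> (s / e))" using \<phi>e by simp
    show "AE s in lborel. 0 \<le> 1 / sqrt (2 * pi) * \<phi> (s / e)"
      by (simp add: \<phi>0)
  qed
  also have "\<dots> = 1 / sqrt (2 * pi) * (e * (\<integral>s. \<phi> s \<partial>lborel))"
    using lborel_integral_real_affine[of "1 / e" \<phi> 0] e by simp
  finally have G: "(\<integral>\<omega>. exp (- ((?Z \<omega>)\<^sup>2) / 2) \<partial>M) \<le> 1 / sqrt (2 * pi) * (e * (\<integral>s. \<phi> s \<partial>lborel))" .
  have "prob {\<omega>\<in>space M. \<bar>X \<omega> - v\<bar> \<le> e} = (\<integral>\<omega>. indicator {\<omega>\<in>space M. \<bar>X \<omega> - v\<bar> \<le> e} \<omega> \<partial>M)"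
    by simp
  also have "\<dots> \<le> (\<integral>\<omega>. exp (1 / 2) * exp (- ((?Z \<omega>)\<^sup>2) / 2) \<partial>M)"
  proof (rule integral_mono)
    fix \<omega> assume "\<omega> \<in> space M"
    show "indicator {\<omega>\<in>space M. \<bar>X \<omega> - v\<bar> \<le> e} \<omega> \<le> exp (1 / 2) * exp (- ((?Z \<omega>)\<^sup>2) / 2)"
    proof (cases "\<bar>X \<omega> - v\<bar> \<le> e")
      case True
      then have "\<bar>?Z \<omega>\<bar> \<le> 1" using e by simp
      then have "(?Z \<omega>)\<^sup>2 \<le> 1" by (simp add: abs_square_le_1)
      then show ?thesis by (simp add: exp_add[symmetric] indicator_def)
    qed simp
  qed (use int1 in \<open>auto simp: emeasure_eq_measure\<close>)
  also have "\<dots> = exp (1 / 2) * (\<integral>\<omega>. exp (- ((?Z \<omega>)\<^sup>2) / 2) \<partial>M)" by simp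
  also have "\<dots> \<le> exp (1 / 2) * (1 / sqrt (2 * pi) * (e * (\<integral>s. \<phi> s \<partial>lborel)))"
    by (intro mult_left_mono G) auto
  also have "\<dots> \<le> e * (\<integral>t. \<phi> t \<partial>lborel)"
  proof -
    \<comment> \<open>The constants cancel: e <= 3 < 2 pi, so the factor exp(1/2) lost in dominating
      the indicator is absorbed by the normalisation of the Gaussian density.\<close>
    have "exp (1 / 2 :: real) = sqrt (exp 1)"
      by (rule real_sqrt_unique[symmetric]) (simp_all add: power2_eq_square exp_add[symmetric])
    also have "\<dots> \<le> sqrt (2 * pi)"
      using exp_le pi_gt3 by simp
    finally have "exp (1 / 2) / sqrt (2 * pi) \<le> 1" by simp
    moreover have "e * (\<integral>t. \<phi> t \<partial>lborel) \<ge> 0"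
      using e \<phi>0 by simp
    ultimately have "exp (1 / 2) / sqrt (2 * pi) * (e * (\<integral>s. \<phi> s \<partial>lborel)) \<le> 1 * (e * (\<integral>s. \<phi> s \<partial>lborel))"
      by (rule mult_right_mono)
    then show ?thesis by simp
  qed
  finally show ?thesis .
qed

text \<open>Expand \<open>0 \<le> E (F - E F - t \<Sum>Y\<^sub>i)\<^sup>2\<close> with \<open>t = a / v\<close>.\<close>

lemma (in prob_space) variance_ge_sum_uncorrelated:
  fixes F :: "'a \<Rightarrow> real" and Y :: "'i \<Rightarrow> 'a \<Rightarrow> real"
  assumes [measurable]: "F \<in> borel_measurable M" "\<And>i. i \<in> I \<Longrightarrow> Y i \<in> borel_measurable M"
    and bF: "\<And>\<omega>. \<omega> \<in> space M \<Longrightarrow> \<bar>F \<omega>\<bar> \<le> K" and bY: "\<And>i \<omega>. i \<in> I \<Longrightarrow> \<bar>Y i \<omega>\<bar> \<le> K'"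
    and I: "finite I" and E0: "\<And>i. i \<in> I \<Longrightarrow> expectation (Y i) = 0"
    and E2: "\<And>i. i \<in> I \<Longrightarrow> expectation (\<lambda>\<omega>. Y i \<omega> * Y i \<omega>) = v"
    and Ec: "\<And>i j. i \<in> I \<Longrightarrow> j \<in> I \<Longrightarrow> i \<noteq> j \<Longrightarrow> expectation (\<lambda>\<omega>. Y i \<omega> * Y j \<omega>) = 0"
    and EF: "\<And>i. i \<in> I \<Longrightarrow> a \<le> expectation (\<lambda>\<omega>. F \<omega> * Y i \<omega>)"
    and v: "v > 0" and a: "a > 0"
  shows "real (card I) * a\<^sup>2 / v \<le> variance F"
proof -
  define S where "S \<omega> = (\<Sum>i\<in>I. Y i \<omega>)" for \<omega>
  define \<mu> where "\<mu> = expectation F"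
  define t where "t = a / v"
  have t: "t > 0" using a v by (simp add: t_def)
  have [measurable]: "S \<in> borel_measurable M" unfolding S_def by measurable
  have mb: "\<bar>x * y\<bar> \<le> A * B" if "\<bar>x\<bar> \<le> A" "\<bar>y\<bar> \<le> B" for x y A B :: real
    unfolding abs_mult using that by (intro mult_mono) auto
  have intF: "integrable M F" using bF by (intro integrable_const_bound[where B=K]) auto
  have intY: "integrable M (Y i)" if "i \<in> I" for i
    using bY that by (intro integrable_const_bound[where B=K']) auto
  have intFF: "integrable M (\<lambda>\<omega>. F \<omega> * F \<omega>)"
    using abs_le_D1[OF mb[OF bF bF]] by (intro integrable_const_bound[where B="K * K"]) auto
  have intFY: "integrable M (\<lambda>\<omega>. F \<omega> * Y i \<omega>)" if "i \<in> I" for i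
    using mb[OF bF bY[OF that]] that by (intro integrable_const_bound[where B="K * K'"]) auto
  have intYY: "integrable M (\<lambda>\<omega>. Y i \<omega> * Y j \<omega>)" if "i \<in> I" "j \<in> I" for i j
    using mb[OF bY[OF that(1)] bY[OF that(2)]] that by (intro integrable_const_bound[where B="K' * K'"]) auto
  have intS: "integrable M S" unfolding S_def using intY by auto
  have ES: "expectation S = 0"
    unfolding S_def using intY E0 by simp
  have FS: "F \<omega> * S \<omega> = (\<Sum>i\<in>I. F \<omega> * Y i \<omega>)" for \<omega>
    by (simp add: S_def sum_distrib_left)
  have intFS: "integrable M (\<lambda>\<omega>. F \<omega> * S \<omega>)"
    unfolding FS using intFY by auto
  have EFS: "real (card I) * a \<le> expectation (\<lambda>\<omega>. F \<omega> * S \<omega>)"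
  proof -
    have "real (card I) * a = (\<Sum>i\<in>I. a)" by simp
    also have "\<dots> \<le> (\<Sum>i\<in>I. expectation (\<lambda>\<omega>. F \<omega> * Y i \<omega>))" by (intro sum_mono EF)
    also have "\<dots> = expectation (\<lambda>\<omega>. F \<omega> * S \<omega>)"
      unfolding FS using intFY by simp
    finally show ?thesis .
  qed
  have SS: "S \<omega> * S \<omega> = (\<Sum>i\<in>I. \<Sum>j\<in>I. Y i \<omega> * Y j \<omega>)" for \<omega>
    by (simp add: S_def sum_product)
  have intSS: "integrable M (\<lambda>\<omega>. S \<omega> * S \<omega>)"
    unfolding SS using intYY by (intro Bochner_Integration.integrable_sum) auto
  have ESS: "expectation (\<lambda>\<omega>. S \<omega> * S \<omega>) = real (card I) * v"
  proof -
    have "expectation (\<lambda>\<omega>. S \<omega> * S \<omega>) = (\<Sum>i\<in>I. \<Sum>j\<in>I. expectation (\<lambda>\<omega>. Y i \<omega> * Y j \<omega>))"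
      unfolding SS using intYY
      by (subst Bochner_Integration.integral_sum) (auto intro!: sum.cong Bochner_Integration.integral_sum)
    also have "\<dots> = (\<Sum>i\<in>I. \<Sum>j\<in>I. if i = j then v else 0)"
      using E2 Ec by (intro sum.cong refl) auto
    also have "\<dots> = real (card I) * v" using I by simp
    finally show ?thesis .
  qed
  have expand: "(F \<omega> - \<mu> - t * S \<omega>)\<^sup>2 = (F \<omega> - \<mu>)\<^sup>2 - 2 * t * (F \<omega> * S \<omega>) + 2 * t * \<mu> * S \<omega> + t\<^sup>2 * (S \<omega> * S \<omega>)" for \<omega>
    by (simp add: power2_eq_square algebra_simps)
  have int2: "integrable M (\<lambda>\<omega>. (F \<omega> - \<mu>)\<^sup>2)"
    using intFF intF by (simp add: power2_eq_square algebra_simps)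
  have "0 \<le> expectation (\<lambda>\<omega>. (F \<omega> - \<mu> - t * S \<omega>)\<^sup>2)"
    by (rule Bochner_Integration.integral_nonneg) simp
  also have "\<dots> = expectation (\<lambda>\<omega>. (F \<omega> - \<mu>)\<^sup>2) - 2 * t * expectation (\<lambda>\<omega>. F \<omega> * S \<omega>)
      + 2 * t * \<mu> * expectation S + t\<^sup>2 * expectation (\<lambda>\<omega>. S \<omega> * S \<omega>)"
    unfolding expand using int2 intFS intS intSS by simp
  also have "\<dots> = variance F - 2 * t * expectation (\<lambda>\<omega>. F \<omega> * S \<omega>) + t\<^sup>2 * (real (card I) * v)"
    by (simp add: ES ESS \<mu>_def)
  also have "\<dots> \<le> variance F - 2 * t * (real (card I) * a) + t\<^sup>2 * (real (card I) * v)"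
    using mult_left_mono[OF EFS, of "2 * t"] t by simp
  also have "\<dots> = variance F - real (card I) * a\<^sup>2 / v"
    using v by (simp add: t_def power2_eq_square field_simps)
  finally show ?thesis by simp
qed

text \<open>The points form a cubic lattice of mesh 3 R in one orthant. The margin
  \<open>\<rho>\<close> keeps the ball of radius \<open>\<rho>\<close> around each of them inside
  the window.\<close>

lemma ex_separated_grid:
  fixes R \<rho> :: real
  assumes R: "R > 0" and \<rho>: "0 < \<rho>" "\<rho> \<le> 1 / 2"
  shows "\<exists>c>0. \<forall>s\<ge>1. \<exists>Z::'a::euclidean_space set. finite Z \<and> Z \<subseteq> cball 0 (s - \<rho>) \<and>
    (\<forall>z\<in>Z. \<forall>w\<in>Z. z \<noteq> w \<longrightarrow> 2 * R < dist z w) \<and> c * s ^ DIM('a) \<le> real (card Z)"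
proof (intro exI[of _ "(1 / (6 * R * DIM('a))) ^ DIM('a)"] conjI allI impI)
  show "0 < (1 / (6 * R * real DIM('a))) ^ DIM('a)" using R by simp
next
  fix s :: real assume s: "s \<ge> 1"
  let ?d = "real DIM('a)"
  \<comment> \<open>A lattice point with coordinates at most 3 R n has norm at most 3 R n d, hence
    this choice.\<close>
  define n where "n = nat \<lfloor>(s - \<rho>) / (3 * R * ?d)\<rfloor>"
  have q0: "0 \<le> (s - \<rho>) / (3 * R * ?d)" using s \<rho> R by simp
  have n1: "real n \<le> (s - \<rho>) / (3 * R * ?d)" using q0 by (simp add: n_def)
  have n2: "(s - \<rho>) / (3 * R * ?d) \<le> real n + 1" using q0 by (simp add: n_def)
  define P where "P = PiE (Basis::'a set) (\<lambda>_. {0..n})"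
  define pt where "pt f = (\<Sum>b\<in>Basis. (3 * R * real (f b)) *\<^sub>R b)" for f :: "'a \<Rightarrow> nat"
  have inner: "pt f \<bullet> b = 3 * R * real (f b)" if "b \<in> Basis" for f b
    using that by (simp add: pt_def inner_sum_left inner_Basis if_distrib cong: if_cong)
  have sep: "2 * R < dist (pt f) (pt f')" if "f \<in> P" "f' \<in> P" "f \<noteq> f'" for f f'
  proof -
    have "\<exists>b\<in>Basis. f b \<noteq> f' b"
    proof (rule ccontr)
      assume "\<not> (\<exists>b\<in>Basis. f b \<noteq> f' b)"
      then have "f = f'" by (intro PiE_ext[OF that(1,2)[unfolded P_def]]) auto
      then show False using that(3) by simp
    qed
    then obtain b where b: "b \<in> Basis" "f b \<noteq> f' b" by blast
    have "3 * R * 1 \<le> 3 * R * \<bar>real (f b) - real (f' b)\<bar>"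
      using b R by (intro mult_left_mono) auto
    also have "\<dots> = \<bar>(pt f - pt f') \<bullet> b\<bar>"
      using b(1) R by (simp add: inner_diff_left inner right_diff_distrib[symmetric] abs_mult)
    also have "\<dots> \<le> norm (pt f - pt f')" by (rule Basis_le_norm[OF b(1)])
    finally show ?thesis using R by (simp add: dist_norm)
  qed
  have inj: "inj_on pt P"
    using sep R by (force simp: inj_on_def)
  have fP: "finite P" unfolding P_def by (intro finite_PiE) auto
  show "\<exists>Z::'a set. finite Z \<and> Z \<subseteq> cball 0 (s - \<rho>) \<and> (\<forall>z\<in>Z. \<forall>w\<in>Z. z \<noteq> w \<longrightarrow> 2 * R < dist z w) \<and>
     (1 / (6 * R * ?d)) ^ DIM('a) * s ^ DIM('a) \<le> real (card Z)"
  proof (intro exI[of _ "pt ` P"] conjI)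
    show "finite (pt ` P)" using fP by simp
    show "pt ` P \<subseteq> cball 0 (s - \<rho>)"
    proof clarsimp
      fix f assume f: "f \<in> P"
      have "norm (pt f) \<le> (\<Sum>b\<in>Basis. norm ((3 * R * real (f b)) *\<^sub>R (b::'a)))"
        unfolding pt_def by (rule norm_sum)
      also have "\<dots> \<le> (\<Sum>b\<in>(Basis::'a set). 3 * R * real n)"
        using f R by (intro sum_mono) (auto simp: P_def PiE_def Pi_def)
      also have "\<dots> = (3 * R * ?d) * real n" by simp
      also have "\<dots> \<le> (3 * R * ?d) * ((s - \<rho>) / (3 * R * ?d))"
        using n1 R by (intro mult_left_mono) auto
      also have "\<dots> = s - \<rho>" using R by simp
      finally show "norm (pt f) \<le> s - \<rho>" .
    qed
    show "\<forall>z\<in>pt ` P. \<forall>w\<in>pt ` P. z \<noteq> w \<longrightarrow> 2 * R < dist z w"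
      using sep by blast
    \<comment> \<open>Uses s >= 1 and \<rho> <= 1/2. Each coordinate takes n + 1 values, 0 included,
      so rounding down does no harm even when n = 0.\<close>
    have "s / 2 \<le> s - \<rho>" using s \<rho> by simp
    then have "s / 2 / (3 * R * ?d) \<le> real n + 1"
      using n2 R divide_right_mono[of "s / 2" "s - \<rho>" "3 * R * ?d"] by simp
    then have "(1 / (6 * R * ?d) * s) ^ DIM('a) \<le> (real n + 1) ^ DIM('a)"
      using s R by (intro power_mono) auto
    also have "\<dots> = real (card (pt ` P))"
      using inj by (simp add: card_image P_def card_PiE add.commute)
    finally show "(1 / (6 * R * ?d)) ^ DIM('a) * s ^ DIM('a) \<le> real (card (pt ` P))"
      by (simp only: power_mult_distrib)
  qed
qed

lemma lborel_distr_diff: "distr lborel borel (\<lambda>y. x - y) = (lborel :: 'a::euclidean_space measure)"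
  by (subst lborel_affine[of "-1" x], auto simp: density_1)

lemma integrable_reflect_translate:
  fixes g :: "'a::euclidean_space \<Rightarrow> real"
  assumes "integrable lborel g"
  shows "integrable lborel (\<lambda>y. g (x - y))"
proof -
  have "integrable (distr lborel borel (\<lambda>y. x - y)) g"
    using assms by (simp add: lborel_distr_diff)
  then show ?thesis using assms by (subst (asm) integrable_distr_eq) auto
qed

lemma integral_reflect_translate:
  fixes g :: "'a::euclidean_space \<Rightarrow> real"
  assumes [measurable]: "g \<in> borel_measurable borel"
  shows "(\<integral>y. g (x - y) \<partial>lborel) = (\<integral>y. g y \<partial>lborel)"
proof -
  have "(\<integral>y. g y \<partial>lborel) = (\<integral>y. g y \<partial>distr lborel borel (\<lambda>y. x - y))"
    by (simp add: lborel_distr_diff)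
  also have "\<dots> = (\<integral>y. g (x - y) \<partial>lborel)"
    by (subst integral_distr) auto
  finally show ?thesis by simp
qed

section \<open>Splitting the shot noise into near and far points\<close>

context poisson_lborel
begin

lemma shot_noise_measurable:
  fixes g :: "'a \<Rightarrow> real"
  assumes [measurable]: "g \<in> borel_measurable borel"
  shows "(\<lambda>p. shot_noise g (\<eta> (snd p)) (fst p)) \<in> borel_measurable (lborel \<Otimes>\<^sub>M M)"
proof -
  have "shot_noise g (\<eta> (snd p)) (fst p) = (\<integral>y. g (fst p - y) \<partial>N (snd p))" for p :: "'a \<times> 'w"
    unfolding shot_noise_def by (rule infsum_eq_integral_N) measurable
  then show ?thesis
    by (simp only:) (intro integral_N_measurable, measurable)
qed

text \<open>Once \<open>C - Q\<close> is empty, the field is the far part plus one term of size at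
  least \<open>m\<close> for each point of \<open>Q\<close>. Only almost sure, because splitting the
  integral needs integrability. Here \<open>m\<close> may be negative, so that losses are covered as
  well.\<close>

lemma shot_noise_local_bound:
  fixes g :: "'a \<Rightarrow> real"
  assumes g: "integrable lborel g"
    and C [measurable]: "C \<in> sets borel" "Q \<in> sets borel" and bC: "bounded C" and QC: "Q \<subseteq> C"
    and m: "\<And>y. y \<in> Q \<Longrightarrow> m \<le> g (x - y)"
  shows "AE \<omega> in M. npt (C - Q) \<omega> = 0 \<longrightarrow>
    (\<integral>y. g (x - y) * indicator (- C) y \<partial>N \<omega>) + real (npt Q \<omega>) * m \<le> shot_noise g (\<eta> \<omega>) x \<and>
    (npt Q \<omega> = 0 \<longrightarrow> shot_noise g (\<eta> \<omega>) x = (\<integral>y. g (x - y) * indicator (- C) y \<partial>N \<omega>))"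
proof -
  have [measurable]: "g \<in> borel_measurable borel" using g by simp
  have bQ: "bounded Q" using bC QC by (rule bounded_subset)
  have "integrable lborel (\<lambda>y. g (x - y))"
    by (rule integrable_reflect_translate[OF g])
  from AE_integrable_N[OF this] show ?thesis
  proof (rule AE_mp[OF _ AE_I2], intro impI)
    fix \<omega> assume w: "\<omega> \<in> space M" and i: "integrable (N \<omega>) (\<lambda>y. g (x - y))" and z: "npt (C - Q) \<omega> = 0"
    let ?h = "\<lambda>y. g (x - y)"
    have iA: "integrable (N \<omega>) (\<lambda>y. ?h y * indicator A y)" if "A \<in> sets borel" for A
      using i that by (intro integrable_real_mult_indicator) auto
    have "emeasure (N \<omega>) (C - Q) = 0"
      using w z bC by (simp add: emeasure_N_bounded bounded_diff)
    then have ae: "AE y in N \<omega>. y \<notin> C - Q"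
      by (intro AE_not_in) (auto simp: null_sets_def)
    have "shot_noise g (\<eta> \<omega>) x = (\<integral>y. ?h y \<partial>N \<omega>)"
      unfolding shot_noise_def by (rule infsum_eq_integral_N) measurable
    also have "\<dots> = (\<integral>y. ?h y * indicator (- C) y + ?h y * indicator Q y \<partial>N \<omega>)"
      using ae QC by (intro integral_cong_AE) (auto simp: indicator_def)
    also have "\<dots> = (\<integral>y. ?h y * indicator (- C) y \<partial>N \<omega>) + (\<integral>y. ?h y * indicator Q y \<partial>N \<omega>)"
      by (intro Bochner_Integration.integral_add iA) auto
    finally have eq: "shot_noise g (\<eta> \<omega>) x = (\<integral>y. ?h y * indicator (- C) y \<partial>N \<omega>) + (\<integral>y. ?h y * indicator Q y \<partial>N \<omega>)" .
    have fQ: "emeasure (N \<omega>) Q < \<infinity>"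
      using w bQ by (simp add: emeasure_N_bounded ennreal_of_nat_eq_real_of_nat)
    have "real (npt Q \<omega>) * m = (\<integral>y. m * indicator Q y \<partial>N \<omega>)"
      using w bQ by (simp add: measure_N_bounded)
    also have "\<dots> \<le> (\<integral>y. ?h y * indicator Q y \<partial>N \<omega>)"
      using m fQ
      by (intro integral_mono iA integrable_mult_right integrable_real_indicator) (auto simp: indicator_def)
    finally have le: "real (npt Q \<omega>) * m \<le> (\<integral>y. ?h y * indicator Q y \<partial>N \<omega>)" .
    have "(\<integral>y. ?h y * indicator Q y \<partial>N \<omega>) = 0" if "npt Q \<omega> = 0"
    proof -
      have "emeasure (N \<omega>) Q = 0"
        using w that bQ by (simp add: emeasure_N_bounded)
      then have "AE y in N \<omega>. y \<notin> Q"
        by (intro AE_not_in) (auto simp: null_sets_def)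
      then have "(\<integral>y. ?h y * indicator Q y \<partial>N \<omega>) = (\<integral>y. 0 \<partial>N \<omega>)"
        by (intro integral_cong_AE) (auto simp: indicator_def)
      then show ?thesis by simp
    qed
    then show "(\<integral>y. ?h y * indicator (- C) y \<partial>N \<omega>) + real (npt Q \<omega>) * m \<le> shot_noise g (\<eta> \<omega>) x \<and>
      (npt Q \<omega> = 0 \<longrightarrow> shot_noise g (\<eta> \<omega>) x = (\<integral>y. ?h y * indicator (- C) y \<partial>N \<omega>))"
      using eq le by auto
  qed
qed

text \<open>\<open>D z\<close> plays the role of the shell and \<open>Q z\<close> that of the core.
  The functions \<open>a\<close> and \<open>b\<close> are left general so that both the means of
  products of distinct probes and the second moment of a single probe are instances.\<close>

lemma expectation_prod_local:
  fixes D Q :: "'i \<Rightarrow> 'a set" and a b :: "nat \<Rightarrow> real"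
  assumes Z: "finite Z" and mD: "\<And>z. z \<in> Z \<Longrightarrow> D z \<in> sets borel \<and> bounded (D z)"
    and mQ: "\<And>z. z \<in> Z \<Longrightarrow> Q z \<in> sets borel \<and> bounded (Q z)"
    and DQ: "\<And>z. z \<in> Z \<Longrightarrow> D z \<inter> Q z = {}"
    and disj: "\<And>z w. z \<in> Z \<Longrightarrow> w \<in> Z \<Longrightarrow> z \<noteq> w \<Longrightarrow> (D z \<union> Q z) \<inter> (D w \<union> Q w) = {}"
    and ba: "\<And>n. \<bar>a n\<bar> \<le> K" and bb: "\<And>n. \<bar>b n\<bar> \<le> K"
  shows "expectation (\<lambda>\<omega>. \<Prod>z\<in>Z. a (npt (D z) \<omega>) * b (npt (Q z) \<omega>)) =
    (\<Prod>z\<in>Z. expectation (\<lambda>\<omega>. a (npt (D z) \<omega>)) * expectation (\<lambda>\<omega>. b (npt (Q z) \<omega>)))"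
proof -
  let ?J = "Z \<times> (UNIV :: bool set)"
  define B where "B = (\<lambda>(z, c). if c then Q z else D z)"
  define \<phi> where "\<phi> = (\<lambda>(z :: 'i, c). if c then b else a)"
  have B: "B j \<in> sets borel" "bounded (B j)" if "j \<in> ?J" for j
    using that mD mQ by (auto simp: B_def)
  have dB: "disjoint_family_on B ?J"
    unfolding disjoint_family_on_def
  proof (intro ballI impI)
    fix j j' assume "j \<in> ?J" "j' \<in> ?J" "j \<noteq> j'"
    then show "B j \<inter> B j' = {}"
      using DQ[of "fst j"] disj[of "fst j" "fst j'"]
      by (cases "fst j = fst j'") (auto simp: B_def split: if_splits)
  qed
  have int: "integrable M (\<lambda>\<omega>. \<phi> j (npt (B j) \<omega>))" if "j \<in> ?J" for j
  proof (rule integrable_const_bound[where B=K])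
    have [measurable]: "npt (B j) \<in> M \<rightarrow>\<^sub>M count_space UNIV" using B[OF that] by simp
    show "(\<lambda>\<omega>. \<phi> j (npt (B j) \<omega>)) \<in> borel_measurable M" by measurable
  qed (use ba bb in \<open>auto simp: \<phi>_def split_beta\<close>)
  have "expectation (\<lambda>\<omega>. \<Prod>j\<in>?J. \<phi> j (npt (B j) \<omega>)) = (\<Prod>j\<in>?J. expectation (\<lambda>\<omega>. \<phi> j (npt (B j) \<omega>)))"
    using Z by (intro expectation_prod_npt B dB int) auto
  then show ?thesis
    by (simp add: prod.cartesian_product' UNIV_bool B_def \<phi>_def)
qed

lemma expectation_of_bool_npt:
  assumes "B \<in> sets borel" "bounded B"
  shows "expectation (\<lambda>\<omega>. of_bool (npt B \<omega> = k)) = measure lborel B ^ k / fact k * exp (- measure lborel B)"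
proof -
  have [measurable]: "npt B \<in> M \<rightarrow>\<^sub>M count_space UNIV" using assms by simp
  have "expectation (\<lambda>\<omega>. of_bool (npt B \<omega> = k)) = expectation (indicator {\<omega>\<in>space M. npt B \<omega> = k})"
    by (intro Bochner_Integration.integral_cong refl) (auto simp: indicator_def)
  also have "\<dots> = prob {\<omega>\<in>space M. npt B \<omega> = k}" by simp
  also have "\<dots> = measure lborel B ^ k / fact k * exp (- measure lborel B)" by (rule prob_npt[OF assms])
  finally show ?thesis .
qed

end

section \<open>The variance of the excursion volume\<close>

lemma translate_lborel:
  fixes \<beta> :: "'a::euclidean_space \<Rightarrow> real"
  assumes "integrable lborel \<beta>"
  shows "integrable lborel (\<lambda>x. \<beta> (x - z))" and "(\<integral>x. \<beta> (x - z) \<partial>lborel) = (\<integral>x. \<beta> x \<partial>lborel)"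
proof -
  have e: "(\<lambda>x. x - z) = (+) (- z)" by (auto simp: fun_eq_iff)
  have d: "distr lborel borel (\<lambda>x. x - z) = (lborel :: 'a measure)"
    unfolding e by (rule lborel_distr_plus)
  have "integrable (distr lborel borel (\<lambda>x. x - z)) \<beta>" using assms by (simp add: d)
  then show "integrable lborel (\<lambda>x. \<beta> (x - z))" using assms by (subst (asm) integrable_distr_eq) auto
  have "(\<integral>x. \<beta> x \<partial>lborel) = (\<integral>x. \<beta> x \<partial>distr lborel borel (\<lambda>x. x - z))" by (simp add: d)
  also have "\<dots> = (\<integral>x. \<beta> (x - z) \<partial>lborel)" using assms by (subst integral_distr) auto
  finally show "(\<integral>x. \<beta> (x - z) \<partial>lborel) = (\<integral>x. \<beta> x \<partial>lborel)" by simp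
qed

lemma (in prob_space) expectation_of_bool:
  assumes "{\<omega>\<in>space M. P \<omega>} \<in> events"
  shows "expectation (\<lambda>\<omega>. of_bool (P \<omega>)) = prob {\<omega>\<in>space M. P \<omega>}"
proof -
  have "expectation (\<lambda>\<omega>. of_bool (P \<omega>)) = expectation (indicator {\<omega>\<in>space M. P \<omega>})"
    by (intro Bochner_Integration.integral_cong refl) (auto simp: indicator_def)
  also have "\<dots> = prob {\<omega>\<in>space M. P \<omega>}" using assms by simp
  finally show ?thesis .
qed

section \<open>Probes and their correlation with the excursion set\<close>

context poisson_lborel
begin

text \<open>The field X of the overview, as seen at \<open>x\<close> when C_z is the ball of radius
  \<open>R\<close> around \<open>z\<close>.\<close>

definition far_shot :: "('a \<Rightarrow> real) \<Rightarrow> real \<Rightarrow> 'a \<Rightarrow> 'a \<Rightarrow> 'w \<Rightarrow> real" where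
  "far_shot g R z x \<omega> = (\<integral>y. g (x - y) * indicator (- cball z R) y \<partial>N \<omega>)"

lemma far_shot_measurable [measurable]:
  assumes [measurable]: "g \<in> borel_measurable borel"
  shows "far_shot g R z x \<in> borel_measurable M"
proof -
  have [measurable]: "cball z R \<in> sets borel" by simp
  show ?thesis unfolding far_shot_def by measurable
qed

text \<open>The test variable Y_z of the overview.\<close>

definition probe :: "real \<Rightarrow> real \<Rightarrow> nat \<Rightarrow> 'a \<Rightarrow> 'w \<Rightarrow> real" where
  "probe R r k z \<omega> = of_bool (npt (cball z R - cball z r) \<omega> = 0) *
     (of_bool (npt (cball z r) \<omega> = k) / prob {\<omega>\<in>space M. npt (cball z r) \<omega> = k} -
      of_bool (npt (cball z r) \<omega> = 0) / prob {\<omega>\<in>space M. npt (cball z r) \<omega> = 0})"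

lemma prob_npt_pos:
  assumes "B \<in> sets borel" "bounded B" "measure lborel B > 0"
  shows "prob {\<omega>\<in>space M. npt B \<omega> = k} > 0"
  using assms by (simp add: prob_npt)

lemma probe_measurable [measurable]: "probe R r k z \<in> borel_measurable M"
proof -
  have [measurable]: "npt (cball z r) \<in> M \<rightarrow>\<^sub>M count_space UNIV"
    "npt (cball z R - cball z r) \<in> M \<rightarrow>\<^sub>M count_space UNIV"
    by (simp_all add: bounded_diff)
  show ?thesis unfolding probe_def by measurable
qed

text \<open>The positive part of the probe needs only a lower bound of the field, which is X + k m;
  in its negative part there is no point in the core and the field equals X. By independence the
  weights 1/p_k and 1/p_0 cancel the probabilities of the counts, and the probability of an empty
  shell remains as a common factor.\<close>

lemma expectation_exceeds_probe_ge:
  fixes g :: "'a \<Rightarrow> real"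
  assumes g: "integrable lborel g" and r: "0 < r" "r \<le> R" and k: "k \<ge> 1"
    and m: "\<And>y. y \<in> cball z r \<Longrightarrow> m \<le> g (x - y)"
  shows "prob {\<omega>\<in>space M. npt (cball z R - cball z r) \<omega> = 0} *
      (prob {\<omega>\<in>space M. u \<le> far_shot g R z x \<omega> + real k * m} - prob {\<omega>\<in>space M. u \<le> far_shot g R z x \<omega>})
    \<le> expectation (\<lambda>\<omega>. of_bool (u \<le> shot_noise g (\<eta> \<omega>) x) * probe R r k z \<omega>)"
proof -
  let ?C = "cball z R" and ?Q = "cball z r"
  let ?D = "?C - ?Q"
  have [measurable]: "g \<in> borel_measurable borel" using g by simp
  have [measurable]: "?C \<in> sets borel" "?Q \<in> sets borel" by simp_all
  have [measurable]: "npt ?Q \<in> M \<rightarrow>\<^sub>M count_space UNIV" "npt ?D \<in> M \<rightarrow>\<^sub>M count_space UNIV"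
    by (simp_all add: bounded_diff)
  define X where "X = far_shot g R z x"
  have [measurable]: "X \<in> borel_measurable M" unfolding X_def by measurable
  define f where "f \<omega> = shot_noise g (\<eta> \<omega>) x" for \<omega>
  have [measurable]: "f \<in> borel_measurable M"
  proof -
    have "f = (\<lambda>\<omega>. \<integral>y. g (x - y) \<partial>N \<omega>)"
      unfolding f_def shot_noise_def by (intro ext infsum_eq_integral_N) measurable
    then show ?thesis by simp
  qed
  define pk where "pk = prob {\<omega>\<in>space M. npt ?Q \<omega> = k}"
  define p0 where "p0 = prob {\<omega>\<in>space M. npt ?Q \<omega> = 0}"
  define q where "q = prob {\<omega>\<in>space M. npt ?D \<omega> = 0}"
  have Qpos: "measure lborel ?Q > 0" using r by (simp add: content_cball)
  have pk: "pk > 0" and p0: "p0 > 0"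
    unfolding pk_def p0_def using Qpos by (auto intro!: prob_npt_pos)
  define h where "h y = g (x - y) * indicator (- ?C) y" for y
  have h: "integrable lborel h"
    unfolding h_def by (intro integrable_real_mult_indicator integrable_reflect_translate g) measurable
  have hX: "(\<integral>y. h y \<partial>N \<omega>) = X \<omega>" for \<omega> by (simp add: h_def X_def far_shot_def)
  \<comment> \<open>\<open>h\<close> vanishes on the large ball, so both the core and the shell are
    admissible windows.\<close>
  have ind: "prob {\<omega>\<in>space M. X \<omega> \<in> S \<and> npt ?Q \<omega> = j \<and> npt ?D \<omega> = 0} =
    prob {\<omega>\<in>space M. X \<omega> \<in> S} * (prob {\<omega>\<in>space M. npt ?Q \<omega> = j} * q)" if "S \<in> sets borel" for S j
    unfolding q_def hX[symmetric] using r that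
    by (intro prob_shot_indep[OF h]) (auto simp: h_def indicator_def bounded_diff)
  have ae: "AE \<omega> in M. of_bool (X \<omega> \<in> {u - real k * m..} \<and> npt ?Q \<omega> = k \<and> npt ?D \<omega> = 0) / pk
      - of_bool (X \<omega> \<in> {u..} \<and> npt ?Q \<omega> = 0 \<and> npt ?D \<omega> = 0) / p0
    \<le> of_bool (u \<le> f \<omega>) * probe R r k z \<omega>"
  proof -
    have "AE \<omega> in M. npt (?C - ?Q) \<omega> = 0 \<longrightarrow>
      X \<omega> + real (npt ?Q \<omega>) * m \<le> f \<omega> \<and> (npt ?Q \<omega> = 0 \<longrightarrow> f \<omega> = X \<omega>)"
      unfolding X_def f_def far_shot_def
      using r by (intro shot_noise_local_bound[OF g] m) auto
    then show ?thesis
    proof eventually_elim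
      case (elim \<omega>)
      show ?case
      proof (cases "npt ?D \<omega> = 0")
        case D: True
        consider "npt ?Q \<omega> = k" | "npt ?Q \<omega> = 0" | "npt ?Q \<omega> \<noteq> k" "npt ?Q \<omega> \<noteq> 0" by blast
        then show ?thesis
        proof cases
          case 1
          then have "u - real k * m \<le> X \<omega> \<Longrightarrow> u \<le> f \<omega>" using elim D by auto
          then show ?thesis using 1 D k pk by (auto simp: probe_def pk_def[symmetric] p0_def[symmetric])
        next
          case 2
          then show ?thesis using elim D k p0 by (auto simp: probe_def pk_def[symmetric] p0_def[symmetric])
        next
          case 3
          then show ?thesis by (simp add: probe_def)
        qed
      qed (simp add: probe_def)
    qed
  qed
  have K: "\<bar>probe R r k z \<omega>\<bar> \<le> 1 / pk + 1 / p0" for \<omega>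
    using pk p0 abs_triangle_ineq4[of "1 / pk" "1 / p0"]
    by (auto simp: probe_def pk_def[symmetric] p0_def[symmetric])
  have E: "expectation (\<lambda>\<omega>. of_bool (X \<omega> \<in> {u - real k * m..} \<and> npt ?Q \<omega> = k \<and> npt ?D \<omega> = 0) / pk
      - of_bool (X \<omega> \<in> {u..} \<and> npt ?Q \<omega> = 0 \<and> npt ?D \<omega> = 0) / p0)
    = prob {\<omega>\<in>space M. X \<omega> \<in> {u - real k * m..}} * q - prob {\<omega>\<in>space M. X \<omega> \<in> {u..}} * q"
  proof (subst Bochner_Integration.integral_diff)
    show "integrable M (\<lambda>\<omega>. of_bool (X \<omega> \<in> {u - real k * m..} \<and> npt ?Q \<omega> = k \<and> npt ?D \<omega> = 0) / pk)"
      using pk by (intro integrable_const_bound[where B="1/pk"]) auto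
    show "integrable M (\<lambda>\<omega>. of_bool (X \<omega> \<in> {u..} \<and> npt ?Q \<omega> = 0 \<and> npt ?D \<omega> = 0) / p0)"
      using p0 by (intro integrable_const_bound[where B="1/p0"]) auto
    have "expectation (\<lambda>\<omega>. of_bool (X \<omega> \<in> {u - real k * m..} \<and> npt ?Q \<omega> = k \<and> npt ?D \<omega> = 0) / pk) =
       prob {\<omega>\<in>space M. X \<omega> \<in> {u - real k * m..} \<and> npt ?Q \<omega> = k \<and> npt ?D \<omega> = 0} / pk"
      by (subst integral_divide_zero, subst expectation_of_bool) measurable
    also have "\<dots> = prob {\<omega>\<in>space M. X \<omega> \<in> {u - real k * m..}} * q"
      using pk by (subst ind) (auto simp: pk_def)
    finally have 1: "expectation (\<lambda>\<omega>. of_bool (X \<omega> \<in> {u - real k * m..} \<and> npt ?Q \<omega> = k \<and> npt ?D \<omega> = 0) / pk) =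
      prob {\<omega>\<in>space M. X \<omega> \<in> {u - real k * m..}} * q" .
    have "expectation (\<lambda>\<omega>. of_bool (X \<omega> \<in> {u..} \<and> npt ?Q \<omega> = 0 \<and> npt ?D \<omega> = 0) / p0) =
       prob {\<omega>\<in>space M. X \<omega> \<in> {u..} \<and> npt ?Q \<omega> = 0 \<and> npt ?D \<omega> = 0} / p0"
      by (subst integral_divide_zero, subst expectation_of_bool) measurable
    also have "\<dots> = prob {\<omega>\<in>space M. X \<omega> \<in> {u..}} * q"
      using p0 by (subst ind) (auto simp: p0_def)
    finally show "expectation (\<lambda>\<omega>. of_bool (X \<omega> \<in> {u - real k * m..} \<and> npt ?Q \<omega> = k \<and> npt ?D \<omega> = 0) / pk)
      - expectation (\<lambda>\<omega>. of_bool (X \<omega> \<in> {u..} \<and> npt ?Q \<omega> = 0 \<and> npt ?D \<omega> = 0) / p0)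
      = prob {\<omega>\<in>space M. X \<omega> \<in> {u - real k * m..}} * q - prob {\<omega>\<in>space M. X \<omega> \<in> {u..}} * q"
      using 1 by simp
  qed
  have "q * (prob {\<omega>\<in>space M. u \<le> X \<omega> + real k * m} - prob {\<omega>\<in>space M. u \<le> X \<omega>}) =
    prob {\<omega>\<in>space M. X \<omega> \<in> {u - real k * m..}} * q - prob {\<omega>\<in>space M. X \<omega> \<in> {u..}} * q"
    by (simp add: algebra_simps)
  also have "\<dots> \<le> expectation (\<lambda>\<omega>. of_bool (u \<le> f \<omega>) * probe R r k z \<omega>)"
    unfolding E[symmetric]
  proof (rule integral_mono_AE[OF _ _ ae])
    show "integrable M (\<lambda>\<omega>. of_bool (u \<le> f \<omega>) * probe R r k z \<omega>)"
      using K pk p0 by (intro integrable_const_bound[where B="1/pk + 1/p0"]) auto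
    show "integrable M (\<lambda>\<omega>. of_bool (X \<omega> \<in> {u - real k * m..} \<and> npt ?Q \<omega> = k \<and> npt ?D \<omega> = 0) / pk
      - of_bool (X \<omega> \<in> {u..} \<and> npt ?Q \<omega> = 0 \<and> npt ?D \<omega> = 0) / p0)"
    proof (rule Bochner_Integration.integrable_diff)
      show "integrable M (\<lambda>\<omega>. of_bool (X \<omega> \<in> {u - real k * m..} \<and> npt ?Q \<omega> = k \<and> npt ?D \<omega> = 0) / pk)"
        using pk by (intro integrable_const_bound[where B="1/pk"]) auto
      show "integrable M (\<lambda>\<omega>. of_bool (X \<omega> \<in> {u..} \<and> npt ?Q \<omega> = 0 \<and> npt ?D \<omega> = 0) / p0)"
        using p0 by (intro integrable_const_bound[where B="1/p0"]) auto
    qed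
  qed
  finally show ?thesis by (simp add: q_def X_def f_def)
qed

text \<open>By translation invariance the probabilities entering a probe do not depend on its
  centre; this and \<open>count_prob\<close> are their closed forms, shared by all probes.\<close>

definition void_prob :: "real \<Rightarrow> real \<Rightarrow> real" where
  "void_prob R r = exp (- (measure lborel (cball (0::'a) R) - measure lborel (cball (0::'a) r)))"

definition count_prob :: "real \<Rightarrow> nat \<Rightarrow> real" where
  "count_prob r k = measure lborel (cball (0::'a) r) ^ k / fact k * exp (- measure lborel (cball (0::'a) r))"

lemma prob_npt_cball: "r \<ge> 0 \<Longrightarrow> prob {\<omega>\<in>space M. npt (cball z r) \<omega> = k} = count_prob r k"
  by (simp add: prob_npt count_prob_def content_cball)

lemma prob_npt_annulus:
  assumes "0 \<le> r" "r \<le> R"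
  shows "prob {\<omega>\<in>space M. npt (cball z R - cball z r) \<omega> = 0} = void_prob R r"
proof -
  have "measure lborel (cball z R - cball z r) = measure lborel (cball z R) - measure lborel (cball z r)"
    using assms emeasure_bounded_finite[of "cball z R"]
    by (intro measure_Diff) (auto simp: fmeasurable_def)
  then show ?thesis
    using assms by (simp add: prob_npt void_prob_def content_cball bounded_diff)
qed

lemma count_prob_pos: "r > 0 \<Longrightarrow> count_prob r k > 0"
  by (simp add: count_prob_def content_cball)

lemma void_prob_pos: "void_prob R r > 0"
  by (simp add: void_prob_def)

lemma probe_eq:
  assumes "r \<ge> 0"
  shows "probe R r k z \<omega> = of_bool (npt (cball z R - cball z r) \<omega> = 0) *
     (of_bool (npt (cball z r) \<omega> = k) / count_prob r k - of_bool (npt (cball z r) \<omega> = 0) / count_prob r 0)"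
  using assms by (simp add: probe_def prob_npt_cball)

lemma abs_probe_le:
  assumes "r > 0"
  shows "\<bar>probe R r k z \<omega>\<bar> \<le> 1 / count_prob r k + 1 / count_prob r 0"
  using count_prob_pos[OF assms, of k] count_prob_pos[OF assms, of 0] assms
    abs_triangle_ineq4[of "1 / count_prob r k" "1 / count_prob r 0"]
  by (auto simp: probe_eq)

text \<open>The core factor has mean p_k/p_k - p_0/p_0 = 0, and disjointness of the large balls
  factorises the product. Singletons give centred probes, pairs give uncorrelated ones.\<close>

lemma expectation_prod_probe:
  fixes j :: nat
  assumes r: "0 < r" "r \<le> R" and k: "k \<ge> 1" and Z: "finite Z" "Z \<noteq> {}"
    and sep: "\<And>z w. z \<in> Z \<Longrightarrow> w \<in> Z \<Longrightarrow> z \<noteq> w \<Longrightarrow> 2 * R < dist z w"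
  shows "expectation (\<lambda>\<omega>. \<Prod>z\<in>Z. probe R r k z \<omega>) = 0"
    and "expectation (\<lambda>\<omega>. probe R r k z \<omega> * probe R r k z \<omega>) =
      void_prob R r * (1 / count_prob r k + 1 / count_prob r 0)"
proof -
  let ?D = "\<lambda>z::'a. cball z R - cball z r" and ?Q = "\<lambda>z::'a. cball z r"
  let ?pk = "count_prob r k" and ?p0 = "count_prob r 0"
  have p: "?pk > 0" "?p0 > 0" using r by (simp_all add: count_prob_pos)
  define a where "a n = (of_bool (n = 0) :: real)" for n :: nat
  define b where "b n = of_bool (n = k) / ?pk - of_bool (n = 0) / ?p0" for n :: nat
  define c where "c = 1 / ?pk + 1 / ?p0"
  have c: "c > 0" using p by (simp add: c_def add_pos_pos)
  \<comment> \<open>One constant that dominates 1, c and c * c, hence \<open>a\<close>,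
    \<open>b\<close> and the square of \<open>b\<close> at once.\<close>
  define K where "K = 1 + c * c + c"
  have ba: "\<bar>a n\<bar> \<le> K" for n using c by (auto simp: a_def K_def intro: add_nonneg_nonneg)
  have bb0: "\<bar>b n\<bar> \<le> c" for n using p by (auto simp: b_def c_def)
  have cc: "0 < c * c" using c by simp
  have bb: "\<bar>b n\<bar> \<le> K" for n using bb0[of n] cc unfolding K_def by linarith
  have bbb: "\<bar>b n * b n\<bar> \<le> K" for n
  proof -
    have "\<bar>b n * b n\<bar> \<le> c * c" unfolding abs_mult by (intro mult_mono bb0) (use c in auto)
    then show ?thesis using c unfolding K_def by linarith
  qed
  have Y: "probe R r k z \<omega> = a (npt (?D z) \<omega>) * b (npt (?Q z) \<omega>)" for z \<omega>
    using r by (simp add: probe_eq a_def b_def)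
  have disj: "(?D z \<union> ?Q z) \<inter> (?D w \<union> ?Q w) = {}" if "z \<in> Z" "w \<in> Z" "z \<noteq> w" for z w
  proof -
    have "cball z R \<inter> cball w R = {}"
    proof (rule ccontr)
      assume "cball z R \<inter> cball w R \<noteq> {}"
      then obtain y where "dist z y \<le> R" "dist w y \<le> R" by auto
      then have "dist z w \<le> 2 * R" using dist_triangle2[of z w y] by simp
      then show False using sep[OF that] by simp
    qed
    moreover have "cball v r \<subseteq> cball v R" for v :: 'a using r by auto
    ultimately show ?thesis by blast
  qed
  have Ek: "expectation (\<lambda>\<omega>. of_bool (npt (?Q z) \<omega> = j)) = count_prob r j" for z j
    using r by (simp add: expectation_of_bool_npt count_prob_def content_cball)
  have [measurable]: "npt (?Q z) \<in> M \<rightarrow>\<^sub>M count_space UNIV" for z by simp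
  have ik: "integrable M (\<lambda>\<omega>. of_bool (npt (?Q z) \<omega> = j) :: real)" for z j
    by (intro integrable_const_bound[where B=1]) auto
  have Eb: "expectation (\<lambda>\<omega>. b (npt (?Q z) \<omega>)) = 0" for z
    unfolding b_def using p ik by (simp add: Ek)
  have Ea: "expectation (\<lambda>\<omega>. a (npt (?D z) \<omega>)) = void_prob R r" for z
  proof -
    have [measurable]: "npt (?D z) \<in> M \<rightarrow>\<^sub>M count_space UNIV" by (simp add: bounded_diff)
    show ?thesis unfolding a_def using r by (subst expectation_of_bool) (simp_all add: prob_npt_annulus)
  qed
  \<comment> \<open>As k >= 1, the events of k points and of no point exclude each other and the
    cross term vanishes.\<close>
  have bsq: "b n * b n = of_bool (n = k) / (?pk * ?pk) + of_bool (n = 0) / (?p0 * ?p0)" for n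
    using k by (auto simp: b_def)
  have Ebb: "expectation (\<lambda>\<omega>. b (npt (?Q z) \<omega>) * b (npt (?Q z) \<omega>)) = 1 / ?pk + 1 / ?p0" for z
    unfolding bsq using p ik by (simp add: Ek)
  have "expectation (\<lambda>\<omega>. \<Prod>z\<in>Z. probe R r k z \<omega>) =
    (\<Prod>z\<in>Z. expectation (\<lambda>\<omega>. a (npt (?D z) \<omega>)) * expectation (\<lambda>\<omega>. b (npt (?Q z) \<omega>)))"
    unfolding Y by (intro expectation_prod_local[where K=K] Z(1) disj ba bb) (auto simp: bounded_diff)
  also have "\<dots> = 0" using Z by (simp add: Eb card_gt_0_iff)
  finally show "expectation (\<lambda>\<omega>. \<Prod>z\<in>Z. probe R r k z \<omega>) = 0" .
  have "expectation (\<lambda>\<omega>. \<Prod>z\<in>{z}. a (npt (?D z) \<omega>) * (b (npt (?Q z) \<omega>) * b (npt (?Q z) \<omega>))) =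
    (\<Prod>z\<in>{z}. expectation (\<lambda>\<omega>. a (npt (?D z) \<omega>)) * expectation (\<lambda>\<omega>. b (npt (?Q z) \<omega>) * b (npt (?Q z) \<omega>)))"
    by (intro expectation_prod_local[where K=K and b="\<lambda>n. b n * b n"] ba bbb) (auto simp: bounded_diff)
  moreover have "probe R r k z \<omega> * probe R r k z \<omega> = a (npt (?D z) \<omega>) * (b (npt (?Q z) \<omega>) * b (npt (?Q z) \<omega>))" for \<omega>
    by (auto simp: Y a_def)
  ultimately show "expectation (\<lambda>\<omega>. probe R r k z \<omega> * probe R r k z \<omega>) =
      void_prob R r * (1 / ?pk + 1 / ?p0)"
    by (simp add: Ea Ebb)
qed

section \<open>The excursion volume as a random variable\<close>

lemma excursion_set_measurable:
  assumes [measurable]: "g \<in> borel_measurable borel"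
  shows "{p \<in> space (M \<Otimes>\<^sub>M lborel). snd p \<in> cball 0 s \<and> u \<le> shot_noise g (\<eta> (fst p)) (snd p)} \<in> sets (M \<Otimes>\<^sub>M lborel)"
    (is "?A \<in> _")
    and "\<omega> \<in> space M \<Longrightarrow> {x \<in> cball 0 s. u \<le> shot_noise g (\<eta> \<omega>) x} \<in> sets lborel"
    and "\<omega> \<in> space M \<Longrightarrow> Pair \<omega> -` {p \<in> space (M \<Otimes>\<^sub>M lborel). snd p \<in> cball 0 s \<and> u \<le> shot_noise g (\<eta> (fst p)) (snd p)} =
      {x \<in> cball 0 s. u \<le> shot_noise g (\<eta> \<omega>) x}"
proof -
  have [measurable]: "cball (0::'a) s \<in> sets borel" by simp
  have "(\<lambda>p. (snd p, fst p)) \<in> (M \<Otimes>\<^sub>M lborel) \<rightarrow>\<^sub>M (lborel \<Otimes>\<^sub>M M)" by measurable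
  from measurable_compose[OF this shot_noise_measurable[OF assms]]
  have [measurable]: "(\<lambda>p. shot_noise g (\<eta> (fst p)) (snd p)) \<in> borel_measurable (M \<Otimes>\<^sub>M lborel)" by simp
  show A: "?A \<in> sets (M \<Otimes>\<^sub>M lborel)" by measurable
  show P: "Pair \<omega> -` ?A = {x \<in> cball 0 s. u \<le> shot_noise g (\<eta> \<omega>) x}" if "\<omega> \<in> space M"
    using that by (auto simp: space_pair_measure)
  show "{x \<in> cball 0 s. u \<le> shot_noise g (\<eta> \<omega>) x} \<in> sets lborel" if "\<omega> \<in> space M"
    using sets_Pair1[OF A, of \<omega>] P[OF that] by simp
qed

lemma excursion_volume_measurable:
  assumes "g \<in> borel_measurable borel"
  shows "(\<lambda>\<omega>. excursion_volume g u (\<eta> \<omega>) s) \<in> borel_measurable M"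
proof -
  \<comment> \<open>The volume of a section of a jointly measurable set, which depends measurably on
    \<omega>.\<close>
  define E where "E \<omega> = enn2real (emeasure lborel (Pair \<omega> -`
     {p \<in> space (M \<Otimes>\<^sub>M lborel). snd p \<in> cball 0 s \<and> u \<le> shot_noise g (\<eta> (fst p)) (snd p)}))" for \<omega>
  have E: "E \<in> borel_measurable M"
    unfolding E_def using lborel.measurable_emeasure_Pair[OF excursion_set_measurable(1)[OF assms, of s u]] by measurable
  have "excursion_volume g u (\<eta> \<omega>) s = E \<omega>" if "\<omega> \<in> space M" for \<omega>
    unfolding excursion_set_measurable(3)[OF assms that] excursion_volume_def measure_def E_def ..
  then show ?thesis
    by (rule measurable_cong[THEN iffD2, OF _ E])
qed

lemma excursion_volume_le:
  assumes "g \<in> borel_measurable borel" "\<omega> \<in> space M"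
  shows "\<bar>excursion_volume g u (\<eta> \<omega>) s\<bar> \<le> measure lborel (cball (0::'a) s)"
  unfolding excursion_volume_def using excursion_set_measurable(2)[OF assms, of s u] emeasure_bounded_finite[of "cball (0::'a) s"]
  by (auto intro!: measure_mono_fmeasurable simp: fmeasurable_def)

text \<open>Fubini's theorem reduces the covariance to an integral of pointwise contributions. A
  gain of half the volume of the core minus a loss of at most a quarter of it leaves a
  quarter.\<close>

lemma expectation_excursion_probe_ge:
  fixes g \<beta> :: "'a \<Rightarrow> real"
  assumes g: "integrable lborel g" and r: "0 < r" "r \<le> R" and k: "k \<ge> 1"
    and z: "norm z \<le> s - r"
    and \<beta>: "integrable lborel \<beta>" "\<And>w. \<beta> w \<ge> 0" "(\<integral>w. \<beta> w \<partial>lborel) \<le> measure lborel (cball (0::'a) r) / 4"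
    and H: "\<And>x. \<exists>m. (\<forall>y\<in>cball z r. m \<le> g (x - y)) \<and>
      1 / 2 * indicator (cball z r) x - \<beta> (x - z) \<le>
      prob {\<omega>\<in>space M. u \<le> far_shot g R z x \<omega> + real k * m} - prob {\<omega>\<in>space M. u \<le> far_shot g R z x \<omega>}"
  shows "void_prob R r * (measure lborel (cball (0::'a) r) / 4)
    \<le> expectation (\<lambda>\<omega>. excursion_volume g u (\<eta> \<omega>) s * probe R r k z \<omega>)"
proof -
  let ?B = "cball (0::'a) s"
  have [measurable]: "g \<in> borel_measurable borel" using g by simp
  note [measurable] = shot_noise_measurable[of g]
  have [measurable]: "?B \<in> sets borel" "cball z r \<in> sets borel" by simp_all
  let ?f = "\<lambda>x \<omega>. of_bool (u \<le> shot_noise g (\<eta> \<omega>) x) * probe R r k z \<omega>"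
  let ?h = "\<lambda>x \<omega>. indicator ?B x * ?f x \<omega>"
  define K where "K = 1 / count_prob r k + 1 / count_prob r 0"
  have K: "\<bar>probe R r k z \<omega>\<bar> \<le> K" for \<omega> unfolding K_def by (rule abs_probe_le[OF r(1)])
  interpret P: pair_sigma_finite lborel M ..
  have meas: "(\<lambda>(x, \<omega>). ?h x \<omega>) \<in> borel_measurable (lborel \<Otimes>\<^sub>M M)"
    by (simp add: split_beta) measurable
  have fin: "emeasure lborel ?B < \<infinity>" using emeasure_bounded_finite[of ?B] by simp
  have int: "integrable (lborel \<Otimes>\<^sub>M M) (\<lambda>(x, \<omega>). ?h x \<omega>)"
  proof (rule Bochner_Integration.integrable_bound[OF _ meas])
    have "emeasure (lborel \<Otimes>\<^sub>M M) (?B \<times> space M) < \<infinity>"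
      using fin by (subst emeasure_pair_measure_Times) (auto simp: emeasure_space_1)
    then show "integrable (lborel \<Otimes>\<^sub>M M) (\<lambda>p. K * indicator (?B \<times> space M) p)"
      by (intro integrable_mult_right integrable_real_indicator) auto
    show "AE p in lborel \<Otimes>\<^sub>M M. norm ((\<lambda>(x, \<omega>). ?h x \<omega>) p) \<le> norm (K * indicator (?B \<times> space M) p)"
    proof (intro AE_I2)
      fix p :: "'a \<times> 'w" assume "p \<in> space (lborel \<Otimes>\<^sub>M M)"
      then have "snd p \<in> space M" by (auto simp: space_pair_measure)
      then show "norm ((\<lambda>(x, \<omega>). ?h x \<omega>) p) \<le> norm (K * indicator (?B \<times> space M) p)"
        using K[of "snd p"] by (cases p) (auto simp: indicator_def)
    qed
  qed
  have "excursion_volume g u (\<eta> \<omega>) s * probe R r k z \<omega> = (\<integral>x. ?h x \<omega> \<partial>lborel)" if "\<omega> \<in> space M" for \<omega>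
  proof -
    have "{x \<in> ?B. u \<le> shot_noise g (\<eta> \<omega>) x} \<in> sets lborel"
      by (rule excursion_set_measurable) (use that in auto)
    moreover have "(\<integral>x. ?h x \<omega> \<partial>lborel) = (\<integral>x. indicator {x \<in> ?B. u \<le> shot_noise g (\<eta> \<omega>) x} x * probe R r k z \<omega> \<partial>lborel)"
      by (intro Bochner_Integration.integral_cong refl) (auto simp: indicator_def)
    ultimately show ?thesis by (simp add: excursion_volume_def)
  qed
  then have "expectation (\<lambda>\<omega>. excursion_volume g u (\<eta> \<omega>) s * probe R r k z \<omega>) =
    (\<integral>\<omega>. (\<integral>x. ?h x \<omega> \<partial>lborel) \<partial>M)"
    by (intro Bochner_Integration.integral_cong refl) auto
  also have "\<dots> = (\<integral>x. (\<integral>\<omega>. ?h x \<omega> \<partial>M) \<partial>lborel)"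
    by (rule P.Fubini_integral[OF int])
  also have "\<dots> \<ge> (\<integral>x. void_prob R r * (1 / 2 * indicator (cball z r) x - \<beta> (x - z)) \<partial>lborel)"
  proof (rule integral_mono)
    show "integrable lborel (\<lambda>x. void_prob R r * (1 / 2 * indicator (cball z r) x - \<beta> (x - z)))"
      using emeasure_bounded_finite[of "cball z r"]
      by (intro integrable_mult_right Bochner_Integration.integrable_diff translate_lborel \<beta> integrable_real_indicator) auto
    show "integrable lborel (\<lambda>x. \<integral>\<omega>. ?h x \<omega> \<partial>M)"
      using P.integrable_fst[OF int] by simp
    show "void_prob R r * (1 / 2 * indicator (cball z r) x - \<beta> (x - z)) \<le> (\<integral>\<omega>. ?h x \<omega> \<partial>M)" for x
    proof (cases "x \<in> ?B")
      case True
      obtain m where m: "\<And>y. y \<in> cball z r \<Longrightarrow> m \<le> g (x - y)"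
        "1 / 2 * indicator (cball z r) x - \<beta> (x - z) \<le>
        prob {\<omega>\<in>space M. u \<le> far_shot g R z x \<omega> + real k * m} - prob {\<omega>\<in>space M. u \<le> far_shot g R z x \<omega>}"
        using H[of x] by blast
      have "void_prob R r * (1 / 2 * indicator (cball z r) x - \<beta> (x - z)) \<le> expectation (?f x)"
      proof (rule order_trans)
        show "void_prob R r * (1 / 2 * indicator (cball z r) x - \<beta> (x - z)) \<le> void_prob R r *
          (prob {\<omega>\<in>space M. u \<le> far_shot g R z x \<omega> + real k * m} - prob {\<omega>\<in>space M. u \<le> far_shot g R z x \<omega>})"
          by (intro mult_left_mono m less_imp_le[OF void_prob_pos])
        show "\<dots> \<le> expectation (?f x)"
          using expectation_exceeds_probe_ge[where u=u and z=z and x=x and m=m, OF g r k] m(1) r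
          by (simp add: prob_npt_annulus)
      qed
      then show ?thesis using True by simp
    next
      case False
      \<comment> \<open>The margin between \<open>z\<close> and the boundary of the window ensures
        that no gain is cut off; outside the window only the harmless term with \<beta> is
        left.\<close>
      have "x \<notin> cball z r"
      proof
        assume "x \<in> cball z r"
        then have "norm x \<le> s" using z norm_triangle_sub[of x z] by (simp add: dist_norm norm_minus_commute)
        then show False using False by simp
      qed
      then show ?thesis using False \<beta>(2)[of "x - z"] void_prob_pos[of R r] by (simp add: mult_nonneg_nonneg)
    qed
  qed
  also have "(\<integral>x. void_prob R r * (1 / 2 * indicator (cball z r) x - \<beta> (x - z)) \<partial>lborel) =
     void_prob R r * (1 / 2 * measure lborel (cball z r) - (\<integral>x. \<beta> x \<partial>lborel))"
    using emeasure_bounded_finite[of "cball z r"]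
    by (simp add: translate_lborel[OF \<beta>(1)])
  also have "\<dots> \<ge> void_prob R r * (measure lborel (cball (0::'a) r) / 4)"
    using \<beta>(3) r void_prob_pos[of R r] by (intro mult_left_mono) (auto simp: content_cball)
  finally show ?thesis .
qed

text \<open>The common frame of both parts of the theorem. In \<open>H\<close> the bound
  \<open>m\<close> may vary with z and x, whereas r, R, k and \<beta> are fixed and \<beta> enters
  through x - z only; so one covariance bound serves every grid point and every s.\<close>

lemma variance_excursion_volume_ge:
  fixes g \<beta> :: "'a \<Rightarrow> real"
  assumes g: "integrable lborel g" and r: "0 < r" "r \<le> 1 / 2" "r \<le> R" and k: "k \<ge> 1"
    and \<beta>: "integrable lborel \<beta>" "\<And>w. \<beta> w \<ge> 0" "(\<integral>w. \<beta> w \<partial>lborel) \<le> measure lborel (cball (0::'a) r) / 4"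
    and H: "\<And>z x. \<exists>m. (\<forall>y\<in>cball z r. m \<le> g (x - y)) \<and>
      1 / 2 * indicator (cball z r) x - \<beta> (x - z) \<le>
      prob {\<omega>\<in>space M. u \<le> far_shot g R z x \<omega> + real k * m} - prob {\<omega>\<in>space M. u \<le> far_shot g R z x \<omega>}"
  shows "\<exists>c>0. \<forall>s\<ge>1. c * s ^ DIM('a) \<le> variance (\<lambda>\<omega>. excursion_volume g u (\<eta> \<omega>) s)"
proof -
  obtain c where c: "c > 0" and grid: "\<And>s. s \<ge> 1 \<Longrightarrow> \<exists>Z::'a set. finite Z \<and> Z \<subseteq> cball 0 (s - r) \<and>
    (\<forall>z\<in>Z. \<forall>w\<in>Z. z \<noteq> w \<longrightarrow> 2 * R < dist z w) \<and> c * s ^ DIM('a) \<le> real (card Z)"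
    using ex_separated_grid[of R r, where 'a='a] r by auto
  define a where "a = void_prob R r * (measure lborel (cball (0::'a) r) / 4)"
  define v where "v = void_prob R r * (1 / count_prob r k + 1 / count_prob r 0)"
  have a: "a > 0" using r void_prob_pos[of R r] by (simp add: a_def content_cball)
  have v: "v > 0"
    using count_prob_pos[OF r(1), of k] count_prob_pos[OF r(1), of 0] void_prob_pos[of R r]
    by (simp add: v_def add_pos_pos)
  have [measurable]: "g \<in> borel_measurable borel" using g by simp
  show ?thesis
  proof (intro exI[of _ "c * a\<^sup>2 / v"] conjI allI impI)
    show "c * a\<^sup>2 / v > 0" using a v c by simp
    fix s :: real assume s: "s \<ge> 1"
    from grid[OF s] obtain Z :: "'a set" where Z: "finite Z" "Z \<subseteq> cball 0 (s - r)"
      "\<And>z w. z \<in> Z \<Longrightarrow> w \<in> Z \<Longrightarrow> z \<noteq> w \<Longrightarrow> 2 * R < dist z w" "c * s ^ DIM('a) \<le> real (card Z)"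
      by blast
    have "real (card Z) * a\<^sup>2 / v \<le> variance (\<lambda>\<omega>. excursion_volume g u (\<eta> \<omega>) s)"
    proof (rule variance_ge_sum_uncorrelated[where Y="probe R r k" and K="measure lborel (cball (0::'a) s)"
          and K'="1 / count_prob r k + 1 / count_prob r 0"])
      show "(\<lambda>\<omega>. excursion_volume g u (\<eta> \<omega>) s) \<in> borel_measurable M"
        by (rule excursion_volume_measurable) measurable
      show "\<bar>excursion_volume g u (\<eta> \<omega>) s\<bar> \<le> measure lborel (cball (0::'a) s)" if "\<omega> \<in> space M" for \<omega>
        by (rule excursion_volume_le) (use that in auto)
      show "\<bar>probe R r k z \<omega>\<bar> \<le> 1 / count_prob r k + 1 / count_prob r 0" for z \<omega>
        by (rule abs_probe_le[OF r(1)])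
      show "expectation (probe R r k z) = 0" if "z \<in> Z" for z
        using expectation_prod_probe(1)[OF r(1,3) k, of "{z}"] by simp
      show "expectation (\<lambda>\<omega>. probe R r k z \<omega> * probe R r k z \<omega>) = v" if "z \<in> Z" for z
        unfolding v_def using expectation_prod_probe(2)[OF r(1,3) k, of "{z}" z] by simp
      show "expectation (\<lambda>\<omega>. probe R r k z \<omega> * probe R r k w \<omega>) = 0" if "z \<in> Z" "w \<in> Z" "z \<noteq> w" for z w
        using expectation_prod_probe(1)[OF r(1,3) k, of "{z, w}"] that Z(3)
        by (auto simp: dist_commute)
      show "a \<le> expectation (\<lambda>\<omega>. excursion_volume g u (\<eta> \<omega>) s * probe R r k z \<omega>)" if "z \<in> Z" for z
        unfolding a_def
        by (rule expectation_excursion_probe_ge[OF g r(1,3) k _ \<beta> H]) (use that Z(2) in auto)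
    qed (use Z a v in auto)
    moreover have "c * a\<^sup>2 / v * s ^ DIM('a) \<le> real (card Z) * a\<^sup>2 / v"
      using mult_right_mono[OF Z(4), of "a\<^sup>2 / v"] v by (simp add: mult_ac)
    ultimately show "c * a\<^sup>2 / v * s ^ DIM('a) \<le> variance (\<lambda>\<omega>. excursion_volume g u (\<eta> \<omega>) s)" by simp
  qed
qed

end

section \<open>Compact support and power decay\<close>

text \<open>Cut the region into dyadic shells: shell j contributes at most its largest value (2^j
  t)^(-\<delta>) times the volume of a ball of radius 2^(j+1) t. The sum is geometric with ratio
  2^(d - \<delta>) < 1.\<close>

lemma power_tail_integral:
  fixes \<delta> :: real
  assumes \<delta>: "\<delta> > DIM('a::euclidean_space)"
  obtains C where "C > 0" and
    "\<And>t. t > 0 \<Longrightarrow> integrable lborel (\<lambda>y::'a. norm y powr - \<delta> * indicator {y. t \<le> norm y} y)"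
    "\<And>t. t > 0 \<Longrightarrow> (\<integral>y. norm y powr - \<delta> * indicator {y. t \<le> norm y} (y::'a) \<partial>lborel) \<le> C * t powr (DIM('a) - \<delta>)"
proof -
  let ?d = "real DIM('a)"
  define q where "q = (2::real) powr (?d - \<delta>)"
  have q: "0 < q" "q < 1"
    using \<delta> powr_less_mono[of "?d - \<delta>" 0 2] by (auto simp: q_def)
  define V where "V = measure lborel (cball (0::'a) 1)"
  have V: "V > 0" by (simp add: V_def content_cball)
  have Vc: "measure lborel (cball (0::'a) s) = V * s ^ DIM('a)" if "s \<ge> 0" for s
    using that by (simp add: V_def content_cball)
  define C where "C = V * 2 ^ DIM('a) / (1 - q)"
  have C: "C > 0" using V q by (simp add: C_def)
  have key: "(\<integral>\<^sup>+y. ennreal (norm y powr - \<delta> * indicator {y. t \<le> norm y} (y::'a)) \<partial>lborel) \<le> ennreal (C * t powr (?d - \<delta>))"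
    if t: "t > 0" for t
  proof -
    let ?a = "\<lambda>j::nat. (2 ^ j * t) powr - \<delta>"
    let ?B = "\<lambda>j::nat. cball (0::'a) (2 ^ Suc j * t)"
    have pt: "ennreal (norm y powr - \<delta> * indicator {y. t \<le> norm y} y) \<le> (\<Sum>j. ennreal (?a j) * indicator (?B j) y)" for y :: 'a
    proof (cases "t \<le> norm y")
      case True
      \<comment> \<open>The index of a shell with 2^j t <= |y| <= 2^(j+1) t.\<close>
      define j where "j = nat \<lfloor>log 2 (norm y / t)\<rfloor>"
      have y: "norm y > 0" using True t by linarith
      have l0: "log 2 (norm y / t) \<ge> 0" using True t y by (subst zero_le_log_cancel_iff) auto
      have j1: "real j \<le> log 2 (norm y / t)" using l0 by (simp add: j_def)
      have j2: "log 2 (norm y / t) \<le> real (Suc j)"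
        using l0 real_of_int_floor_add_one_ge[of "log 2 (norm y / t)"] by (simp add: j_def add.commute)
      have "2 ^ j \<le> norm y / t"
        using j1 t y by (simp add: le_log_iff powr_realpow)
      then have lo: "2 ^ j * t \<le> norm y" using t by (simp add: field_simps)
      have "norm y / t \<le> 2 ^ Suc j"
        using j2 t y log_le_iff[of 2 "norm y / t" "real (Suc j)"] powr_realpow[of 2 "Suc j"]
        by (simp del: of_nat_Suc power_Suc)
      then have hi: "norm y \<le> 2 ^ Suc j * t" using t by (simp add: field_simps)
      have "norm y powr - \<delta> \<le> ?a j"
        using lo t \<delta> by (intro powr_mono2') auto
      then have "ennreal (norm y powr - \<delta> * indicator {y. t \<le> norm y} y) \<le> ennreal (?a j) * indicator (?B j) y"
        using True hi by (simp add: ennreal_leI)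
      moreover have "F j \<le> (\<Sum>i. F i)" for F :: "nat \<Rightarrow> ennreal"
        using sum_le_suminf[of F "{j}"] by simp
      from this[of "\<lambda>j. ennreal (?a j) * indicator (?B j) y"]
      have "ennreal (?a j) * indicator (?B j) y \<le> (\<Sum>j. ennreal (?a j) * indicator (?B j) y)" .
      ultimately show ?thesis by (rule order_trans)
    qed simp
    have "(\<integral>\<^sup>+y. ennreal (norm y powr - \<delta> * indicator {y. t \<le> norm y} (y::'a)) \<partial>lborel) \<le>
      (\<integral>\<^sup>+y. (\<Sum>j. ennreal (?a j) * indicator (?B j) y) \<partial>lborel)"
      by (intro nn_integral_mono pt)
    also have "\<dots> = (\<Sum>j. \<integral>\<^sup>+y. ennreal (?a j) * indicator (?B j) y \<partial>lborel)"
    proof (rule nn_integral_suminf)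
      have [measurable]: "?B j \<in> sets borel" for j by simp
      show "(\<lambda>y. ennreal (?a j) * indicator (?B j) y) \<in> borel_measurable lborel" for j
        by measurable
    qed
    also have "\<dots> = (\<Sum>j. ennreal (V * 2 ^ DIM('a) * t powr (?d - \<delta>) * q ^ j))"
    proof (intro suminf_cong)
      fix j
      have "(\<integral>\<^sup>+y. ennreal (?a j) * indicator (?B j) y \<partial>lborel) = ennreal (?a j) * emeasure lborel (?B j)"
        by (rule nn_integral_cmult_indicator) simp
      also have "emeasure lborel (?B j) = ennreal (measure lborel (?B j))"
        using emeasure_bounded_finite[of "?B j"] by (intro emeasure_eq_ennreal_measure) auto
      also have "ennreal (?a j) * \<dots> = ennreal (?a j * (V * (2 ^ Suc j * t) ^ DIM('a)))"
        using t V by (subst Vc) (simp_all only: ennreal_mult'[OF powr_ge_zero], simp)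
      also have "?a j * (V * (2 ^ Suc j * t) ^ DIM('a)) = V * 2 ^ DIM('a) * t powr (?d - \<delta>) * q ^ j"
      proof -
        have 1: "(2 ^ Suc j * t) ^ DIM('a) = 2 ^ DIM('a) * (2 ^ j * t) powr ?d"
          using t by (simp add: powr_realpow power_mult_distrib)
        have "?a j * (2 ^ j * t) powr ?d = (2 ^ j * t) powr (?d - \<delta>)"
          by (simp add: powr_add[symmetric])
        also have "\<dots> = t powr (?d - \<delta>) * q ^ j"
          using t by (simp add: powr_mult q_def powr_realpow[symmetric] powr_powr mult.commute)
        finally have 2: "?a j * (2 ^ j * t) powr ?d = t powr (?d - \<delta>) * q ^ j" .
        have "?a j * (V * (2 ^ Suc j * t) ^ DIM('a)) = V * 2 ^ DIM('a) * (?a j * (2 ^ j * t) powr ?d)"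
          unfolding 1 by (simp only: mult_ac)
        then show ?thesis unfolding 2 by (simp only: mult_ac)
      qed
      finally show "(\<integral>\<^sup>+y. ennreal (?a j) * indicator (?B j) y \<partial>lborel) = ennreal (V * 2 ^ DIM('a) * t powr (?d - \<delta>) * q ^ j)" .
    qed
    also have "\<dots> = ennreal (C * t powr (?d - \<delta>))"
    proof (rule suminf_ennreal_eq)
      have "(\<lambda>j. V * 2 ^ DIM('a) * t powr (?d - \<delta>) * q ^ j) sums (V * 2 ^ DIM('a) * t powr (?d - \<delta>) * (1 / (1 - q)))"
        using q by (intro sums_mult geometric_sums) auto
      then show "(\<lambda>j. V * 2 ^ DIM('a) * t powr (?d - \<delta>) * q ^ j) sums (C * t powr (?d - \<delta>))"
        by (simp add: C_def mult_ac)
    qed (use V q in simp)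
    finally show ?thesis .
  qed
  show thesis
  proof (rule that[OF C])
    fix t :: real assume t: "t > 0"
    let ?f = "\<lambda>y::'a. norm y powr - \<delta> * indicator {y. t \<le> norm y} y"
    have [measurable]: "{y::'a. t \<le> norm y} \<in> sets borel" by measurable
    show i: "integrable lborel ?f"
    proof (rule integrableI_bounded)
      have "(\<integral>\<^sup>+y. ennreal (norm (?f y)) \<partial>lborel) = (\<integral>\<^sup>+y. ennreal (?f y) \<partial>lborel)"
        by (intro nn_integral_cong) (auto simp: indicator_def)
      also have "\<dots> < \<infinity>" using key[OF t] by (simp add: le_less_trans)
      finally show "(\<integral>\<^sup>+y. ennreal (norm (?f y)) \<partial>lborel) < \<infinity>" .
    qed measurable
    have "ennreal (\<integral>y. ?f y \<partial>lborel) \<le> ennreal (C * t powr (?d - \<delta>))"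
      using key[OF t] nn_integral_eq_integral[OF i] by simp
    then show "(\<integral>y. ?f y \<partial>lborel) \<le> C * t powr (?d - \<delta>)"
      using C by (subst (asm) ennreal_le_iff) auto
  qed
qed

text \<open>The second order Taylor polynomial has remainder at most |t|^3/6 <= t^2/6, and 1/2 - 1/6
  exceeds 1/4.\<close>

lemma one_minus_cos_ge:
  fixes t :: real
  assumes "\<bar>t\<bar> \<le> 1"
  shows "t\<^sup>2 / 4 \<le> 1 - cos t"
proof -
  have "\<bar>Re (iexp t - (\<Sum>k\<le>2. (\<i> * t) ^ k / fact k))\<bar> \<le> \<bar>t\<bar> ^ 3 / 6"
    using order_trans[OF abs_Re_le_cmod iexp_approx1[of t 2]] by (simp add: eval_nat_numeral)
  moreover have "Re (iexp t - (\<Sum>k\<le>2. (\<i> * t) ^ k / fact k)) = cos t - (1 - t\<^sup>2 / 2)"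
    by (simp add: eval_nat_numeral cis_conv_exp[symmetric])
  moreover have "\<bar>t\<bar> ^ 3 \<le> t\<^sup>2"
    using assms mult_left_le[of "\<bar>t\<bar>" "t\<^sup>2"] by (simp add: eval_nat_numeral mult_ac)
  ultimately show ?thesis using zero_le_power2[of t] by linarith
qed

text \<open>Replaces the stretched exponential by a majorant whose integrability over the whole line
  is standard.\<close>

lemma ex_decay_bound:
  fixes c \<kappa> :: real
  assumes "c > 0" "\<kappa> > 0"
  obtains A where "A > 0" "\<And>t. t \<ge> 0 \<Longrightarrow> exp (- c * t powr \<kappa>) \<le> A / (1 + t\<^sup>2)"
proof -
  have "((\<lambda>t::real. (1 + t\<^sup>2) * exp (- c * t powr \<kappa>)) \<longlongrightarrow> 0) at_top"
    using assms by real_asymp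
  then have "eventually (\<lambda>t. (1 + t\<^sup>2) * exp (- c * t powr \<kappa>) < 1) at_top"
    by (rule order_tendstoD) simp
  then obtain t0 where t0: "\<And>t. t \<ge> t0 \<Longrightarrow> (1 + t\<^sup>2) * exp (- c * t powr \<kappa>) < 1"
    by (auto simp: eventually_at_top_linorder)
  show thesis
  proof (rule that[of "2 + t0\<^sup>2"])
    show "2 + t0\<^sup>2 > 0" by (simp add: add_pos_nonneg)
    fix t :: real assume t: "t \<ge> 0"
    have "(1 + t\<^sup>2) * exp (- c * t powr \<kappa>) \<le> 2 + t0\<^sup>2"
    proof (cases "t \<ge> t0")
      case True
      then show ?thesis using t0[of t] zero_le_power2[of t0] by linarith
    next
      case False
      then have "t\<^sup>2 \<le> t0\<^sup>2" using t by (intro power_mono) auto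
      moreover have "(1 + t\<^sup>2) * exp (- c * t powr \<kappa>) \<le> (1 + t\<^sup>2) * 1"
        using assms by (intro mult_left_mono) auto
      ultimately show ?thesis by simp
    qed
    moreover have "1 + t\<^sup>2 > 0" by (simp add: add_pos_nonneg)
    ultimately show "exp (- c * t powr \<kappa>) \<le> (2 + t0\<^sup>2) / (1 + t\<^sup>2)"
      by (simp add: field_simps)
  qed
qed

text \<open>The first summand is the Markov part with exponent (3 d - \<delta>)/2, which is where
  \<delta> > 3 d is decisive. The second one is the density part with exponents d - \<delta>/2 and d
  - \<delta>, negative all the more.\<close>

lemma ex_radius:
  fixes d \<delta> :: real and b1 b2 b3 b4 r0 \<epsilon> :: real
  assumes d: "d > 0" "\<delta> > 3 * d" and \<epsilon>: "\<epsilon> > 0"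
  obtains R where "R \<ge> r0" "b1 * R powr d * sqrt R powr (d - \<delta>) + b2 * (b3 * sqrt R powr \<delta> + b4) * (R / 2) powr (d - \<delta>) \<le> \<epsilon>"
proof -
  let ?f = "\<lambda>R::real. b1 * R powr ((3 * d - \<delta>) / 2) + b2 * 2 powr (\<delta> - d) * (b3 * R powr (d - \<delta> / 2) + b4 * R powr (d - \<delta>))"
  have neg: "((\<lambda>R::real. R powr a) \<longlongrightarrow> 0) at_top" if "a < 0" for a
    using that by (rule tendsto_neg_powr) (rule filterlim_ident)
  have "(?f \<longlongrightarrow> b1 * 0 + b2 * 2 powr (\<delta> - d) * (b3 * 0 + b4 * 0)) at_top"
    using d by (intro tendsto_intros neg) auto
  then have "eventually (\<lambda>R. ?f R < \<epsilon>) at_top"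
    using \<epsilon> by (intro order_tendstoD(2)[where y=0 and a=\<epsilon>]) auto
  then have "eventually (\<lambda>R. ?f R < \<epsilon> \<and> R \<ge> max r0 1) at_top"
    using eventually_ge_at_top by (rule eventually_conj)
  then obtain R where R: "?f R < \<epsilon>" "R \<ge> r0" "R \<ge> 1"
    by (auto simp: eventually_at_top_linorder)
  have s: "sqrt R powr a = R powr (a / 2)" for a
    using R by (simp add: powr_half_sqrt[symmetric] powr_powr)
  have 1: "R powr d * sqrt R powr (d - \<delta>) = R powr ((3 * d - \<delta>) / 2)"
    unfolding s by (simp add: powr_add[symmetric] field_simps)
  have 2: "(R / 2) powr (d - \<delta>) = 2 powr (\<delta> - d) * R powr (d - \<delta>)"
    using R by (simp add: powr_divide powr_diff divide_simps)
  have 3: "sqrt R powr \<delta> * R powr (d - \<delta>) = R powr (d - \<delta> / 2)"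
    unfolding s by (simp add: powr_add[symmetric] field_simps)
  have "b2 * (b3 * sqrt R powr \<delta> + b4) * (R / 2) powr (d - \<delta>) =
    b2 * 2 powr (\<delta> - d) * (b3 * (sqrt R powr \<delta> * R powr (d - \<delta>)) + b4 * R powr (d - \<delta>))"
    unfolding 2 by (simp add: algebra_simps)
  then have "b1 * R powr d * sqrt R powr (d - \<delta>) + b2 * (b3 * sqrt R powr \<delta> + b4) * (R / 2) powr (d - \<delta>) = ?f R"
    unfolding 3 using 1 by (simp add: mult.assoc)
  then show thesis using that[of R] R by simp
qed

text \<open>The pointwise inequality asks for some \<open>m\<close> even at locations where its
  value does not matter; compactness supplies one.\<close>

lemma ex_lower_bound_cball:
  fixes g :: "'a::euclidean_space \<Rightarrow> real"
  assumes "continuous_on UNIV g"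
  obtains m where "\<And>y. y \<in> cball z r \<Longrightarrow> m \<le> g (x - y)"
proof -
  have "continuous_on (cball z r) (\<lambda>y. g (x - y))"
    by (rule continuous_on_compose2[OF assms]) (auto intro!: continuous_intros)
  then have "compact ((\<lambda>y. g (x - y)) ` cball z r)"
    by (rule compact_continuous_image) simp
  then have "bounded ((\<lambda>y. g (x - y)) ` cball z r)" by (rule compact_imp_bounded)
  then obtain K where "\<forall>v\<in>(\<lambda>y. g (x - y)) ` cball z r. norm v \<le> K"
    unfolding bounded_iff by blast
  then have K: "\<bar>g (x - y)\<bar> \<le> K" if "y \<in> cball z r" for y
    using that by simp
  have "- K \<le> g (x - y)" if "y \<in> cball z r" for y using K[OF that] by linarith
  then show thesis by (rule that)
qed

text \<open>Two points of a ball of radius r are at most 2 r apart, hence the radius 2 r; r <= 1/2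
  is the margin allowed by the grid.\<close>

lemma ex_positive_near_zero:
  fixes g :: "'a::euclidean_space \<Rightarrow> real"
  assumes cont: "continuous_on UNIV g" and g0: "g 0 > 0"
  obtains r where "0 < r" "r \<le> 1 / 2" "\<And>v. norm v \<le> 2 * r \<Longrightarrow> g 0 / 2 \<le> g v"
proof -
  have "isCont g 0" using cont by (simp add: continuous_on_eq_continuous_at)
  then obtain e where e: "e > 0" "\<And>v. norm v < e \<Longrightarrow> \<bar>g v - g 0\<bar> < g 0 / 2"
    using g0 by (auto simp: continuous_at_eps_delta dist_norm dest!: spec[of _ "g 0 / 2"])
  show thesis
  proof (rule that[of "min (1 / 2) (e / 3)"])
    fix v :: 'a assume v: "norm v \<le> 2 * min (1 / 2) (e / 3)"
    also have "\<dots> < e" using e(1) by (simp add: min_def)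
    finally show "g 0 / 2 \<le> g v" using e(2)[of v] by linarith
  qed (use e in auto)
qed

section \<open>The case of compact support\<close>

context poisson_lborel
begin

lemma variance_ge_compact_support:
  fixes g :: "'a \<Rightarrow> real"
  assumes u: "u > 0" and cont: "continuous_on UNIV g" and g: "integrable lborel g" and g0: "g 0 > 0"
    and supp: "compact (closure {x. g x \<noteq> 0})"
  shows "\<exists>c>0. \<forall>s\<ge>1. c * s ^ DIM('a) \<le> variance (\<lambda>\<omega>. excursion_volume g u (\<eta> \<omega>) s)"
proof -
  obtain r where r: "0 < r" "r \<le> 1 / 2" "\<And>v. norm v \<le> 2 * r \<Longrightarrow> g 0 / 2 \<le> g v"
    using ex_positive_near_zero[OF cont g0] by blast
  have "bounded {x. g x \<noteq> 0}"
    using supp by (meson bounded_subset closure_subset compact_imp_bounded)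
  then obtain K where K: "K > 0" "\<And>x. norm x > K \<Longrightarrow> g x = 0"
    unfolding bounded_pos by (metis (mono_tags, lifting) linorder_not_le mem_Collect_eq)
  \<comment> \<open>A location within K + r of z is then more than K away from every point outside
    the large ball, so the far field vanishes there.\<close>
  define R where "R = 2 * K + r"
  \<comment> \<open>Enough points to reach the level from X = 0 if each contributes at least
    g(0)/2.\<close>
  define k where "k = nat \<lceil>2 * u / g 0\<rceil> + 1"
  have ku: "u \<le> real k * (g 0 / 2)"
  proof -
    have "2 * u / g 0 \<le> real k" unfolding k_def by linarith
    then show ?thesis using g0 by (simp add: field_simps)
  qed
  have far: "far_shot g R z x \<omega> = 0" if "norm (x - z) \<le> K + r" for z x \<omega>
  proof -
    have "g (x - y) * indicator (- cball z R) y = 0" for y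
    proof (cases "y \<in> cball z R")
      case False
      then have "norm (x - y) > K"
        using that norm_triangle_ineq4[of "x - z" "x - y"] by (simp add: R_def dist_norm norm_minus_commute)
      then show ?thesis using K by simp
    qed simp
    then show ?thesis by (simp only: far_shot_def integral_zero)
  qed
  show ?thesis
  proof (rule variance_excursion_volume_ge[OF g r(1,2), where R=R and k=k and \<beta>="\<lambda>_. 0"])
    show "r \<le> R" "k \<ge> 1" using K by (simp_all add: R_def k_def)
    fix z x :: 'a
    show "\<exists>m. (\<forall>y\<in>cball z r. m \<le> g (x - y)) \<and>
      1 / 2 * indicator (cball z r) x - 0 \<le>
      prob {\<omega>\<in>space M. u \<le> far_shot g R z x \<omega> + real k * m} - prob {\<omega>\<in>space M. u \<le> far_shot g R z x \<omega>}"
    proof (cases "norm (x - z) \<le> K + r")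
      case near: True
      show ?thesis
      proof (cases "x \<in> cball z r")
        case True
        have "g 0 / 2 \<le> g (x - y)" if "y \<in> cball z r" for y
          using True that norm_triangle_ineq4[of "x - z" "y - z"]
          by (intro r(3)) (simp add: dist_norm norm_minus_commute)
        then show ?thesis
          using far[OF near] ku u by (intro exI[of _ "g 0 / 2"]) (simp add: prob_space indicator_def)
      next
        case False
        obtain m where "\<And>y. y \<in> cball z r \<Longrightarrow> m \<le> g (x - y)"
          using ex_lower_bound_cball[OF cont, where z=z and r=r and x=x] by blast
        then show ?thesis
          using far[OF near] u False by (intro exI[of _ m]) simp
      qed
    next
      case False
      \<comment> \<open>Beyond distance K + r no point of the core reaches x. With m = 0 the two
        probabilities coincide, whatever the far field is.\<close>
      have "g (x - y) = 0" if "y \<in> cball z r" for y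
        using that False norm_triangle_ineq4[of "x - y" "z - y"]
        by (intro K(2)) (simp add: dist_norm norm_minus_commute)
      then show ?thesis
        using False K(1) by (intro exI[of _ 0]) (simp add: dist_norm norm_minus_commute)
    qed
  qed (use r in \<open>auto simp: content_cball\<close>)
qed

section \<open>The case of power decay\<close>

lemma norm_char_far_shot_le:
  fixes g :: "'a \<Rightarrow> real" and cl cu \<delta> \<gamma> cg :: real
  assumes g: "integrable lborel g"
    and c: "cl > 0" "cu > 0" "cg \<ge> 1" and \<delta>: "\<delta> > 0" "\<delta> \<le> \<gamma>" "\<gamma> < \<delta> + DIM('a) / 2"
    and bd: "\<And>x. norm x \<ge> cg \<Longrightarrow> cl * norm x powr (- \<gamma>) \<le> \<bar>g x\<bar> \<and> \<bar>g x\<bar> \<le> cu * norm x powr (- \<delta>)"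
  obtains c \<kappa> where "c > 0" "\<kappa> > 0"
    "\<And>z x R b t. cg \<le> b \<Longrightarrow> R - b \<le> norm (x - z) \<Longrightarrow> b powr \<delta> / cu \<le> \<bar>t\<bar> \<Longrightarrow>
      norm (\<integral>\<omega>. iexp (t * far_shot g R z x \<omega>) \<partial>M) \<le> exp (- c * \<bar>t\<bar> powr \<kappa>)"
proof -
  let ?d = "real DIM('a)"
  have [measurable]: "g \<in> borel_measurable borel" using g by simp
  define V where "V = measure lborel (ball (0::'a) 1)"
  have V: "V > 0" by (simp add: V_def)
  define \<kappa> where "\<kappa> = 2 + (?d - 2 * \<gamma>) / \<delta>"
  have \<kappa>: "\<kappa> > 0"
  proof -
    have "\<kappa> = (2 * \<delta> + ?d - 2 * \<gamma>) / \<delta>" using \<delta>(1) by (simp add: \<kappa>_def field_simps)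
    then show ?thesis using \<delta> by simp
  qed
  \<comment> \<open>Collects the volume of a ball of radius \<rho>/2, the lower bound of g squared
    at distance 2 \<rho>, the factor 1/4 of the cosine estimate, and the factor left when \<rho> is
    expressed through |t|.\<close>
  define C where "C = V * (1 / 2) ^ DIM('a) * (cl\<^sup>2 * 2 powr (- 2 * \<gamma>) / 4) * cu powr ((?d - 2 * \<gamma>) / \<delta>)"
  have C: "C > 0" using V c by (simp add: C_def)
  show thesis
  proof (rule that[OF C \<kappa>])
    fix z x :: 'a and R b t :: real
    assume b: "cg \<le> b" and xz: "R - b \<le> norm (x - z)" and t: "b powr \<delta> / cu \<le> \<bar>t\<bar>"
    have b0: "b > 0" using b c by simp
    have t0: "\<bar>t\<bar> > 0" using t b0 c by (smt (verit) divide_pos_pos powr_gt_zero)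
    define \<rho> where "\<rho> = (cu * \<bar>t\<bar>) powr (1 / \<delta>)"
    have \<rho>0: "\<rho> > 0" using c t0 by (simp add: \<rho>_def)
    have \<rho>\<delta>: "\<rho> powr \<delta> = cu * \<bar>t\<bar>" using \<delta>(1) c t0 by (simp add: \<rho>_def powr_powr)
    \<comment> \<open>The purpose of the threshold on |t|: \<rho> >= b >= cg makes the decay bounds
      applicable at distance \<rho>, and the depth b of x is outweighed by \<rho>, so
      \<open>D\<close> avoids the large ball.\<close>
    have b\<rho>: "b \<le> \<rho>"
    proof -
      have "b powr \<delta> \<le> cu * \<bar>t\<bar>" using t c by (simp add: field_simps)
      then have "(b powr \<delta>) powr (1 / \<delta>) \<le> \<rho>"
        unfolding \<rho>_def using \<delta>(1) by (intro powr_mono2) auto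
      then show ?thesis using b0 \<delta>(1) by (simp add: powr_powr)
    qed
    \<comment> \<open>The direction from z to x, arbitrary if they coincide.\<close>
    obtain e :: 'a where e: "norm e = 1" "x - z = norm (x - z) *\<^sub>R e"
    proof (cases "x = z")
      case True
      then show ?thesis using that[of "SOME i. i \<in> Basis"] by (simp add: SOME_Basis)
    next
      case False
      then show ?thesis using that[of "(x - z) /\<^sub>R norm (x - z)"] by simp
    qed
    \<comment> \<open>All its points are at distance between \<rho> and 2 \<rho> from x. Going away
      from z, they are farther than |x - z| + \<rho> >= R - b + \<rho> >= R from z.\<close>
    define D where "D = ball (x + (3 / 2 * \<rho>) *\<^sub>R e) (\<rho> / 2)"
    have D: "\<rho> \<le> norm (x - y)" "norm (x - y) \<le> 2 * \<rho>" "y \<notin> cball z R" if "y \<in> D" for y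
    proof -
      define v where "v = y - (x + (3 / 2 * \<rho>) *\<^sub>R e)"
      have v: "norm v < \<rho> / 2" using that by (simp add: D_def v_def dist_norm norm_minus_commute)
      have y: "y - x = (3 / 2 * \<rho>) *\<^sub>R e + v" by (simp add: v_def)
      have n: "norm ((3 / 2 * \<rho>) *\<^sub>R e) = 3 / 2 * \<rho>" using e \<rho>0 by simp
      show "\<rho> \<le> norm (x - y)"
        using norm_diff_ineq[of "(3 / 2 * \<rho>) *\<^sub>R e" v] v n unfolding y[symmetric] by (simp add: norm_minus_commute)
      show "norm (x - y) \<le> 2 * \<rho>"
        using norm_triangle_ineq[of "(3 / 2 * \<rho>) *\<^sub>R e" v] v n unfolding y[symmetric] by (simp add: norm_minus_commute)
      have "y - z = (norm (x - z) + 3 / 2 * \<rho>) *\<^sub>R e + v"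
      proof -
        have "y - z = (x - z) + (y - x)" by simp
        also have "\<dots> = norm (x - z) *\<^sub>R e + ((3 / 2 * \<rho>) *\<^sub>R e + v)" using e(2) y by simp
        finally show ?thesis by (simp add: scaleR_add_left)
      qed
      moreover have "norm ((norm (x - z) + 3 / 2 * \<rho>) *\<^sub>R e) = norm (x - z) + 3 / 2 * \<rho>"
        using e(1) \<rho>0 by simp
      ultimately have "norm (x - z) + 3 / 2 * \<rho> - norm v \<le> norm (y - z)"
        using norm_diff_ineq[of "(norm (x - z) + 3 / 2 * \<rho>) *\<^sub>R e" v] by simp
      then show "y \<notin> cball z R"
        using v xz b\<rho> by (simp add: dist_norm norm_minus_commute)
    qed
    define h where "h y = g (x - y) * indicator (- cball z R) y" for y
    have [measurable]: "cball z R \<in> sets borel" "D \<in> sets borel" by (simp_all add: D_def)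
    have h: "integrable lborel h"
      unfolding h_def by (intro integrable_real_mult_indicator integrable_reflect_translate g) measurable
    define a where "a = t\<^sup>2 * (cl\<^sup>2 * (2 * \<rho>) powr (- 2 * \<gamma>)) / 4"
    have pt: "a * indicator D y \<le> 1 - cos (t * h y)" for y
    proof (cases "y \<in> D")
      case True
      note Dy = D[OF True]
      have hy: "h y = g (x - y)" using Dy(3) by (simp add: h_def)
      have n: "norm (x - y) \<ge> cg" using Dy(1) b\<rho> b by simp
      \<comment> \<open>The upper decay bound and the choice of \<rho> keep |t h| <= 1 on
        \<open>D\<close>, the range in which 1 - cos is bounded below quadratically.\<close>
      have "\<bar>h y\<bar> \<le> cu * norm (x - y) powr (- \<delta>)" using bd[OF n] hy by simp
      also have "\<dots> \<le> cu * \<rho> powr (- \<delta>)"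
        using c Dy(1) \<rho>0 \<delta>(1) by (intro mult_left_mono powr_mono2') auto
      also have "\<dots> = 1 / \<bar>t\<bar>" using c t0 by (simp add: powr_minus \<rho>\<delta> field_simps)
      finally have "\<bar>t * h y\<bar> \<le> 1" using t0 by (simp add: abs_mult field_simps)
      then have 1: "(t * h y)\<^sup>2 / 4 \<le> 1 - cos (t * h y)" by (rule one_minus_cos_ge)
      have "cl * (2 * \<rho>) powr (- \<gamma>) \<le> cl * norm (x - y) powr (- \<gamma>)"
        using c Dy \<rho>0 \<delta> by (intro mult_left_mono powr_mono2') auto
      also have "\<dots> \<le> \<bar>h y\<bar>" using bd[OF n] hy by simp
      finally have "(cl * (2 * \<rho>) powr (- \<gamma>))\<^sup>2 \<le> \<bar>h y\<bar>\<^sup>2"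
        using c by (intro power_mono) auto
      then have "cl\<^sup>2 * (2 * \<rho>) powr (- 2 * \<gamma>) \<le> (h y)\<^sup>2"
        by (simp add: power_mult_distrib power2_eq_square[of "_ powr _"] powr_add[symmetric])
      then have "a \<le> (t * h y)\<^sup>2 / 4"
        unfolding a_def power_mult_distrib by (intro divide_right_mono mult_left_mono) auto
      then show ?thesis using 1 True by simp
    qed simp
    have "measure lborel D * a = (\<integral>y. a * indicator D y \<partial>lborel)"
      using emeasure_bounded_finite[of D] by (simp add: D_def)
    also have "\<dots> \<le> (\<integral>y. 1 - cos (t * h y) \<partial>lborel)"
      using emeasure_bounded_finite[of D] norm_shot_char(2)[OF h, of t]
      by (intro integral_mono pt integrable_mult_right integrable_real_indicator) (auto simp: D_def)
    finally have le: "measure lborel D * a \<le> (\<integral>y. 1 - cos (t * h y) \<partial>lborel)" .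
    have "measure lborel D * a = C * \<bar>t\<bar> powr \<kappa>"
    proof -
      have 1: "measure lborel D = V * (1 / 2) ^ DIM('a) * \<rho> powr ?d"
        using \<rho>0 by (simp add: D_def V_def content_ball powr_realpow power_divide)
      have 2: "a = t\<^sup>2 * (cl\<^sup>2 * 2 powr (- 2 * \<gamma>) / 4) * \<rho> powr (- 2 * \<gamma>)"
        using \<rho>0 by (simp add: a_def powr_mult)
      have 3: "\<rho> powr ?d * \<rho> powr (- 2 * \<gamma>) = cu powr ((?d - 2 * \<gamma>) / \<delta>) * \<bar>t\<bar> powr ((?d - 2 * \<gamma>) / \<delta>)"
      proof -
        have "\<rho> powr ?d * \<rho> powr (- 2 * \<gamma>) = \<rho> powr (?d - 2 * \<gamma>)" by (simp add: powr_add[symmetric])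
        also have "\<dots> = (cu * \<bar>t\<bar>) powr ((?d - 2 * \<gamma>) / \<delta>)" by (simp add: \<rho>_def powr_powr)
        finally show ?thesis using c by (simp add: powr_mult)
      qed
      have 4: "\<bar>t\<bar> powr \<kappa> = \<bar>t\<bar> powr ((?d - 2 * \<gamma>) / \<delta>) * t\<^sup>2"
        using t0 by (simp add: \<kappa>_def powr_add mult.commute)
      have "measure lborel D * a =
        V * (1 / 2) ^ DIM('a) * (cl\<^sup>2 * 2 powr (- 2 * \<gamma>) / 4) * t\<^sup>2 * (\<rho> powr ?d * \<rho> powr (- 2 * \<gamma>))"
        unfolding 1 2 by (simp only: mult_ac)
      then show ?thesis unfolding 3 4 C_def by (simp only: mult_ac)
    qed
    moreover have "norm (\<integral>\<omega>. iexp (t * far_shot g R z x \<omega>) \<partial>M) = exp (- (\<integral>y. 1 - cos (t * h y) \<partial>lborel))"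
      using norm_shot_char(1)[OF h, of t] by (simp add: h_def far_shot_def)
    ultimately show "norm (\<integral>\<omega>. iexp (t * far_shot g R z x \<omega>) \<partial>M) \<le> exp (- C * \<bar>t\<bar> powr \<kappa>)"
      using le by simp
  qed
qed

text \<open>The point is uniformity: \<open>B\<close> depends neither on z, x, v nor on R, so R can
  be chosen after it. Frequencies up to \<open>b powr \<delta> / cu\<close> are bounded trivially by
  1 and account for the other term, the only one that grows with the depth b.\<close>

lemma prob_far_shot_near_le:
  fixes g :: "'a \<Rightarrow> real" and cl cu \<delta> \<gamma> cg :: real
  assumes g: "integrable lborel g"
    and c: "cl > 0" "cu > 0" "cg \<ge> 1" and \<delta>: "\<delta> > 0" "\<delta> \<le> \<gamma>" "\<gamma> < \<delta> + DIM('a) / 2"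
    and bd: "\<And>x. norm x \<ge> cg \<Longrightarrow> cl * norm x powr (- \<gamma>) \<le> \<bar>g x\<bar> \<and> \<bar>g x\<bar> \<le> cu * norm x powr (- \<delta>)"
  obtains B where "B \<ge> 0"
    "\<And>z x R b v e. cg \<le> b \<Longrightarrow> R - b \<le> norm (x - z) \<Longrightarrow> e > 0 \<Longrightarrow>
      prob {\<omega>\<in>space M. \<bar>far_shot g R z x \<omega> - v\<bar> \<le> e} \<le> e * (2 * (b powr \<delta> / cu) + B)"
proof -
  have [measurable]: "g \<in> borel_measurable borel" using g by simp
  obtain c0 \<kappa> where c0: "c0 > 0" "\<kappa> > 0"
    "\<And>z x R b t. cg \<le> b \<Longrightarrow> R - b \<le> norm (x - z) \<Longrightarrow> b powr \<delta> / cu \<le> \<bar>t\<bar> \<Longrightarrow>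
      norm (\<integral>\<omega>. iexp (t * far_shot g R z x \<omega>) \<partial>M) \<le> exp (- c0 * \<bar>t\<bar> powr \<kappa>)"
    using norm_char_far_shot_le[OF g c \<delta> bd] by blast
  obtain A where A: "A > 0" "\<And>t. t \<ge> 0 \<Longrightarrow> exp (- c0 * t powr \<kappa>) \<le> A / (1 + t\<^sup>2)"
    using ex_decay_bound[OF c0(1,2)] by blast
  have iA: "integrable lborel (\<lambda>t::real. A / (1 + t\<^sup>2))"
    using integrable_inverse_1_plus_square
    by (simp add: set_integrable_def einterval_def divide_inverse)
  show thesis
  proof (rule that[of "\<integral>t. A / (1 + t\<^sup>2) \<partial>lborel"])
    show "(\<integral>t. A / (1 + t\<^sup>2) \<partial>lborel) \<ge> 0" using A(1) by (intro Bochner_Integration.integral_nonneg) simp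
    fix z x :: 'a and R b v e :: real
    assume b: "cg \<le> b" and xz: "R - b \<le> norm (x - z)" and e: "e > 0"
    define T where "T = b powr \<delta> / cu"
    have T: "T \<ge> 0" using c by (simp add: T_def)
    let ?\<phi> = "\<lambda>t. indicator {-T..T} t + A / (1 + t\<^sup>2)"
    have "prob {\<omega>\<in>space M. \<bar>far_shot g R z x \<omega> - v\<bar> \<le> e} \<le> e * (\<integral>t. ?\<phi> t \<partial>lborel)"
    proof (rule prob_near_le_integral_char[OF _ _ _ e])
      show "integrable lborel ?\<phi>" using iA T by (intro Bochner_Integration.integrable_add) auto
      show "norm (\<integral>\<omega>. iexp (t * far_shot g R z x \<omega>) \<partial>M) \<le> ?\<phi> t" for t
      proof (cases "\<bar>t\<bar> \<le> T")
        case True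
        have "norm (\<integral>\<omega>. iexp (t * far_shot g R z x \<omega>) \<partial>M) \<le> (\<integral>\<omega>. norm (iexp (t * far_shot g R z x \<omega>)) \<partial>M)"
          by (rule integral_norm_bound)
        also have "\<dots> = 1" by (simp add: prob_space)
        also have "\<dots> \<le> ?\<phi> t" using True A(1) by (simp add: abs_le_iff add_nonneg_nonneg)
        finally show ?thesis .
      next
        case False
        then have "norm (\<integral>\<omega>. iexp (t * far_shot g R z x \<omega>) \<partial>M) \<le> exp (- c0 * \<bar>t\<bar> powr \<kappa>)"
          using b xz by (intro c0(3)) (auto simp: T_def)
        also have "\<dots> \<le> A / (1 + t\<^sup>2)" using A(2)[of "\<bar>t\<bar>"] by simp
        finally show ?thesis by (simp add: indicator_def)
      qed
    qed measurable
    also have "(\<integral>t. ?\<phi> t \<partial>lborel) = 2 * T + (\<integral>t. A / (1 + t\<^sup>2) \<partial>lborel)"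
      using T iA by (subst Bochner_Integration.integral_add) auto
    finally show "prob {\<omega>\<in>space M. \<bar>far_shot g R z x \<omega> - v\<bar> \<le> e} \<le>
      e * (2 * (b powr \<delta> / cu) + (\<integral>t. A / (1 + t\<^sup>2) \<partial>lborel))" by (simp add: T_def)
  qed
qed

text \<open>At depth t inside the large ball every far point is at distance at least t from x, so
  the mean of the absolute shot noise is controlled by a tail integral of the power; Markov's
  inequality does the rest.\<close>

lemma prob_far_shot_ge:
  fixes g :: "'a \<Rightarrow> real"
  assumes g: "integrable lborel g" and u: "u > 0" and cu: "cu > 0" and t: "t > 0"
    and xz: "norm (x - z) \<le> R - t"
    and bd: "\<And>v. norm v \<ge> t \<Longrightarrow> \<bar>g v\<bar> \<le> cu * norm v powr (- \<delta>)"
    and tail: "integrable lborel (\<lambda>y::'a. norm y powr - \<delta> * indicator {y. t \<le> norm y} y)"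
      "(\<integral>y. norm y powr - \<delta> * indicator {y. t \<le> norm y} (y::'a) \<partial>lborel) \<le> T"
  shows "prob {\<omega>\<in>space M. u \<le> \<bar>far_shot g R z x \<omega>\<bar>} \<le> cu * T / u"
proof -
  have [measurable]: "g \<in> borel_measurable borel" using g by simp
  have [measurable]: "cball z R \<in> sets borel" by simp
  define h where "h y = g (x - y) * indicator (- cball z R) y" for y
  have h: "integrable lborel h"
    unfolding h_def by (intro integrable_real_mult_indicator integrable_reflect_translate g) measurable
  let ?p = "\<lambda>y::'a. norm y powr - \<delta> * indicator {y. t \<le> norm y} y"
  have "(\<integral>y. \<bar>h y\<bar> \<partial>lborel) \<le> (\<integral>y. cu * ?p (x - y) \<partial>lborel)"
  proof (rule integral_mono)
    show "integrable lborel (\<lambda>y. \<bar>h y\<bar>)" using h by simp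
    show "integrable lborel (\<lambda>y. cu * ?p (x - y))"
      by (intro integrable_mult_right integrable_reflect_translate[of ?p] tail)
    show "\<bar>h y\<bar> \<le> cu * ?p (x - y)" for y
    proof (cases "y \<in> cball z R")
      case True
      then show ?thesis using cu by (simp add: h_def)
    next
      case False
      then have "t \<le> norm (x - y)"
        using xz norm_triangle_ineq4[of "x - z" "x - y"] by (simp add: dist_norm norm_minus_commute)
      then show ?thesis using bd[of "x - y"] False by (simp add: h_def)
    qed
  qed
  also have "\<dots> = cu * (\<integral>y. ?p y \<partial>lborel)"
    using integral_reflect_translate[of ?p x] tail(1) by simp
  also have "\<dots> \<le> cu * T" using cu tail(2) by (intro mult_left_mono) auto
  finally have "(\<integral>y. \<bar>h y\<bar> \<partial>lborel) / u \<le> cu * T / u" using u by (intro divide_right_mono) auto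
  moreover have "prob {\<omega>\<in>space M. u \<le> \<bar>far_shot g R z x \<omega>\<bar>} \<le> (\<integral>y. \<bar>h y\<bar> \<partial>lborel) / u"
    using prob_abs_integral_N_ge[OF h u] by (simp add: h_def far_shot_def)
  ultimately show ?thesis by linarith
qed

lemma variance_ge_power_decay:
  fixes g :: "'a \<Rightarrow> real" and cl cu \<delta> \<gamma> cg :: real
  assumes u: "u > 0" and cont: "continuous_on UNIV g" and g: "integrable lborel g" and g0: "g 0 > 0"
    and c: "cl > 0" "cu > 0" "cg \<ge> 1" and \<delta>: "\<delta> > 3 * real DIM('a)" "\<delta> \<le> \<gamma>" "\<gamma> < \<delta> + DIM('a) / 2"
    and bd: "\<And>x. norm x \<ge> cg \<Longrightarrow> cl * norm x powr (- \<gamma>) \<le> \<bar>g x\<bar> \<and> \<bar>g x\<bar> \<le> cu * norm x powr (- \<delta>)"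
  shows "\<exists>c>0. \<forall>s\<ge>1. c * s ^ DIM('a) \<le> variance (\<lambda>\<omega>. excursion_volume g u (\<eta> \<omega>) s)"
proof -
  let ?d = "real DIM('a)"
  have [measurable]: "g \<in> borel_measurable borel" using g by simp
  have d1: "?d \<ge> 1" using DIM_positive[where 'a='a] by linarith
  have \<delta>0: "\<delta> > 0" "\<delta> > ?d" using \<delta>(1) d1 by linarith+
  obtain r where r: "0 < r" "r \<le> 1 / 2" "\<And>v. norm v \<le> 2 * r \<Longrightarrow> g 0 / 2 \<le> g v"
    using ex_positive_near_zero[OF cont g0] by blast
  \<comment> \<open>Twice the level has to be gained here, since the far field is only known to
    exceed -u with high probability.\<close>
  define k where "k = nat \<lceil>4 * u / g 0\<rceil> + 1"
  have k1: "k \<ge> 1" by (simp add: k_def)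
  have ku: "2 * u \<le> real k * (g 0 / 2)"
  proof -
    have "4 * u / g 0 \<le> real k" unfolding k_def by linarith
    then show ?thesis using g0 by (simp add: field_simps)
  qed
  obtain C where C: "C > 0"
    "\<And>t. t > 0 \<Longrightarrow> integrable lborel (\<lambda>y::'a. norm y powr - \<delta> * indicator {y. t \<le> norm y} y)"
    "\<And>t. t > 0 \<Longrightarrow> (\<integral>y. norm y powr - \<delta> * indicator {y. t \<le> norm y} (y::'a) \<partial>lborel) \<le> C * t powr (?d - \<delta>)"
    using power_tail_integral[OF \<delta>0(2)] by blast
  obtain B where B: "B \<ge> 0"
    "\<And>z x R b v e. cg \<le> b \<Longrightarrow> R - b \<le> norm (x - z) \<Longrightarrow> e > 0 \<Longrightarrow>
      prob {\<omega>\<in>space M. \<bar>far_shot g R z x \<omega> - v\<bar> \<le> e} \<le> e * (2 * (b powr \<delta> / cu) + B)"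
    using prob_far_shot_near_le[OF g c \<delta>0(1) \<delta>(2,3) bd] by blast
  define V where "V = measure lborel (cball (0::'a) 1)"
  \<comment> \<open>Makes \<open>a2 * w powr - \<delta>\<close> half of the largest loss
    \<open>k * cu * (w / 2) powr - \<delta>\<close> that k core points can cause at distance
    w.\<close>
  define a2 where "a2 = real k * cu * 2 powr \<delta> / 2"
  have a2: "a2 > 0" using k1 c by (simp add: a2_def)
  \<comment> \<open>Besides the smallness, sqrt R >= cg admits the depth b = sqrt R, and R >= 4 cg
    gives w/2 >= cg in the outer region, where the decay of g is applied to core points.\<close>
  obtain R where R: "R \<ge> max (4 * cg) (cg\<^sup>2)"
    "(cu * C / u * V) * R powr ?d * sqrt R powr (?d - \<delta>) + (a2 * C) * (2 / cu * sqrt R powr \<delta> + B) * (R / 2) powr (?d - \<delta>)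
      \<le> measure lborel (cball (0::'a) r) / 4"
    using ex_radius[of ?d \<delta> "measure lborel (cball (0::'a) r) / 4" "max (4 * cg) (cg\<^sup>2)" "cu * C / u * V" "a2 * C" "2 / cu" B]
      \<delta>(1) d1 r(1) by (auto simp: content_cball)
  have R4: "R \<ge> 4" "R \<ge> 4 * cg" and Rcg: "cg \<le> sqrt R"
    using R(1) c by (auto intro: real_le_rsqrt)
  have sR: "2 \<le> sqrt R" using R4 by (intro real_le_rsqrt) simp
  have RR: "sqrt R * 2 \<le> R"
    using mult_left_mono[OF sR, of "sqrt R"] R4 by simp
  \<comment> \<open>The Markov bound for the inner region; \<open>\<beta>2\<close> is the
    concentration bound at depth sqrt R for the outer region, without its factor
    \<open>w powr - \<delta>\<close>.\<close>
  define \<beta>1 where "\<beta>1 = cu * (C * sqrt R powr (?d - \<delta>)) / u"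
  define \<beta>2 where "\<beta>2 = a2 * (2 * (sqrt R powr \<delta> / cu) + B)"
  have \<beta>0: "\<beta>1 \<ge> 0" "\<beta>2 \<ge> 0" using C c u a2 B(1) by (simp_all add: \<beta>1_def \<beta>2_def)
  let ?p = "\<lambda>y::'a. norm y powr - \<delta> * indicator {y. R / 2 \<le> norm y} y"
  \<comment> \<open>The two supports overlap on purpose: as R - sqrt R >= R/2, the ball of radius R
    and the tail from R/2 cover the two regions at the price of constants only.\<close>
  define \<beta> where "\<beta> w = \<beta>1 * indicator (cball 0 R) w + \<beta>2 * ?p w" for w :: 'a
  have ip: "integrable lborel ?p" using C(2)[of "R / 2"] R4 by simp
  have fin: "emeasure lborel (cball (0::'a) R) < \<infinity>" using emeasure_bounded_finite[of "cball (0::'a) R"] by simp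
  have i\<beta>: "integrable lborel \<beta>"
    unfolding \<beta>_def using ip fin
    by (intro Bochner_Integration.integrable_add integrable_mult_right integrable_real_indicator) auto
  have "(\<integral>w. \<beta> w \<partial>lborel) = \<beta>1 * measure lborel (cball (0::'a) R) + \<beta>2 * (\<integral>y. ?p y \<partial>lborel)"
    unfolding \<beta>_def using ip fin by (subst Bochner_Integration.integral_add) auto
  also have "\<dots> \<le> \<beta>1 * (V * R powr ?d) + \<beta>2 * (C * (R / 2) powr (?d - \<delta>))"
    using \<beta>0 C(3)[of "R / 2"] R4
    by (intro add_mono mult_left_mono) (auto simp: V_def content_cball powr_realpow)
  also have "\<dots> = (cu * C / u * V) * R powr ?d * sqrt R powr (?d - \<delta>) + (a2 * C) * (2 / cu * sqrt R powr \<delta> + B) * (R / 2) powr (?d - \<delta>)"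
    by (simp add: \<beta>1_def \<beta>2_def mult_ac)
  finally have I\<beta>: "(\<integral>w. \<beta> w \<partial>lborel) \<le> measure lborel (cball (0::'a) r) / 4" using R(2) by linarith
  have sR0: "sqrt R > 0" using R4 by simp
  have tail: "prob {\<omega>\<in>space M. u \<le> \<bar>far_shot g R z x \<omega>\<bar>} \<le> \<beta>1" if "norm (x - z) \<le> R - sqrt R" for x z
    unfolding \<beta>1_def
    by (rule prob_far_shot_ge[OF g u c(2) sR0 that _ C(2)[OF sR0] C(3)[OF sR0]]) (use bd Rcg in force)
  show ?thesis
  proof (rule variance_excursion_volume_ge[OF g r(1,2) _ k1 i\<beta> _ I\<beta>])
    show "r \<le> R" using r R4 by simp
    show "\<beta> w \<ge> 0" for w using \<beta>0 by (simp add: \<beta>_def)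
    fix z x :: 'a
    let ?X = "far_shot g R z x"
    have mono: "prob {\<omega>\<in>space M. P \<omega>} \<le> prob {\<omega>\<in>space M. Q \<omega>}"
      if "\<And>\<omega>. \<omega> \<in> space M \<Longrightarrow> P \<omega> \<Longrightarrow> Q \<omega>" "{\<omega>\<in>space M. Q \<omega>} \<in> events" for P Q
      using that by (intro finite_measure_mono) auto
    show "\<exists>m. (\<forall>y\<in>cball z r. m \<le> g (x - y)) \<and>
      1 / 2 * indicator (cball z r) x - \<beta> (x - z) \<le>
      prob {\<omega>\<in>space M. u \<le> ?X \<omega> + real k * m} - prob {\<omega>\<in>space M. u \<le> ?X \<omega>}"
    proof (cases "norm (x - z) \<le> R - sqrt R")
      case near: True
      have "norm (x - z) \<le> R" using near sR0 by linarith
      then have "x - z \<in> cball 0 R" by simp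
      then have \<beta>ge: "\<beta>1 \<le> \<beta> (x - z)" using \<beta>0 by (simp add: \<beta>_def)
      have up: "prob {\<omega>\<in>space M. u \<le> ?X \<omega>} \<le> prob {\<omega>\<in>space M. u \<le> \<bar>?X \<omega>\<bar>}"
        by (rule mono) auto
      show ?thesis
      proof (cases "x \<in> cball z r")
        case True
        have m: "g 0 / 2 \<le> g (x - y)" if "y \<in> cball z r" for y
          using True that norm_triangle_ineq4[of "x - z" "y - z"]
          by (intro r(3)) (simp add: dist_norm norm_minus_commute)
        \<comment> \<open>The events |X| < u and X >= u are disjoint, and on both of them X plus the
          gain 2 u reaches the level.\<close>
        have "1 - prob {\<omega>\<in>space M. u \<le> \<bar>?X \<omega>\<bar>} + prob {\<omega>\<in>space M. u \<le> ?X \<omega>}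
          \<le> prob {\<omega>\<in>space M. u \<le> ?X \<omega> + real k * (g 0 / 2)}"
        proof -
          have "prob {\<omega>\<in>space M. \<not> u \<le> \<bar>?X \<omega>\<bar>} = 1 - prob {\<omega>\<in>space M. u \<le> \<bar>?X \<omega>\<bar>}"
            by (rule prob_neg) measurable
          moreover have "prob ({\<omega>\<in>space M. \<not> u \<le> \<bar>?X \<omega>\<bar>} \<union> {\<omega>\<in>space M. u \<le> ?X \<omega>}) =
            prob {\<omega>\<in>space M. \<not> u \<le> \<bar>?X \<omega>\<bar>} + prob {\<omega>\<in>space M. u \<le> ?X \<omega>}"
            by (rule finite_measure_Union) auto
          moreover have "prob ({\<omega>\<in>space M. \<not> u \<le> \<bar>?X \<omega>\<bar>} \<union> {\<omega>\<in>space M. u \<le> ?X \<omega>}) \<le>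
            prob {\<omega>\<in>space M. u \<le> ?X \<omega> + real k * (g 0 / 2)}"
            using ku u by (intro finite_measure_mono) auto
          ultimately show ?thesis by linarith
        qed
        then show ?thesis
          using m tail[OF near] \<beta>ge True by (intro exI[of _ "g 0 / 2"]) (simp add: indicator_def)
      next
        case False
        obtain m where "\<And>y. y \<in> cball z r \<Longrightarrow> m \<le> g (x - y)"
          using ex_lower_bound_cball[OF cont, where z=z and r=r and x=x] by blast
        moreover have "prob {\<omega>\<in>space M. u \<le> ?X \<omega>} \<le> \<beta> (x - z)"
          using up tail[OF near] \<beta>ge by linarith
        then have "- \<beta> (x - z) \<le> prob {\<omega>\<in>space M. u \<le> ?X \<omega> + real k * m} - prob {\<omega>\<in>space M. u \<le> ?X \<omega>}"
          using measure_nonneg[of M "{\<omega>\<in>space M. u \<le> ?X \<omega> + real k * m}"] by linarith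
        ultimately show ?thesis
          using False by (intro exI[of _ m]) (simp add: indicator_def)
      qed
    next
      case far: False
      define w where "w = norm (x - z)"
      have w: "R / 2 \<le> w" "R - sqrt R \<le> w" using far RR by (simp_all add: w_def)
      have w2: "w \<ge> 2" using w R4 by simp
      \<comment> \<open>The worst case: a core point is at distance at least w/2 from x, and the
        sign of g there is unknown.\<close>
      define m where "m = - (cu * (w / 2) powr - \<delta>)"
      have notin: "x \<notin> cball z r" using w2 r by (simp add: w_def dist_norm norm_minus_commute)
      define e where "e = - (real k * m) / 2"
      have e0: "e > 0" using k1 c w2 by (simp add: e_def m_def)
      have e: "e = a2 * w powr - \<delta>"
        using w2 by (simp add: e_def m_def a2_def powr_divide powr_minus divide_simps)
      \<comment> \<open>As k m = -2 e, a location drops out of the excursion set only if X lies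
        between u and u + 2 e, the interval of radius e around u + e.\<close>
      have "prob {\<omega>\<in>space M. u \<le> ?X \<omega>} \<le> prob ({\<omega>\<in>space M. u \<le> ?X \<omega> + real k * m} \<union> {\<omega>\<in>space M. \<bar>?X \<omega> - (u + e)\<bar> \<le> e})"
        by (intro finite_measure_mono) (auto simp: e_def abs_le_iff)
      also have "\<dots> \<le> prob {\<omega>\<in>space M. u \<le> ?X \<omega> + real k * m} + prob {\<omega>\<in>space M. \<bar>?X \<omega> - (u + e)\<bar> \<le> e}"
        by (intro measure_Un_le) measurable
      also have "prob {\<omega>\<in>space M. \<bar>?X \<omega> - (u + e)\<bar> \<le> e} \<le> e * (2 * (sqrt R powr \<delta> / cu) + B)"
        using w(2) by (intro B(2) Rcg e0) (simp add: w_def)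
      also have "\<dots> = \<beta>2 * w powr - \<delta>" by (simp add: e \<beta>2_def)
      also have "\<dots> \<le> \<beta> (x - z)"
        using \<beta>0 w(1) by (simp add: \<beta>_def w_def)
      finally have "- \<beta> (x - z) \<le> prob {\<omega>\<in>space M. u \<le> ?X \<omega> + real k * m} - prob {\<omega>\<in>space M. u \<le> ?X \<omega>}"
        by linarith
      moreover have "m \<le> g (x - y)" if y: "y \<in> cball z r" for y
      proof -
        have n: "w / 2 \<le> norm (x - y)"
          using y norm_triangle_ineq4[of "x - y" "z - y"] w2 r by (simp add: w_def dist_norm)
        have "cg \<le> norm (x - y)" using n w(1) R4(2) by linarith
        then have "\<bar>g (x - y)\<bar> \<le> cu * norm (x - y) powr - \<delta>" using bd by blast
        also have "\<dots> \<le> cu * (w / 2) powr - \<delta>"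
          using n w2 \<delta>0 c by (intro mult_left_mono powr_mono2') auto
        finally show ?thesis unfolding m_def by linarith
      qed
      ultimately show ?thesis
        using notin by (intro exI[of _ m]) auto
    qed
  qed
qed

end

theorem theorem5p1:
  fixes M :: "'w measure"
    and \<eta> :: "'w \<Rightarrow> 'a::euclidean_space set"
    and g :: "'a \<Rightarrow> real"
    and u :: real
  assumes "poisson_process M (lborel :: 'a measure) \<eta>"
    and "u > 0"
    and "continuous_on UNIV g"
    and "integrable lborel g"
    and "g 0 > 0"
  shows
    "((\<exists>(cl::real) (cu::real) (\<delta>::real) (\<gamma>::real) (cg::real). cl > 0 \<and> cu > 0 \<and> \<delta> > 0 \<and> \<gamma> > 0 \<and> cg \<ge> 1 \<and>
         \<delta> + real DIM('a) / 2 > \<gamma> \<and> \<gamma> \<ge> \<delta> \<and> \<delta> > 3 * real DIM('a) \<and>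
         (\<forall>x. norm x \<ge> cg \<longrightarrow>
            cl * norm x powr (- \<gamma>) \<le> \<bar>g x\<bar> \<and> \<bar>g x\<bar> \<le> cu * norm x powr (- \<delta>)))
      \<longrightarrow> (\<exists>c::real>0. \<forall>s::real\<ge>1. prob_space.variance M (\<lambda>\<omega>. excursion_volume g u (\<eta> \<omega>) s) \<ge> c * s ^ DIM('a))) \<and>
     (compact (closure {x. g x \<noteq> 0})
      \<longrightarrow> (\<exists>c::real>0. \<forall>s::real\<ge>1. prob_space.variance M (\<lambda>\<omega>. excursion_volume g u (\<eta> \<omega>) s) \<ge> c * s ^ DIM('a)))"
proof -
  interpret poisson_lborel M \<eta> by unfold_locales (rule assms(1))
  show ?thesis
  proof (intro conjI impI, elim exE conjE)
    fix cl cu \<delta> \<gamma> cg :: real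
    assume "cl > 0" "cu > 0" "cg \<ge> 1" "\<delta> + real DIM('a) / 2 > \<gamma>" "\<gamma> \<ge> \<delta>" "\<delta> > 3 * real DIM('a)"
      and "\<forall>x. norm x \<ge> cg \<longrightarrow> cl * norm x powr (- \<gamma>) \<le> \<bar>g x\<bar> \<and> \<bar>g x\<bar> \<le> cu * norm x powr (- \<delta>)"
    then show "\<exists>c>0. \<forall>s\<ge>1. variance (\<lambda>\<omega>. excursion_volume g u (\<eta> \<omega>) s) \<ge> c * s ^ DIM('a)"
      using assms(2-5) by (intro variance_ge_power_decay[of u g cl cu cg \<delta> \<gamma>]) auto
  next
    assume "compact (closure {x. g x \<noteq> 0})"
    then show "\<exists>c>0. \<forall>s\<ge>1. variance (\<lambda>\<omega>. excursion_volume g u (\<eta> \<omega>) s) \<ge> c * s ^ DIM('a)"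
      using assms(2-5) by (intro variance_ge_compact_support)
  qed
qed

end
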